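(* Let $p,q,m,n,k$ be nonnegative integers. The images of the universal enveloping algebras of $gl(p|q)$ and $gl(m|n)$ in $\mathrm{End}\bigl(S^k(\mathbb{C}^{p|q}\otimes\mathbb{C}^{m|n})\bigr)$ are double commutants, i.e. each of the two images is the full (super)centralizer of the other.
   Context: $\mathbb{C}^{m|n}$ is the complex superspace with even part of dimension $m$ and odd part of dimension $n$, and $gl(m|n)$ is the Lie superalgebra of its linear endomorphisms. For a superspace $V$, $S(V)=\bigoplus_kS^k(V)$ is the symmetric algebra in the super sense, i.e. the tensor product of the symmetric algebra of the even part and the exterior algebra of the odd part of $V$, graded by giving elements of $V$ degree $1$. The natural actions of $gl(p|q)$ on $\mathbb{C}^{p|q}$ and of $gl(m|n)$ on $\mathbb{C}^{m|n}$ induce (super)commuting actions on $S^k(\mathbb{C}^{p|q}\otimes\mathbb{C}^{m|n})$. Commutants are taken in the super sense. *)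

theory Defs
  imports
    "Jordan_Normal_Form.Matrix"
    "HOL-Library.Poly_Mapping"
    "HOL-Library.FuncSet"
    "HOL-Library.Multiset"
begin

section \<open>Superspaces with a homogeneous basis\<close>

text \<open>
  A finite-dimensional complex superspace is given by its dimension and the parities (0 or 1)
  of the vectors \<open>b\<^sub>0, b\<^sub>1, \<dots>\<close> of a homogeneous basis.  Its endomorphisms are the square matrices
  of that size, \<open>X $$ (i, j)\<close> being the coefficient of \<open>b\<^sub>i\<close> in \<open>X b\<^sub>j\<close>.
\<close>

record superspace =
  sdim :: nat
  par :: "nat \<Rightarrow> nat"

definition CC :: "nat \<Rightarrow> nat \<Rightarrow> superspace" where
  "CC p q = \<lparr>sdim = p + q, par = (\<lambda>i. if i < p then 0 else 1)\<rparr>"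

text \<open>The basis vector \<open>b\<^sub>i \<otimes> c\<^sub>a\<close> of the tensor product has the index \<open>i * sdim W + a\<close>.\<close>

definition stensor :: "superspace \<Rightarrow> superspace \<Rightarrow> superspace" where
  "stensor V W = \<lparr>sdim = sdim V * sdim W,
     par = (\<lambda>u. (par V (u div sdim W) + par W (u mod sdim W)) mod 2)\<rparr>"

definition gl :: "superspace \<Rightarrow> complex mat set" where
  "gl V = carrier_mat (sdim V) (sdim V)"

definition gl_homog :: "superspace \<Rightarrow> nat \<Rightarrow> complex mat set" where
  "gl_homog V d = {X \<in> gl V. \<forall>i < sdim V. \<forall>j < sdim V.
     X $$ (i, j) \<noteq> 0 \<longrightarrow> (par V i + par V j) mod 2 = d}"

text \<open>The bracket of the Lie superalgebra \<open>gl V\<close> on elements of parities \<open>d\<close> and \<open>e\<close>.\<close>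

definition gl_bracket :: "nat \<Rightarrow> nat \<Rightarrow> complex mat \<Rightarrow> complex mat \<Rightarrow> complex mat" where
  "gl_bracket d e X Y = X * Y - ((-1) ^ (d * e)) \<cdot>\<^sub>m (Y * X)"

text \<open>\<open>X \<otimes> 1\<close>: \<open>v \<otimes> w \<mapsto> X v \<otimes> w\<close>.\<close>

definition act_fst :: "superspace \<Rightarrow> superspace \<Rightarrow> complex mat \<Rightarrow> complex mat" where
  "act_fst V W X = mat (sdim V * sdim W) (sdim V * sdim W) (\<lambda>(u, v).
     if u mod sdim W = v mod sdim W then X $$ (u div sdim W, v div sdim W) else 0)"

text \<open>
  \<open>1 \<otimes> Y\<close>: \<open>v \<otimes> w \<mapsto> (-1)\<^bsup>|Y||v|\<^esup> v \<otimes> Y w\<close>.  The parity of the matrix unit with entry \<open>(a, b)\<close> is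
  \<open>|a| + |b|\<close>, so the formula also covers inhomogeneous \<open>Y\<close>.
\<close>

definition act_snd :: "superspace \<Rightarrow> superspace \<Rightarrow> complex mat \<Rightarrow> complex mat" where
  "act_snd V W Y = mat (sdim V * sdim W) (sdim V * sdim W) (\<lambda>(u, v).
     if u div sdim W = v div sdim W
     then (-1) ^ ((par W (u mod sdim W) + par W (v mod sdim W)) * par V (v div sdim W))
            * Y $$ (u mod sdim W, v mod sdim W)
     else 0)"


section \<open>The symmetric superalgebra\<close>

text \<open>
  \<open>S(V) = Sym(V\<^sub>0) \<otimes> \<Lambda>(V\<^sub>1)\<close> has the basis of pairs \<open>(\<alpha>, B)\<close>: the multiset \<open>\<alpha>\<close> of even indices stands
  for the monomial \<open>\<Prod>i\<in>#\<alpha>. b\<^sub>i\<close>, and the set \<open>B = {j\<^sub>1 < \<dots> < j\<^sub>r}\<close> of odd indices for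
  \<open>b\<^bsub>j\<^sub>1\<^esub> \<and> \<dots> \<and> b\<^bsub>j\<^sub>r\<^esub>\<close>.  A vector is represented by its coefficient function.
\<close>

type_synonym smonom = "nat multiset \<times> nat set"
type_synonym svec = "smonom \<Rightarrow> complex"

definition smonoms :: "superspace \<Rightarrow> nat \<Rightarrow> smonom set" where
  "smonoms V k = {(\<alpha>, B). set_mset \<alpha> \<subseteq> {i. i < sdim V \<and> par V i = 0} \<and>
     B \<subseteq> {i. i < sdim V \<and> par V i = 1} \<and> size \<alpha> + card B = k}"

definition Sym :: "superspace \<Rightarrow> nat \<Rightarrow> svec set" where
  "Sym V k = {f. \<forall>M. M \<notin> smonoms V k \<longrightarrow> f M = 0}"

text \<open>The sign from moving \<open>b\<^sub>u\<close> past the factors of \<open>B\<close> that precede it.\<close>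

definition jw_sign :: "nat \<Rightarrow> nat set \<Rightarrow> complex" where
  "jw_sign u B = (-1) ^ card {b \<in> B. b < u}"

text \<open>Left multiplication by the generator \<open>b\<^sub>u\<close> of \<open>S(V)\<close>.\<close>

definition var_mult :: "superspace \<Rightarrow> nat \<Rightarrow> svec \<Rightarrow> svec" where
  "var_mult V u f = (\<lambda>(\<alpha>, B).
     if par V u = 0 then (if u \<in># \<alpha> then f (\<alpha> - {#u#}, B) else 0)
     else (if u \<in> B then jw_sign u B * f (\<alpha>, B - {u}) else 0))"

text \<open>The (left) partial superderivation \<open>\<partial>/\<partial>b\<^sub>u\<close> of \<open>S(V)\<close>.\<close>

definition var_deriv :: "superspace \<Rightarrow> nat \<Rightarrow> svec \<Rightarrow> svec" where
  "var_deriv V u f = (\<lambda>(\<alpha>, B).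
     if par V u = 0 then of_nat (Suc (count \<alpha> u)) * f (add_mset u \<alpha>, B)
     else (if u \<in> B then 0 else jw_sign u B * f (\<alpha>, insert u B)))"

text \<open>
  The superderivation \<open>\<Sum>\<^sub>v (T b\<^sub>v) \<partial>/\<partial>b\<^sub>v\<close> of \<open>S(V)\<close> that extends the endomorphism \<open>T\<close> of \<open>V\<close>.
  That it kills constants and satisfies the super Leibniz rule on products \<open>b\<^sub>u f\<close>,
  which determines it, is \<open>sder_const\<close> and \<open>sder_var_mult\<close> below.
\<close>

definition sder :: "superspace \<Rightarrow> complex mat \<Rightarrow> svec \<Rightarrow> svec" where
  "sder V T f = (\<lambda>M. \<Sum>u < sdim V. \<Sum>v < sdim V.
     T $$ (u, v) * var_mult V u (var_deriv V v f) M)"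

lemma sder_const: "sder V T (\<lambda>M. if M = ({#}, {}) then c else 0) = (\<lambda>M. 0)"
proof -
  have "var_deriv V v (\<lambda>M. if M = ({#}, {}) then c else 0) = (\<lambda>M. 0)" for v
    by (auto simp: var_deriv_def fun_eq_iff)
  moreover have "var_mult V u (\<lambda>M. 0) = (\<lambda>M. 0)" for u
    by (auto simp: var_mult_def fun_eq_iff)
  ultimately show ?thesis by (simp add: sder_def)
qed

lemma jw_sign_insert: "b \<notin> B \<Longrightarrow> jw_sign u (insert b B) = (if b < u then - jw_sign u B else jw_sign u B)"
proof -
  assume b: "b \<notin> B"
  have "{x \<in> insert b B. x < u} = (if b < u then insert b {x \<in> B. x < u} else {x \<in> B. x < u})"
    by auto
  then show ?thesis using b by (simp add: jw_sign_def)
qed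

lemma jw_sign_remove: "b \<in> B \<Longrightarrow> jw_sign u (B - {b}) = (if b < u then - jw_sign u B else jw_sign u B)"
  using jw_sign_insert[of b "B - {b}" u] by (auto simp: insert_absorb)

lemma jw_sign_square [simp]: "jw_sign u B * jw_sign u B = 1"
  by (simp add: jw_sign_def flip: power_add mult_2)

lemma var_mult_commute:
  assumes p: "par V u \<in> {0, 1}" "par V w \<in> {0, 1}"
  shows "var_mult V w (var_mult V u f) M = (-1) ^ (par V u * par V w) * var_mult V u (var_mult V w f) M"
proof (cases M)
  case (Pair \<alpha> B)
  show ?thesis
  proof (cases "u = w")
    case True
    then show ?thesis using p by (auto simp: Pair var_mult_def)
  next
    case False
    then have ne: "w \<noteq> u" by simp
    have 1: "f (\<alpha> - {#u#} - {#w#}, B) = f (\<alpha> - {#w#} - {#u#}, B)"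
      by (simp add: diff_diff_add_mset add_mset_commute)
    have 2: "f (\<alpha>, B - {u} - {w}) = f (\<alpha>, B - {w} - {u})"
      by (simp add: Diff_insert2[symmetric] insert_commute)
    have 3: "u \<in># \<alpha> - {#w#} \<longleftrightarrow> u \<in># \<alpha>" "w \<in># \<alpha> - {#u#} \<longleftrightarrow> w \<in># \<alpha>"
      using False by (auto simp: in_diff_count)
    have 4: "u < w \<or> w < u" using False by auto
    consider "par V u = 0" "par V w = 0" | "par V u = 0" "par V w = 1"
      | "par V u = 1" "par V w = 0" | "par V u = 1" "par V w = 1"
      using p by auto
    then show ?thesis
    proof cases
      case 1
      then show ?thesis using \<open>f (\<alpha> - {#u#} - {#w#}, B) = _\<close>
        by (simp only: Pair var_mult_def prod.case 3 if_True) simp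
    next
      case 4
      then show ?thesis using 2 False ne \<open>u < w \<or> w < u\<close>
        by (cases "u \<in> B"; cases "w \<in> B") (auto simp: Pair var_mult_def jw_sign_remove)
    qed (simp_all add: Pair var_mult_def)
  qed
qed

lemma var_deriv_var_mult:
  assumes p: "par V u \<in> {0, 1}" "par V v \<in> {0, 1}"
  shows "var_deriv V v (var_mult V u f) =
    (\<lambda>M. (if u = v then f M else 0) + (-1) ^ (par V u * par V v) * var_mult V u (var_deriv V v f) M)"
proof (rule ext)
  fix M :: smonom
  obtain \<alpha> B where M: "M = (\<alpha>, B)" by (cases M)
  show "var_deriv V v (var_mult V u f) M =
    (if u = v then f M else 0) + (-1) ^ (par V u * par V v) * var_mult V u (var_deriv V v f) M"
  proof (cases "u = v")
    case True
    show ?thesis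
    proof (cases "par V u = 0")
      case even: True
      show ?thesis
      proof (cases "u \<in># \<alpha>")
        case True
        then obtain \<beta> where "\<alpha> = add_mset u \<beta>" by (meson mset_add)
        then show ?thesis using \<open>u = v\<close> even
          by (simp add: M var_mult_def var_deriv_def algebra_simps)
      next
        case False
        then show ?thesis using \<open>u = v\<close> even
          by (simp add: M var_mult_def var_deriv_def count_eq_zero_iff)
      qed
    next
      case False
      then show ?thesis using True p
        by (auto simp: M var_mult_def var_deriv_def jw_sign_insert jw_sign_remove insert_absorb
            simp flip: mult.assoc)
    qed
  next
    case False
    then have ne: "v \<noteq> u" by simp
    consider "par V u = 0" "par V v = 0" | "par V u = 0" "par V v = 1"
      | "par V u = 1" "par V v = 0" | "par V u = 1" "par V v = 1"
      using p by auto
    then show ?thesis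
    proof cases
      case 1
      show ?thesis
      proof (cases "u \<in># \<alpha>")
        case True
        then obtain \<beta> where "\<alpha> = add_mset u \<beta>" by (meson mset_add)
        moreover have "add_mset v (add_mset u \<beta>) - {#u#} = add_mset v \<beta>" by simp
        ultimately show ?thesis using 1 False ne
          by (simp add: M var_mult_def var_deriv_def)
      qed (use 1 False ne in \<open>simp add: M var_mult_def var_deriv_def\<close>)
    next
      case 4
      have "insert v B - {u} = insert v (B - {u})" using False by blast
      moreover have "u < v \<or> v < u" using False by auto
      ultimately show ?thesis using 4 False ne
        by (cases "u \<in> B"; cases "v \<in> B")
          (auto simp add: M var_mult_def var_deriv_def jw_sign_insert jw_sign_remove)
    qed (use False in \<open>simp_all add: M var_mult_def var_deriv_def\<close>)
  qed
qed

lemma var_mult_add: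
  "var_mult V w (\<lambda>M. f M + g M) M = var_mult V w f M + var_mult V w g M"
  by (cases M) (simp add: var_mult_def algebra_simps)

lemma var_mult_cmult: "var_mult V w (\<lambda>M. c * f M) M = c * var_mult V w f M"
  by (cases M) (simp add: var_mult_def)

lemma var_mult_sum:
  "var_mult V w (\<lambda>M. \<Sum>i \<in> A. f i M) M = (\<Sum>i \<in> A. var_mult V w (f i) M)"
  by (cases M) (simp add: var_mult_def sum_distrib_left)

lemma sder_var_mult:
  assumes p: "\<And>i. par V i \<in> {0, 1}" and T: "T \<in> gl_homog V d" and u: "u < sdim V"
  shows "sder V T (var_mult V u f) M =
    (\<Sum>w < sdim V. T $$ (w, u) * var_mult V w f M)
      + (-1) ^ (d * par V u) * var_mult V u (sder V T f) M"
proof -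
  have *: "T $$ (w, v) * var_mult V w (var_deriv V v (var_mult V u f)) M =
      (if u = v then T $$ (w, v) * var_mult V w f M else 0)
      + (-1) ^ (d * par V u) * (T $$ (w, v) * var_mult V u (var_mult V w (var_deriv V v f)) M)"
    if "w < sdim V" "v < sdim V" for w v
  proof (cases "T $$ (w, v) = 0")
    case False
    then have d: "d = (par V w + par V v) mod 2" using T that by (auto simp: gl_homog_def)
    have z: "var_mult V w (\<lambda>M. 0) M = 0" by (cases M) (simp add: var_mult_def)
    have sg: "(-1 :: complex) ^ (par V u * par V v) * (-1) ^ (par V u * par V w) = (-1) ^ (d * par V u)"
      using p[of u] p[of v] p[of w] unfolding d by auto
    have "var_mult V w (var_deriv V v (var_mult V u f)) M = (if u = v then var_mult V w f M else 0)
        + (-1) ^ (par V u * par V v) * var_mult V w (var_mult V u (var_deriv V v f)) M"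
      by (simp add: var_deriv_var_mult[OF p p] var_mult_add var_mult_cmult z)
    also have "\<dots> = (if u = v then var_mult V w f M else 0)
        + (-1) ^ (d * par V u) * var_mult V u (var_mult V w (var_deriv V v f)) M"
      by (simp only: var_mult_commute[OF p p, where u = u and w = w] mult.assoc[symmetric] sg)
    finally show ?thesis by (simp add: algebra_simps)
  qed simp
  have "sder V T (var_mult V u f) M = (\<Sum>w < sdim V. \<Sum>v < sdim V.
      (if u = v then T $$ (w, v) * var_mult V w f M else 0)
      + (-1) ^ (d * par V u) * (T $$ (w, v) * var_mult V u (var_mult V w (var_deriv V v f)) M))"
    unfolding sder_def by (intro sum.cong refl) (simp add: *)
  also have "\<dots> = (\<Sum>w < sdim V. T $$ (w, u) * var_mult V w f M)
      + (-1) ^ (d * par V u) * var_mult V u (sder V T f) M"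
    using u by (simp add: sder_def sum.distrib var_mult_sum var_mult_cmult sum_distrib_left)
  finally show ?thesis .
qed


section \<open>Endomorphisms and supercentralizers\<close>

text \<open>Linear endomorphisms of \<open>S\<^sup>k(V)\<close>, made extensional so that equality is equality on \<open>S\<^sup>k(V)\<close>.\<close>

definition End_Sym :: "superspace \<Rightarrow> nat \<Rightarrow> (svec \<Rightarrow> svec) set" where
  "End_Sym V k = {F \<in> Sym V k \<rightarrow>\<^sub>E Sym V k.
     (\<forall>f \<in> Sym V k. \<forall>g \<in> Sym V k. F (\<lambda>M. f M + g M) = (\<lambda>M. F f M + F g M)) \<and>
     (\<forall>c. \<forall>f \<in> Sym V k. F (\<lambda>M. c * f M) = (\<lambda>M. c * F f M))}"

definition par_proj :: "nat \<Rightarrow> svec \<Rightarrow> svec" where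
  "par_proj d f = (\<lambda>M. if card (snd M) mod 2 = d then f M else 0)"

text \<open>\<open>End_homog V k d\<close>: the endomorphisms of \<open>S\<^sup>k(V)\<close> of parity \<open>d\<close>.\<close>

definition End_homog :: "superspace \<Rightarrow> nat \<Rightarrow> nat \<Rightarrow> (svec \<Rightarrow> svec) set" where
  "End_homog V k d = {F \<in> End_Sym V k. \<forall>e \<in> {0, 1}. \<forall>f \<in> Sym V k.
     par_proj e f = f \<longrightarrow> par_proj ((d + e) mod 2) (F f) = F f}"

text \<open>
  The supercentralizer of \<open>A\<close>: all \<open>F = F\<^sub>0 + F\<^sub>1\<close> whose homogeneous components satisfy
  \<open>F\<^sub>d G = (-1)\<^bsup>d e\<^esup> G F\<^sub>d\<close> for all homogeneous \<open>G \<in> A\<close>, with \<open>e\<close> the parity of \<open>G\<close>.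
\<close>

definition supercommute_on ::
    "superspace \<Rightarrow> nat \<Rightarrow> nat \<Rightarrow> nat \<Rightarrow> (svec \<Rightarrow> svec) \<Rightarrow> (svec \<Rightarrow> svec) \<Rightarrow> bool" where
  "supercommute_on V k d e F G \<longleftrightarrow>
     (\<forall>f \<in> Sym V k. F (G f) = (\<lambda>M. (-1) ^ (d * e) * G (F f) M))"

definition supercentralizer ::
    "superspace \<Rightarrow> nat \<Rightarrow> (svec \<Rightarrow> svec) set \<Rightarrow> (svec \<Rightarrow> svec) set" where
  "supercentralizer V k A = {F \<in> End_Sym V k.
     \<exists>F0 \<in> End_homog V k 0. \<exists>F1 \<in> End_homog V k 1.
       (\<forall>f \<in> Sym V k. F f = (\<lambda>M. F0 f M + F1 f M)) \<and>
       (\<forall>e \<in> {0, 1}. \<forall>G \<in> A \<inter> End_homog V k e.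
          supercommute_on V k 0 e F0 G \<and> supercommute_on V k 1 e F1 G)}"


section \<open>The universal enveloping algebra of \<open>gl V\<close>\<close>

datatype 'a free_monoid = Word (letters: "'a list")

instantiation free_monoid :: (type) monoid_add
begin

definition zero_free_monoid :: "'a free_monoid" where "0 = Word []"

definition plus_free_monoid :: "'a free_monoid \<Rightarrow> 'a free_monoid \<Rightarrow> 'a free_monoid" where
  "v + w = Word (letters v @ letters w)"

instance
  by standard (simp_all add: zero_free_monoid_def plus_free_monoid_def)

end

text \<open>
  With the convolution product of \<open>HOL-Library.Poly_Mapping\<close>, this type is the free associative
  unital algebra on the set of all complex matrices; \<open>free_alg V\<close> is the free algebra
  on the set \<open>gl V\<close>.
\<close>

type_synonym falg = "complex mat free_monoid \<Rightarrow>\<^sub>0 complex"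

definition free_alg :: "superspace \<Rightarrow> falg set" where
  "free_alg V = {t. \<forall>w \<in> Poly_Mapping.keys t. set (letters w) \<subseteq> gl V}"

definition gen :: "complex mat \<Rightarrow> falg" where
  "gen X = Poly_Mapping.single (Word [X]) 1"

definition scalar :: "complex \<Rightarrow> falg" where
  "scalar c = Poly_Mapping.single 0 c"

text \<open>
  The defining two-sided ideal of \<open>U(gl V)\<close>.  As the free algebra is taken on the set \<open>gl V\<close>, the
  relations \<open>add\<close> and \<open>smult\<close> are needed to make \<open>gen\<close> linear; they turn the
  free algebra into the tensor algebra of \<open>gl V\<close>.
\<close>

inductive_set env_ideal :: "superspace \<Rightarrow> falg set" for V :: superspace where
  add: "X \<in> gl V \<Longrightarrow> Y \<in> gl V \<Longrightarrow> gen (X + Y) - (gen X + gen Y) \<in> env_ideal V"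
| smult: "X \<in> gl V \<Longrightarrow> gen (c \<cdot>\<^sub>m X) - scalar c * gen X \<in> env_ideal V"
| bracket: "d \<in> {0, 1} \<Longrightarrow> e \<in> {0, 1} \<Longrightarrow> X \<in> gl_homog V d \<Longrightarrow> Y \<in> gl_homog V e \<Longrightarrow>
    gen X * gen Y - scalar ((-1) ^ (d * e)) * gen Y * gen X - gen (gl_bracket d e X Y)
      \<in> env_ideal V"
| zero: "0 \<in> env_ideal V"
| sum: "s \<in> env_ideal V \<Longrightarrow> t \<in> env_ideal V \<Longrightarrow> s + t \<in> env_ideal V"
| mult: "a \<in> free_alg V \<Longrightarrow> b \<in> free_alg V \<Longrightarrow> t \<in> env_ideal V \<Longrightarrow> a * t * b \<in> env_ideal V"

definition U_gl :: "superspace \<Rightarrow> falg set set" where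
  "U_gl V = free_alg V // {(s, t). s \<in> free_alg V \<and> t \<in> free_alg V \<and> s - t \<in> env_ideal V}"

text \<open>
  \<open>eval_free S \<rho>\<close> is the algebra homomorphism \<open>X\<^sub>1 \<cdots> X\<^sub>r \<mapsto> \<rho>(X\<^sub>1) \<circ> \<cdots> \<circ> \<rho>(X\<^sub>r)\<close> from the free algebra to
  the endomorphisms of \<open>S\<close>; \<open>eval_env S \<rho>\<close> is the map it induces on the cosets forming \<open>U(gl V)\<close>
  (single-valued when \<open>\<rho>\<close> is a representation of the Lie superalgebra).
\<close>

definition eval_free ::
    "svec set \<Rightarrow> (complex mat \<Rightarrow> svec \<Rightarrow> svec) \<Rightarrow> falg \<Rightarrow> svec \<Rightarrow> svec" where
  "eval_free S \<rho> t = (\<lambda>f \<in> S. \<lambda>M. \<Sum>w \<in> Poly_Mapping.keys t. Poly_Mapping.lookup t w * foldr \<rho> (letters w) f M)"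

definition eval_env ::
    "svec set \<Rightarrow> (complex mat \<Rightarrow> svec \<Rightarrow> svec) \<Rightarrow> falg set \<Rightarrow> svec \<Rightarrow> svec" where
  "eval_env S \<rho> x = the_elem (eval_free S \<rho> ` x)"


section \<open>The two actions on \<open>S\<^sup>k(V \<otimes> W)\<close>\<close>

definition image_fst :: "superspace \<Rightarrow> superspace \<Rightarrow> nat \<Rightarrow> (svec \<Rightarrow> svec) set" where
  "image_fst V W k =
     eval_env (Sym (stensor V W) k) (\<lambda>X. sder (stensor V W) (act_fst V W X)) ` U_gl V"

definition image_snd :: "superspace \<Rightarrow> superspace \<Rightarrow> nat \<Rightarrow> (svec \<Rightarrow> svec) set" where
  "image_snd V W k =
     eval_env (Sym (stensor V W) k) (\<lambda>Y. sder (stensor V W) (act_snd V W Y)) ` U_gl W"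

end

theory Submission
  imports Defs "HOL-Library.Function_Algebras" "HOL-Library.Nat_Bijection"
begin

text \<open>
  Write \<open>x\<^sub>i\<^sub>a\<close> for the generators of \<open>S(V \<otimes> W)\<close> and \<open>\<partial>\<^sub>i\<^sub>a\<close> for the partial superderivations.  Matrix
  units of \<open>gl V\<close> act by \<open>E\<^sub>i\<^sub>j = \<Sum>\<^sub>a \<plusminus> x\<^sub>i\<^sub>a \<partial>\<^sub>j\<^sub>a\<close>, those of \<open>gl W\<close> by \<open>E\<^sub>a\<^sub>b = \<Sum>\<^sub>i \<plusminus> x\<^sub>i\<^sub>a \<partial>\<^sub>i\<^sub>b\<close>.  The two families
  supercommute (\<open>L_R_supercommute\<close>), so each image lies in the supercentralizer of the other.
  The statement is symmetric in \<open>V\<close> and \<open>W\<close> up to where the signs are put, so it remains to show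
  that a homogeneous \<open>F\<close> on \<open>S\<^sup>k(V \<otimes> W)\<close> that supercommutes with \<open>gl W\<close> comes from \<open>U(gl V)\<close>.  If \<open>F\<close> is
  odd, its product with the parity operator commutes with \<open>gl W\<close> in the ordinary sense, and only
  ordinary commutants have to be studied.

  The idea is to enlarge \<open>W\<close> to \<open>X = W \<oplus> V\<close>.  The space \<open>S\<^sup>k(V \<otimes> X)\<close> contains the even vector
  \<open>\<omega> = (\<Sum>\<^sub>i x\<^sub>i\<^sub>i)\<^sup>k\<close>, the sum running over a basis of \<open>V\<close> and its copy in \<open>X\<close>.  Since \<open>E\<^sub>a\<^sub>i\<close> sends
  \<open>\<Sum>\<^sub>j x\<^sub>j\<^sub>j\<close> to \<open>\<plusminus> x\<^sub>i\<^sub>a\<close>, the Leibniz rule and induction on the number of factors different from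
  \<open>\<Sum>\<^sub>j x\<^sub>j\<^sub>j\<close> show that \<open>U(gl X) \<omega>\<close> is all of \<open>S\<^sup>k(V \<otimes> X)\<close>, and in the same way that \<open>U(gl V) \<omega>\<close> is
  \<open>S\<^sup>k(V \<otimes> V)\<close> (\<open>power_vec_cyclic\<close>); this uses that the characteristic is zero.  The latter space
  is cut out by \<open>E\<^sub>a\<^sub>a = 0\<close> for the basis vectors \<open>a\<close> of \<open>W\<close>.  Hence an operator that commutes with
  \<open>gl X\<close> sends \<open>\<omega>\<close> to \<open>T \<omega>\<close> with \<open>T\<close> from \<open>U(gl V)\<close>, and as \<open>\<omega>\<close> is cyclic, it equals \<open>T\<close>.

  To pass from \<open>S\<^sup>k(V \<otimes> W)\<close> to \<open>S\<^sup>k(V \<otimes> X)\<close>, use the Fock inner product, for which \<open>x\<^sub>i\<^sub>a\<close> and \<open>\<partial>\<^sub>i\<^sub>a\<close> are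
  adjoint, so that the image of \<open>U(gl X)\<close> is closed under adjoints.  Commuting factors past one
  another shows that the compression to \<open>S\<^sup>k(V \<otimes> W)\<close> of every word in \<open>gl X\<close> still commutes with
  \<open>F\<close>.  Therefore \<open>b h \<mapsto> b (F h)\<close>, for \<open>b\<close> from \<open>U(gl X)\<close> and \<open>h\<close> from \<open>S\<^sup>k(V \<otimes> W)\<close>, is a well defined
  extension of \<open>F\<close> to \<open>U(gl X) S\<^sup>k(V \<otimes> W)\<close>, and orthogonal projection to this invariant subspace
  takes the place of an extension to all of \<open>S\<^sup>k(V \<otimes> X)\<close> (\<open>compressed_commutant\<close>).  The
  ordinary commutant is computed in \<open>column_commutant\<close> and \<open>commutant_of_R\<close>,
  the passage to enveloping algebras is \<open>image_eq\<close>, and the signs are sorted out in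
  \<open>homogeneous_commutant\<close>.
\<close>

section \<open>Commutants and compressions in finite-dimensional Hilbert spaces\<close>

definition smul :: "complex \<Rightarrow> ('x \<Rightarrow> complex) \<Rightarrow> 'x \<Rightarrow> complex" (infixr "*\<^sub>f" 75) where
  "c *\<^sub>f f = (\<lambda>M. c * f M)"

lemma smul_apply: "(c *\<^sub>f f) M = c * f M"
  by (simp add: smul_def)

lemmas pointwise = smul_apply plus_fun_apply zero_fun_apply minus_apply uminus_apply

(* Vectors are functions: without these rules, equations between vectors are not rewritten into
   equations between coefficients unless this is requested. *)
declare plus_fun_apply [simp del] zero_fun_apply [simp del] minus_apply [simp del] uminus_apply [simp del]

lemma smul_smul [simp]: "c *\<^sub>f d *\<^sub>f f = (c * d) *\<^sub>f f"
  by (simp add: fun_eq_iff pointwise)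

lemma smul_simps [simp]: "1 *\<^sub>f f = f" "0 *\<^sub>f f = 0" "c *\<^sub>f 0 = 0" "c *\<^sub>f (\<lambda>x. 0) = (\<lambda>x. 0)"
  by (simp_all add: fun_eq_iff pointwise)

lemma smul_add: "c *\<^sub>f (f + g) = c *\<^sub>f f + c *\<^sub>f g"
  by (simp add: fun_eq_iff pointwise algebra_simps)

lemma smul_diff: "c *\<^sub>f (f - g) = c *\<^sub>f f - c *\<^sub>f g"
  by (simp add: fun_eq_iff pointwise algebra_simps)

lemma sum_apply: "(\<Sum>i\<in>A. f i) M = (\<Sum>i\<in>A. f i M)" for f :: "'i \<Rightarrow> 'x \<Rightarrow> complex"
  by (induction A rule: infinite_finite_induct) (simp_all add: pointwise)

lemma diff_eq_add_smul: "f - g = f + (-1) *\<^sub>f g"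
  by (simp add: fun_eq_iff pointwise)

definition lin :: "(('x \<Rightarrow> complex) \<Rightarrow> ('y \<Rightarrow> complex)) \<Rightarrow> bool" where
  "lin T \<longleftrightarrow> (\<forall>f g. T (f + g) = T f + T g) \<and> (\<forall>c f. T (c *\<^sub>f f) = c *\<^sub>f T f)"

lemma lin_add: "lin T \<Longrightarrow> T (f + g) = T f + T g"
  by (simp add: lin_def)

lemma lin_smul: "lin T \<Longrightarrow> T (c *\<^sub>f f) = c *\<^sub>f T f"
  by (simp add: lin_def)

lemma lin_zero: "lin T \<Longrightarrow> T 0 = 0"
  using lin_smul[of T 0 0] by simp

lemma lin_diff: "lin T \<Longrightarrow> T (f - g) = T f - T g"
  unfolding diff_eq_add_smul by (simp only: lin_def)

lemma lin_sum:
  assumes "lin T"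
  shows "T (\<Sum>i\<in>A. f i) = (\<Sum>i\<in>A. T (f i))"
proof (induction A rule: infinite_finite_induct)
  case (infinite A)
  then show ?case using lin_zero[OF assms] by (metis sum.infinite)
next
  case empty
  then show ?case using lin_zero[OF assms] by (metis sum.empty)
next
  case (insert x A)
  then show ?case using lin_add[OF assms] by (metis sum.insert)
qed

lemma linI:
  assumes "\<And>f g. T (f + g) = T f + T g" "\<And>c f. T (c *\<^sub>f f) = c *\<^sub>f T f"
  shows "lin T"
  using assms by (simp add: lin_def)

lemma lin_foldr: "(\<And>s. lin (E s)) \<Longrightarrow> lin (foldr E b)"
  by (induction b) (auto simp: lin_def)

definition supp_on :: "'x set \<Rightarrow> ('x \<Rightarrow> complex) set" where
  "supp_on S = {f. \<forall>M. M \<notin> S \<longrightarrow> f M = 0}"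

lemma supp_on_zero [simp]: "0 \<in> supp_on S"
  by (simp add: supp_on_def pointwise)

lemma supp_on_add [intro]: "f \<in> supp_on S \<Longrightarrow> g \<in> supp_on S \<Longrightarrow> f + g \<in> supp_on S"
  by (simp add: supp_on_def pointwise)

lemma supp_on_smul [intro]: "f \<in> supp_on S \<Longrightarrow> c *\<^sub>f f \<in> supp_on S"
  by (simp add: supp_on_def pointwise)

lemma supp_on_diff [intro]: "f \<in> supp_on S \<Longrightarrow> g \<in> supp_on S \<Longrightarrow> f - g \<in> supp_on S"
  by (simp add: supp_on_def pointwise)

lemma supp_on_sum [intro]: "(\<And>i. i \<in> A \<Longrightarrow> f i \<in> supp_on S) \<Longrightarrow> (\<Sum>i\<in>A. f i) \<in> supp_on S"
  by (induction A rule: infinite_finite_induct) auto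

lemma supp_on_mono: "f \<in> supp_on S \<Longrightarrow> S \<subseteq> S' \<Longrightarrow> f \<in> supp_on S'"
  by (auto simp: supp_on_def pointwise)

definition restr :: "'x set \<Rightarrow> ('x \<Rightarrow> complex) \<Rightarrow> 'x \<Rightarrow> complex" where
  "restr S f = (\<lambda>M. if M \<in> S then f M else 0)"

lemma restr_in [simp]: "restr S f \<in> supp_on S"
  by (simp add: supp_on_def pointwise restr_def)

lemma restr_id: "f \<in> supp_on S \<Longrightarrow> restr S f = f"
  by (auto simp: supp_on_def pointwise restr_def)

lemma lin_restr: "lin (restr S)"
  by (auto simp: lin_def restr_def pointwise)

definition inner :: "('x \<Rightarrow> real) \<Rightarrow> 'x set \<Rightarrow> ('x \<Rightarrow> complex) \<Rightarrow> ('x \<Rightarrow> complex) \<Rightarrow> complex" where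
  "inner \<mu> S f g = (\<Sum>M\<in>S. of_real (\<mu> M) * f M * cnj (g M))"

lemma inner_add_left: "inner \<mu> S (f + g) h = inner \<mu> S f h + inner \<mu> S g h"
  by (simp add: inner_def pointwise algebra_simps sum.distrib)

lemma inner_smul_left: "inner \<mu> S (c *\<^sub>f f) h = c * inner \<mu> S f h"
  by (simp add: inner_def pointwise algebra_simps sum_distrib_left)

lemma inner_diff_left: "inner \<mu> S (f - g) h = inner \<mu> S f h - inner \<mu> S g h"
  by (simp add: inner_def pointwise algebra_simps sum_subtractf)

lemma inner_commute: "inner \<mu> S g f = cnj (inner \<mu> S f g)"
  by (simp add: inner_def pointwise algebra_simps)

lemma inner_add_right: "inner \<mu> S h (f + g) = inner \<mu> S h f + inner \<mu> S h g"
  by (simp add: inner_def pointwise algebra_simps sum.distrib)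

lemma inner_smul_right: "inner \<mu> S h (c *\<^sub>f f) = cnj c * inner \<mu> S h f"
  by (simp add: inner_def pointwise algebra_simps sum_distrib_left)

lemma inner_zero_left [simp]: "inner \<mu> S 0 f = 0"
  by (simp add: inner_def pointwise)

lemma inner_self_eq_0:
  assumes "finite S" "\<forall>M\<in>S. \<mu> M > 0" "f \<in> supp_on S" "inner \<mu> S f f = 0"
  shows "f = 0"
proof -
  have eq: "inner \<mu> S f f = of_real (\<Sum>M\<in>S. \<mu> M * (cmod (f M))\<^sup>2)"
    by (simp add: inner_def pointwise mult.assoc complex_norm_square del: of_real_power)
  with assms(4) have 1: "(\<Sum>M\<in>S. \<mu> M * (cmod (f M))\<^sup>2) = 0"
    by (metis of_real_eq_0_iff)
  have "\<forall>M\<in>S. \<mu> M * (cmod (f M))\<^sup>2 = 0"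
    by (rule sum_nonneg_eq_0_iff[THEN iffD1, OF _ _ 1])
       (use assms(1,2) in \<open>auto simp: less_imp_le\<close>)
  hence "f M = 0" if "M \<in> S" for M
    using that assms(2) by force
  moreover have "f M = 0" if "M \<notin> S" for M
    using assms(3) that by (auto simp: supp_on_def pointwise)
  ultimately show ?thesis by (auto simp: fun_eq_iff pointwise)
qed

definition subsp :: "('x \<Rightarrow> complex) set \<Rightarrow> bool" where
  "subsp K \<longleftrightarrow> 0 \<in> K \<and> (\<forall>f\<in>K. \<forall>g\<in>K. f + g \<in> K) \<and> (\<forall>c. \<forall>f\<in>K. c *\<^sub>f f \<in> K)"

lemma subsp_diff: "subsp K \<Longrightarrow> f \<in> K \<Longrightarrow> g \<in> K \<Longrightarrow> f - g \<in> K"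
  unfolding diff_eq_add_smul by (simp add: subsp_def)

lemma subsp_sum: "subsp K \<Longrightarrow> (\<And>i. i \<in> A \<Longrightarrow> f i \<in> K) \<Longrightarrow> (\<Sum>i\<in>A. f i) \<in> K"
  by (induction A rule: infinite_finite_induct) (auto simp: subsp_def)

text \<open>
  Induction on a support of the subspace: if some member of \<open>K\<close> does not vanish at \<open>s\<close>, then \<open>K\<close>
  is the sum of a smaller space and of the line of one vector orthogonal to it.
\<close>

lemma orthogonal_decomposition:
  assumes fin: "finite S" and pos: "\<forall>M\<in>S. \<mu> M > 0"
  assumes "finite S'" "S' \<subseteq> S" "subsp K" "K \<subseteq> supp_on S'"
  shows "\<exists>q\<in>K. \<forall>h\<in>K. inner \<mu> S (f - q) h = 0"
  using assms(3-)
proof (induction S' arbitrary: K f rule: finite_induct)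
  case empty
  hence "K \<subseteq> {0}" by (auto simp: supp_on_def pointwise fun_eq_iff pointwise)
  with empty(2) have "K = {0}" by (auto simp: subsp_def)
  thus ?case by (simp add: inner_def pointwise)
next
  case (insert s S')
  define K0 where "K0 = {h \<in> K. h s = 0}"
  have K0: "subsp K0" "K0 \<subseteq> supp_on S'" "S' \<subseteq> S"
    using insert.prems by (auto simp: subsp_def K0_def supp_on_def pointwise)
  show ?case
  proof (cases "\<forall>h\<in>K. h s = 0")
    case True
    hence "K0 = K" by (auto simp: K0_def)
    thus ?thesis using insert.IH[OF K0(3) K0(1,2)] by blast
  next
    case False
    then obtain h0 where h0: "h0 \<in> K" "h0 s \<noteq> 0" by blast
    obtain q0 where q0: "q0 \<in> K0" "\<forall>h\<in>K0. inner \<mu> S (h0 - q0) h = 0"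
      using insert.IH[OF K0(3) K0(1,2)] by blast
    define g where "g = h0 - q0"
    have g: "g \<in> K" "g s \<noteq> 0"
      using h0 q0(1) subsp_diff[OF insert.prems(2)] by (auto simp: g_def K0_def pointwise)
    have gK0: "inner \<mu> S g h = 0" if "h \<in> K0" for h using q0 that by (simp add: g_def)
    have gg: "inner \<mu> S g g \<noteq> 0"
    proof
      assume "inner \<mu> S g g = 0"
      moreover have "g \<in> supp_on S"
        using g(1) insert.prems by (intro supp_on_mono[of g "insert s S'" S]) auto
      ultimately have "g = 0" by (intro inner_self_eq_0[OF fin pos])
      then show False using g(2) by (simp add: pointwise)
    qed
    obtain q1 where q1: "q1 \<in> K0" "\<forall>h\<in>K0. inner \<mu> S (f - q1) h = 0"
      using insert.IH[OF K0(3) K0(1,2)] by blast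
    define c where "c = inner \<mu> S f g / inner \<mu> S g g"
    define q where "q = q1 + c *\<^sub>f g"
    have "q \<in> K" using g q1(1) insert.prems(2) by (auto simp: q_def K0_def subsp_def pointwise)
    moreover have "inner \<mu> S (f - q) h = 0" if "h \<in> K" for h
    proof -
      define d where "d = h s / g s"
      have "h - d *\<^sub>f g \<in> K0"
        using that g insert.prems(2) subsp_diff[OF insert.prems(2)]
        by (auto simp: K0_def d_def subsp_def pointwise)
      then obtain h' where h': "h' \<in> K0" "h = h' + d *\<^sub>f g" by (metis diff_add_cancel)
      have "inner \<mu> S q1 g = 0"
        using gK0[OF q1(1)] inner_commute[of \<mu> S g q1] by simp
      hence "inner \<mu> S (f - q) g = 0"
        using gg by (simp add: q_def inner_diff_left inner_add_left inner_smul_left c_def)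
      moreover have "inner \<mu> S (f - q) h' = inner \<mu> S (f - q1) h' - c * inner \<mu> S g h'"
        by (simp add: q_def inner_diff_left inner_add_left inner_smul_left algebra_simps)
      ultimately show ?thesis
        using q1 h' gK0 by (simp add: inner_add_right inner_smul_right)
    qed
    ultimately show ?thesis by blast
  qed
qed

text \<open>
  For \<open>G\<close> the graph of an operator, this is the graph of its extension \<open>b h \<mapsto> b (F h)\<close> along all
  polynomials \<open>b\<close> in the operators \<open>E s\<close>.  It is a relation, because it need not be single-valued
  in general.
\<close>

inductive_set graph_closure ::
    "('s \<Rightarrow> ('x \<Rightarrow> complex) \<Rightarrow> ('x \<Rightarrow> complex)) \<Rightarrow> (('x \<Rightarrow> complex) \<times> ('x \<Rightarrow> complex)) set
      \<Rightarrow> (('x \<Rightarrow> complex) \<times> ('x \<Rightarrow> complex)) set"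
  for E :: "'s \<Rightarrow> ('x \<Rightarrow> complex) \<Rightarrow> ('x \<Rightarrow> complex)" and G :: "(('x \<Rightarrow> complex) \<times> ('x \<Rightarrow> complex)) set"
  where
    base: "(x, y) \<in> G \<Longrightarrow> (x, y) \<in> graph_closure E G"
  | step: "(x, y) \<in> graph_closure E G \<Longrightarrow> (E s x, E s y) \<in> graph_closure E G"
  | add: "(x, y) \<in> graph_closure E G \<Longrightarrow> (x', y') \<in> graph_closure E G \<Longrightarrow>
      (x + x', y + y') \<in> graph_closure E G"
  | smul: "(x, y) \<in> graph_closure E G \<Longrightarrow> (c *\<^sub>f x, c *\<^sub>f y) \<in> graph_closure E G"

text \<open>
  The algebra generated by the operators \<open>E s\<close> is closed under adjoints (\<open>Eadj\<close>), \<open>F\<close> lives on a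
  smaller space and commutes with all compressions of this algebra (\<open>FE\<close>), and \<open>\<omega>\<close> is a cyclic
  vector of the algebra (\<open>cyc\<close>).  The condition \<open>repr\<close> says that \<open>\<T>\<close> realizes every vector to which an
  operator in the commutant could send \<open>\<omega>\<close>, judging by the operators \<open>E s\<close> that kill \<open>\<omega>\<close>.

  Let \<open>H'\<close> be the invariant subspace generated by the small space.  Its orthogonal complement \<open>Z\<close>
  consists of the vectors of which no word has a component in the small space.  As \<open>H'\<close> meets \<open>Z\<close>
  only in \<open>0\<close>, the extension of \<open>F\<close> to \<open>H'\<close> is single-valued.  Let \<open>q\<close> be the projection of \<open>\<omega>\<close> to \<open>H'\<close>.
  The extension sends \<open>q\<close> to a vector \<open>y\<close> to which \<open>repr\<close> applies, say \<open>y = T \<omega>\<close>; then \<open>y = T q\<close>, since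
  \<open>T\<close> preserves both \<open>H'\<close> and \<open>Z\<close>.  So the extension agrees with \<open>T\<close> on the projection of
  the cyclic vector and hence on all of \<open>H'\<close>.
\<close>

theorem compressed_commutant:
  fixes E :: "'s \<Rightarrow> ('x \<Rightarrow> complex) \<Rightarrow> ('x \<Rightarrow> complex)"
  assumes fin: "finite S" and pos: "\<forall>M\<in>S. \<mu> M > 0" and S0: "S0 \<subseteq> S"
  assumes Elin: "\<And>s. lin (E s)" and EH: "\<And>s f. f \<in> supp_on S \<Longrightarrow> E s f \<in> supp_on S"
  assumes Eadj: "\<And>s f g. f \<in> supp_on S \<Longrightarrow> g \<in> supp_on S \<Longrightarrow>
     inner \<mu> S (E s f) g = inner \<mu> S f (E (adj s) g)"
  assumes Flin: "lin F" and FH: "\<And>h. h \<in> supp_on S0 \<Longrightarrow> F h \<in> supp_on S0"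
  assumes FE: "\<And>b h. h \<in> supp_on S0 \<Longrightarrow>
     F (restr S0 (foldr E b h)) = restr S0 (foldr E b (F h))"
  assumes \<omega>: "\<omega> \<in> supp_on S"
  assumes cyc: "\<And>K. subsp K \<Longrightarrow> \<omega> \<in> K \<Longrightarrow> (\<And>s f. f \<in> K \<Longrightarrow> E s f \<in> K) \<Longrightarrow> supp_on S \<subseteq> K"
  assumes repr: "\<And>y. y \<in> supp_on S \<Longrightarrow> (\<And>s. E s \<omega> = 0 \<Longrightarrow> E s y = 0) \<Longrightarrow> \<exists>T\<in>\<T>. y = T \<omega>"
  assumes Tlin: "\<And>T. T \<in> \<T> \<Longrightarrow> lin T" and TH: "\<And>T f. T \<in> \<T> \<Longrightarrow> f \<in> supp_on S \<Longrightarrow> T f \<in> supp_on S"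
  assumes TE: "\<And>T s f. T \<in> \<T> \<Longrightarrow> f \<in> supp_on S \<Longrightarrow> T (E s f) = E s (T f)"
  assumes Te: "\<And>T f. T \<in> \<T> \<Longrightarrow> f \<in> supp_on S \<Longrightarrow> T (restr S0 f) = restr S0 (T f)"
  shows "\<exists>T\<in>\<T>. \<forall>h\<in>supp_on S0. F h = T h"
proof -
  define Gr where "Gr = graph_closure E {(h, F h) | h. h \<in> supp_on S0}"
  define H' where "H' = fst ` Gr"
  define Z where "Z = {z \<in> supp_on S. \<forall>b. restr S0 (foldr E b z) = 0}"
  note sub = supp_on_mono[OF _ S0]
  have Gr_base: "(h, F h) \<in> Gr" if "h \<in> supp_on S0" for h
    unfolding Gr_def by (rule graph_closure.base) (use that in blast)
  have Gr_step: "(E s x, E s y) \<in> Gr" if "(x, y) \<in> Gr" for s x y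
    using that unfolding Gr_def by (rule graph_closure.step)
  have Gr_add: "(x + x', y + y') \<in> Gr" if "(x, y) \<in> Gr" "(x', y') \<in> Gr" for x y x' y'
    using that unfolding Gr_def by (rule graph_closure.add)
  have Gr_smul: "(c *\<^sub>f x, c *\<^sub>f y) \<in> Gr" if "(x, y) \<in> Gr" for c x y
    using that unfolding Gr_def by (rule graph_closure.smul)
  have Gr_diff: "(x - x', y - y') \<in> Gr" if "(x, y) \<in> Gr" "(x', y') \<in> Gr" for x y x' y'
    unfolding diff_eq_add_smul by (intro Gr_add Gr_smul that)
  have Gr_0: "(0, 0) \<in> Gr" using Gr_base[of 0] lin_zero[OF Flin] by simp
  have H'_iff: "x \<in> H' \<longleftrightarrow> (\<exists>y. (x, y) \<in> Gr)" for x by (force simp: H'_def)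
  have H'_sub: "subsp H'"
    unfolding subsp_def
  proof (intro conjI ballI allI)
    show "0 \<in> H'" unfolding H'_iff by (rule exI[where x = 0]) (rule Gr_0)
  next
    fix f g assume "f \<in> H'" "g \<in> H'"
    then obtain y y' where "(f, y) \<in> Gr" "(g, y') \<in> Gr" unfolding H'_iff by (elim exE)
    from Gr_add[OF this] show "f + g \<in> H'" unfolding H'_def by (metis fst_conv imageI)
  next
    fix c f assume "f \<in> H'"
    then obtain y where "(f, y) \<in> Gr" unfolding H'_iff by (elim exE)
    from Gr_smul[OF this] show "c *\<^sub>f f \<in> H'" unfolding H'_def by (metis fst_conv imageI)
  qed
  have wlin: "lin (foldr E b)" for b by (rule lin_foldr[OF Elin])
  have wH: "foldr E b f \<in> supp_on S" if "f \<in> supp_on S" for b f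
    by (induction b) (use that EH in auto)
  have Gr_inv: "x \<in> supp_on S \<and> y \<in> H' \<and> (\<forall>b. F (restr S0 (foldr E b x)) = restr S0 (foldr E b y))"
    if "(x, y) \<in> Gr" for x y
    using that unfolding Gr_def
  proof (induction rule: graph_closure.induct)
    case (base x y)
    then have x: "x \<in> supp_on S0" and y: "y = F x" by auto
    have "y \<in> H'" using Gr_base[OF FH[OF x]] y by (auto simp only: H'_iff)
    then show ?case using FE[OF x] sub[OF x] by (simp only: y) simp
  next
    case (step x y s)
    have "F (restr S0 (foldr E b (E s x))) = restr S0 (foldr E b (E s y))" for b
      using step.IH by (metis foldr.simps(1,2) foldr_append comp_apply id_apply)
    moreover have "E s y \<in> H'" using step.IH Gr_step H'_iff by metis
    ultimately show ?case using step.IH EH by simp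
  next
    case (add x y x' y')
    then show ?case using H'_sub
      by (auto simp: subsp_def lin_add[OF wlin] lin_add[OF lin_restr] lin_add[OF Flin])
  next
    case (smul x y c)
    then show ?case using H'_sub
      by (auto simp: subsp_def lin_smul[OF wlin] lin_smul[OF lin_restr] lin_smul[OF Flin])
  qed
  have H'_S: "x \<in> supp_on S" if "x \<in> H'" for x using that Gr_inv H'_iff by blast
  have Z_E: "E s z \<in> Z" if "z \<in> Z" for s z
  proof -
    have "restr S0 (foldr E b (E s z)) = restr S0 (foldr E (b @ [s]) z)" for b by simp
    also have "\<dots> b = 0" for b using that by (simp add: Z_def del: foldr_append)
    finally show ?thesis using that EH by (auto simp: Z_def)
  qed
  have inner_restr: "inner \<mu> S f h = inner \<mu> S (restr S0 f) h" if "h \<in> supp_on S0" for f h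
    unfolding inner_def by (rule sum.cong) (use that in \<open>auto simp: restr_def supp_on_def\<close>)
  have Z_perp: "inner \<mu> S z x = 0" if "(x, y) \<in> Gr" "z \<in> Z" for x y z
    using that unfolding Gr_def
  proof (induction arbitrary: z rule: graph_closure.induct)
    case (base x y)
    then have "restr S0 z = 0" by (auto simp: Z_def dest: spec[of _ "[]"])
    then show ?case using inner_restr[of x z] base by auto
  next
    case (step x y s)
    have "x \<in> supp_on S" using step.hyps Gr_inv by (auto simp: Gr_def)
    moreover have "z \<in> supp_on S" using step.prems by (simp add: Z_def)
    ultimately have "inner \<mu> S (E s x) z = inner \<mu> S x (E (adj s) z)" using Eadj by blast
    moreover have "inner \<mu> S (E (adj s) z) x = 0" using step.IH Z_E step.prems by blast
    ultimately show ?case using inner_commute[of \<mu> S z] inner_commute[of \<mu> S _ x] by simp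
  qed (simp_all add: inner_add_right inner_smul_right)
  have H'_Z: "x = 0" if "x \<in> H'" "x \<in> Z" for x
    using that Z_perp inner_self_eq_0[OF fin pos] H'_iff by (auto simp: Z_def)
  have functional: "y = y'" if "(x, y) \<in> Gr" "(x, y') \<in> Gr" for x y y'
  proof -
    have d: "(0, y - y') \<in> Gr" using Gr_diff[OF that] by simp
    have "restr S0 (foldr E b (y - y')) = 0" for b
      using Gr_inv[OF d] lin_zero[OF wlin] lin_zero[OF lin_restr] lin_zero[OF Flin] by metis
    moreover have "y - y' \<in> H'" using Gr_inv[OF d] by blast
    ultimately have "y - y' \<in> H'" "y - y' \<in> Z" using H'_S by (simp_all add: Z_def)
    then have "y - y' = 0" by (rule H'_Z)
    then show ?thesis by simp
  qed
  have perp_Z: "z \<in> Z" if z: "z \<in> supp_on S" "\<forall>h\<in>H'. inner \<mu> S z h = 0" for z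
  proof -
    have w: "inner \<mu> S (foldr E b z) h = 0" if "h \<in> H'" for b h
      using that
    proof (induction b arbitrary: h)
      case Nil then show ?case using z by simp
    next
      case (Cons s b)
      have "inner \<mu> S (E s (foldr E b z)) h = inner \<mu> S (foldr E b z) (E (adj s) h)"
        using wH z Cons.prems H'_S by (intro Eadj) auto
      moreover have "E (adj s) h \<in> H'" using Cons.prems Gr_step H'_iff by blast
      ultimately show ?case using Cons.IH by simp
    qed
    have "restr S0 (foldr E b z) = 0" for b
    proof -
      let ?h = "restr S0 (foldr E b z)"
      have "?h \<in> H'" using Gr_base[OF restr_in] H'_iff by blast
      then have "inner \<mu> S ?h ?h = 0" using w inner_restr[OF restr_in] by metis
      then show ?thesis using inner_self_eq_0[OF fin pos, where f = ?h] sub by auto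
    qed
    then show ?thesis using z by (simp add: Z_def)
  qed
  have Z_diff: "z - z' \<in> Z" if "z \<in> Z" "z' \<in> Z" for z z'
    using that supp_on_diff by (fastforce simp: Z_def lin_diff[OF wlin] lin_diff[OF lin_restr])
  have Z_add: "z + z' \<in> Z" if "z \<in> Z" "z' \<in> Z" for z z'
    using that by (auto simp: Z_def lin_add[OF wlin] lin_add[OF lin_restr])
  have Z_smul: "c *\<^sub>f z \<in> Z" if "z \<in> Z" for z c
    using that by (auto simp: Z_def lin_smul[OF wlin] lin_smul[OF lin_restr])
  obtain q where q: "q \<in> H'" "\<forall>h\<in>H'. inner \<mu> S (\<omega> - q) h = 0"
    using orthogonal_decomposition[OF fin pos fin subset_refl H'_sub] H'_S by blast
  define z where "z = \<omega> - q"
  have z: "z \<in> Z" unfolding z_def using q \<omega> H'_S by (intro perp_Z) auto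
  obtain y where y: "(q, y) \<in> Gr" using q H'_iff by blast
  \<comment> \<open>\<open>E s q = - E s z\<close> lies both in \<open>H'\<close> and in \<open>Z\<close>.\<close>
  have "E s y = 0" if "E s \<omega> = 0" for s
  proof -
    have "E s q = - E s z" using that by (simp add: z_def lin_diff[OF Elin])
    then have "E s q = (-1) *\<^sub>f E s z" by (simp add: fun_eq_iff pointwise)
    then have "E s q = 0" using Z_smul[OF Z_E[OF z]] Gr_step[OF y] H'_Z H'_iff by metis
    then show ?thesis using functional[OF Gr_0] Gr_step[OF y, of s] by metis
  qed
  then obtain T where T: "T \<in> \<T>" "y = T \<omega>"
    using repr[of y] Gr_inv[OF y] H'_S by blast
  have Tw: "T (foldr E b f) = foldr E b (T f)" if "f \<in> supp_on S" for b f
    by (induction b) (use that TE[OF T(1)] wH in auto)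
  have T_H': "T x \<in> H'" if "(x, y) \<in> Gr" for x y
    using that unfolding Gr_def
  proof (induction rule: graph_closure.induct)
    case (base x y)
    then have x: "x \<in> supp_on S0" by auto
    have "T x = restr S0 (T x)" using Te[OF T(1) sub[OF x]] by (simp only: restr_id[OF x])
    then show ?case using Gr_base H'_iff restr_in by metis
  next
    case (step x y s)
    then have "T (E s x) = E s (T x)" using TE[OF T(1)] Gr_inv unfolding Gr_def by simp
    then show ?case using step.IH Gr_step unfolding H'_iff by (simp only:) blast
  qed (use H'_sub in \<open>auto simp: subsp_def lin_add[OF Tlin[OF T(1)]] lin_smul[OF Tlin[OF T(1)]]\<close>)
  have T_Z: "T z' \<in> Z" if "z' \<in> Z" for z'
  proof -
    have z': "z' \<in> supp_on S" using that by (simp add: Z_def)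
    have "restr S0 (foldr E b (T z')) = T (restr S0 (foldr E b z'))" for b
      by (simp only: Tw[OF z', symmetric] Te[OF T(1) wH[OF z']])
    then show ?thesis using that TH[OF T(1)] lin_zero[OF Tlin[OF T(1)]] by (simp add: Z_def)
  qed
  have "T z = y - T q" unfolding T(2) z_def by (simp add: lin_diff[OF Tlin[OF T(1)]])
  then have "T z \<in> H'" using subsp_diff[OF H'_sub] T_H' y Gr_inv by metis
  then have "T z = 0" using T_Z z H'_Z by blast
  then have "y = T q" using \<open>T z = y - T q\<close> by simp
  then have qT: "(q, T q) \<in> Gr" using y by simp
  \<comment> \<open>The vectors on whose component in \<open>H'\<close> the extension of \<open>F\<close> agrees with \<open>T\<close>.\<close>
  define K where "K = {x. \<exists>q z. x = q + z \<and> (q, T q) \<in> Gr \<and> z \<in> Z}"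
  have "supp_on S \<subseteq> K"
  proof (rule cyc)
    have "(0, T 0) \<in> Gr" using Gr_0 lin_zero[OF Tlin[OF T(1)]] by simp
    moreover have "0 \<in> Z" using Z_diff[OF z z] by simp
    ultimately have "0 \<in> K" unfolding K_def by force
    moreover have "x + x' \<in> K" if xx: "x \<in> K" "x' \<in> K" for x x'
    proof -
      obtain q z q' z' where "x = q + z" "(q, T q) \<in> Gr" "z \<in> Z" "x' = q' + z'" "(q', T q') \<in> Gr" "z' \<in> Z"
        using xx unfolding K_def by blast
      then have "x + x' = (q + q') + (z + z')" "(q + q', T (q + q')) \<in> Gr" "z + z' \<in> Z"
        using Gr_add Z_add by (auto simp: lin_add[OF Tlin[OF T(1)]])
      then show ?thesis unfolding K_def by blast
    qed
    moreover have "c *\<^sub>f x \<in> K" if xK: "x \<in> K" for c x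
    proof -
      obtain q z where "x = q + z" "(q, T q) \<in> Gr" "z \<in> Z" using xK unfolding K_def by blast
      then have "c *\<^sub>f x = c *\<^sub>f q + c *\<^sub>f z" "(c *\<^sub>f q, T (c *\<^sub>f q)) \<in> Gr" "c *\<^sub>f z \<in> Z"
        using Gr_smul Z_smul by (auto simp: lin_smul[OF Tlin[OF T(1)]] smul_add)
      then show ?thesis unfolding K_def by blast
    qed
    ultimately show "subsp K" by (simp add: subsp_def)
    have "\<omega> = q + z" by (simp add: z_def)
    with qT z show "\<omega> \<in> K" unfolding K_def by blast
    show "E s f \<in> K" if fK: "f \<in> K" for s f
    proof -
      obtain q z where f: "f = q + z" "(q, T q) \<in> Gr" "z \<in> Z" using fK unfolding K_def by blast
      then have "T (E s q) = E s (T q)" using TE[OF T(1)] Gr_inv by blast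
      then have "E s f = E s q + E s z" "(E s q, T (E s q)) \<in> Gr" "E s z \<in> Z"
        using f Gr_step Z_E by (auto simp: lin_add[OF Elin])
      then show ?thesis unfolding K_def by blast
    qed
  qed
  have "F h = T h" if h: "h \<in> supp_on S0" for h
  proof -
    obtain q z where f: "h = q + z" "(q, T q) \<in> Gr" "z \<in> Z"
      using subsetD[OF \<open>supp_on S \<subseteq> K\<close> sub[OF h]] unfolding K_def by blast
    have "h \<in> H'" "q \<in> H'" using f Gr_base[OF h] H'_iff by blast+
    moreover have "z = h - q" using f by simp
    ultimately have "z = 0" using f H'_Z subsp_diff[OF H'_sub] by blast
    then show ?thesis using f functional Gr_base[OF h] by auto
  qed
  then show ?thesis using T by blast
qed

section \<open>The super Weyl algebra\<close>

lemma minus_one_power_mod_two: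
  assumes "a mod 2 = (e :: nat)"
  shows "(-1 :: complex) ^ (a * n) = (-1) ^ (e * n)"
  using assms by (auto simp: minus_one_power_iff)

lemma minus_one_power_square [simp]: "(-1 :: complex) ^ n * (-1) ^ n = 1"
  by (simp flip: power_add add: minus_one_power_iff)

text \<open>
  The parity of the matrix unit with entry \<open>(i, j)\<close> is \<open>p i + p j\<close>; a matrix is homogeneous of
  parity \<open>e\<close> if only matrix units of this parity occur.
\<close>

definition par_homog :: "('i \<Rightarrow> nat) \<Rightarrow> 'i set \<Rightarrow> nat \<Rightarrow> ('i \<Rightarrow> 'i \<Rightarrow> complex) \<Rightarrow> bool" where
  "par_homog p I e T \<longleftrightarrow> (\<forall>i\<in>I. \<forall>j\<in>I. T i j \<noteq> 0 \<longrightarrow> (p i + p j) mod 2 = e)"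

definition mmul :: "'i set \<Rightarrow> ('i \<Rightarrow> 'i \<Rightarrow> complex) \<Rightarrow> ('i \<Rightarrow> 'i \<Rightarrow> complex) \<Rightarrow> 'i \<Rightarrow> 'i \<Rightarrow> complex" where
  "mmul I T T' = (\<lambda>u w. \<Sum>v\<in>I. T u v * T' v w)"

text \<open>
  The labels of all generators come from one infinite supply with a parity function; the finite
  set of generators in use is an argument \<open>U\<close> of the notions below.  Thus \<open>S\<^sup>k(V \<otimes> W)\<close> is
  literally a subspace of \<open>S\<^sup>k(V \<otimes> X)\<close> when \<open>W\<close> is enlarged to \<open>X\<close>.
\<close>

locale fock =
  fixes \<pi> :: "nat \<Rightarrow> nat"
  assumes parity: "\<pi> u \<in> {0, 1}"
begin

abbreviation sp :: superspace where
  "sp \<equiv> \<lparr>sdim = 0, par = \<pi>\<rparr>"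

definition X :: "nat \<Rightarrow> svec \<Rightarrow> svec" where
  "X = var_mult sp"

definition D :: "nat \<Rightarrow> svec \<Rightarrow> svec" where
  "D = var_deriv sp"

lemma lin_X: "lin (X u)"
  by (rule linI) (auto simp: X_def var_mult_def fun_eq_iff pointwise algebra_simps)

lemma lin_D: "lin (D u)"
  by (rule linI) (auto simp: D_def var_deriv_def fun_eq_iff pointwise algebra_simps)

lemma X_X: "X w (X u f) = (-1) ^ (\<pi> u * \<pi> w) *\<^sub>f X u (X w f)"
  using var_mult_commute[of sp u w f] parity[of u] parity[of w]
  by (simp add: fun_eq_iff pointwise X_def)

lemma D_X: "D v (X u f) = (if u = v then f else 0) + (-1) ^ (\<pi> u * \<pi> v) *\<^sub>f X u (D v f)"
  using var_deriv_var_mult[of sp u v f] parity[of u] parity[of v]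
  by (simp add: fun_eq_iff pointwise X_def D_def)

lemma D_D: "D w (D u f) = (-1) ^ (\<pi> u * \<pi> w) *\<^sub>f D u (D w f)"
proof (rule ext)
  fix M :: smonom
  obtain \<alpha> B where M: "M = (\<alpha>, B)" by (cases M)
  show "D w (D u f) M = ((-1) ^ (\<pi> u * \<pi> w) *\<^sub>f D u (D w f)) M"
  proof (cases "u = w")
    case True
    then show ?thesis using parity[of w] by (auto simp: M D_def var_deriv_def pointwise)
  next
    case False
    then have ne: "u < w \<or> w < u" by auto
    have s: "insert u (insert w B) = insert w (insert u B)" "add_mset u (add_mset w \<alpha>) = add_mset w (add_mset u \<alpha>)"
      by auto
    have "\<pi> u = 0 \<or> \<pi> u = 1" "\<pi> w = 0 \<or> \<pi> w = 1" using parity[of u] parity[of w] by auto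
    then show ?thesis using ne
      by (elim disjE) (auto simp: M D_def var_deriv_def pointwise s jw_sign_insert)
  qed
qed

definition mon :: "nat set \<Rightarrow> nat \<Rightarrow> smonom set" where
  "mon U k = {(\<alpha>, B). set_mset \<alpha> \<subseteq> {u \<in> U. \<pi> u = 0} \<and> B \<subseteq> {u \<in> U. \<pi> u = 1} \<and> size \<alpha> + card B = k}"

abbreviation Sk :: "nat set \<Rightarrow> nat \<Rightarrow> svec set" where
  "Sk U k \<equiv> supp_on (mon U k)"

lemma mon_mono: "U \<subseteq> U' \<Longrightarrow> mon U k \<subseteq> mon U' k"
  by (auto simp: mon_def)

lemma finite_mon:
  assumes "finite U"
  shows "finite (mon U k)"
proof (rule finite_subset)
  show "mon U k \<subseteq> (\<Union>n\<le>k. {\<alpha>. size \<alpha> = n \<and> set_mset \<alpha> \<subseteq> U}) \<times> Pow U"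
    by (auto simp: mon_def)
  have "finite {\<alpha>. size \<alpha> = n \<and> set_mset \<alpha> \<subseteq> U}" for n
  proof (rule finite_subset)
    show "{\<alpha>. size \<alpha> = n \<and> set_mset \<alpha> \<subseteq> U} \<subseteq> mset ` {xs. set xs \<subseteq> U \<and> length xs = n}"
    proof
      fix \<alpha> assume "\<alpha> \<in> {\<alpha>. size \<alpha> = n \<and> set_mset \<alpha> \<subseteq> U}"
      moreover obtain xs where "\<alpha> = mset xs" by (metis ex_mset)
      ultimately show "\<alpha> \<in> mset ` {xs. set xs \<subseteq> U \<and> length xs = n}" by auto
    qed
  qed (use assms in \<open>simp add: finite_lists_length_eq\<close>)
  then show "finite ((\<Union>n\<le>k. {\<alpha>. size \<alpha> = n \<and> set_mset \<alpha> \<subseteq> U}) \<times> Pow U)"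
    using assms by simp
qed

lemma X_Sk:
  assumes "finite U" "u \<in> U" "f \<in> Sk U k"
  shows "X u f \<in> Sk U (Suc k)"
proof -
  have "X u f (\<alpha>, B) = 0" if *: "(\<alpha>, B) \<notin> mon U (Suc k)" for \<alpha> B
  proof (cases "\<pi> u = 0")
    case True
    have "(\<alpha> - {#u#}, B) \<notin> mon U k" if u: "u \<in># \<alpha>"
    proof -
      obtain \<beta> where "\<alpha> = add_mset u \<beta>" using u by (meson mset_add)
      then show ?thesis using * assms True by (auto simp: mon_def)
    qed
    then show ?thesis using True assms by (auto simp: X_def var_mult_def supp_on_def)
  next
    case False
    then have 1: "\<pi> u = 1" using parity[of u] by auto
    have "(\<alpha>, B - {u}) \<notin> mon U k" if u: "u \<in> B"
    proof
      assume m: "(\<alpha>, B - {u}) \<in> mon U k"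
      then have "B \<subseteq> {v \<in> U. \<pi> v = 1}" using 1 assms u by (auto simp: mon_def)
      then have "finite B" using assms(1) by (auto intro: finite_subset)
      then have "card B = Suc (card (B - {u}))" using u by (metis card_Suc_Diff1)
      then show False using m * \<open>B \<subseteq> _\<close> by (auto simp: mon_def)
    qed
    then show ?thesis using False assms by (auto simp: X_def var_mult_def supp_on_def)
  qed
  then show ?thesis by (auto simp: supp_on_def)
qed

lemma D_Sk:
  assumes "finite U" "f \<in> Sk U (Suc k)"
  shows "D u f \<in> Sk U k"
proof -
  have "D u f (\<alpha>, B) = 0" if *: "(\<alpha>, B) \<notin> mon U k" for \<alpha> B
  proof (cases "\<pi> u = 0")
    case True
    have "(add_mset u \<alpha>, B) \<notin> mon U (Suc k)" using * by (auto simp: mon_def)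
    then show ?thesis using True assms by (auto simp: D_def var_deriv_def supp_on_def)
  next
    case False
    have "(\<alpha>, insert u B) \<notin> mon U (Suc k)" if u: "u \<notin> B"
    proof
      assume m: "(\<alpha>, insert u B) \<in> mon U (Suc k)"
      then have "finite B" using assms(1) by (auto simp: mon_def intro: finite_subset)
      then show False using m * u by (auto simp: mon_def)
    qed
    then show ?thesis using False assms by (auto simp: D_def var_deriv_def supp_on_def)
  qed
  then show ?thesis by (auto simp: supp_on_def)
qed

lemma D_outside:
  assumes "f \<in> Sk U k" "u \<notin> U"
  shows "D u f = 0"
proof -
  have "f (add_mset u \<alpha>, B) = 0" "f (\<alpha>, insert u B) = 0" for \<alpha> B
    using assms by (auto simp: supp_on_def mon_def)
  then show ?thesis by (auto simp: D_def var_deriv_def fun_eq_iff pointwise)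
qed

lemma D_S0:
  assumes "finite U" "f \<in> Sk U 0"
  shows "D u f = 0"
proof -
  have "f (add_mset u \<alpha>, B) = 0" for \<alpha> B
    using assms by (auto simp: supp_on_def mon_def)
  moreover have "f (\<alpha>, insert u B) = 0" for \<alpha> B
  proof -
    have "(\<alpha>, insert u B) \<notin> mon U 0"
    proof
      assume m: "(\<alpha>, insert u B) \<in> mon U 0"
      then have "finite (insert u B)" using assms(1) by (auto simp: mon_def intro: finite_subset)
      then show False using m by (auto simp: mon_def)
    qed
    then show ?thesis using assms by (auto simp: supp_on_def)
  qed
  ultimately show ?thesis by (auto simp: D_def var_deriv_def fun_eq_iff pointwise)
qed

lemma XD_Sk:
  assumes "finite U" "u \<in> U" "f \<in> Sk U k"
  shows "X u (D v f) \<in> Sk U k"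
proof (cases k)
  case 0
  then show ?thesis using assms D_S0[of U f v] lin_zero[OF lin_X] by simp
next
  case (Suc k')
  then have "D v f \<in> Sk U k'" using assms by (intro D_Sk) simp_all
  then show ?thesis unfolding Suc by (intro X_Sk assms(1,2))
qed

lemma X_D_same:
  "X u (D u f) (\<alpha>, B) = (if \<pi> u = 0 then of_nat (count \<alpha> u) else of_bool (u \<in> B)) * f (\<alpha>, B)"
proof (cases "\<pi> u = 0")
  case True
  show ?thesis
  proof (cases "u \<in># \<alpha>")
    case u: True
    then obtain \<beta> where "\<alpha> = add_mset u \<beta>" by (meson mset_add)
    then show ?thesis using True by (simp add: X_def D_def var_mult_def var_deriv_def)
  next
    case False
    then show ?thesis using True by (simp add: X_def D_def var_mult_def count_eq_zero_iff)
  qed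
next
  case False
  then show ?thesis
    by (auto simp: X_def D_def var_mult_def var_deriv_def jw_sign_remove insert_absorb mult.assoc[symmetric])
qed

text \<open>
  Euler's formula.  It expresses a vector of positive degree through generators times vectors of
  smaller degree, and so reduces spanning statements to induction on the degree.
\<close>

lemma euler:
  assumes "finite U" "f \<in> Sk U k"
  shows "(\<Sum>u\<in>U. X u (D u f)) = of_nat k *\<^sub>f f"
proof (rule ext)
  fix M :: smonom
  obtain \<alpha> B where M: "M = (\<alpha>, B)" by (cases M)
  show "(\<Sum>u\<in>U. X u (D u f)) M = (of_nat k *\<^sub>f f) M"
  proof (cases "M \<in> mon U k")
    case True
    have "(\<Sum>u\<in>U. X u (D u f)) M = (\<Sum>u\<in>U. if \<pi> u = 0 then of_nat (count \<alpha> u) else of_bool (u \<in> B)) * f M"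
      by (simp add: sum_apply M X_D_same sum_distrib_right)
    also have "(\<Sum>u\<in>U. if \<pi> u = 0 then of_nat (count \<alpha> u) else of_bool (u \<in> B)) =
      (of_nat (\<Sum>u\<in>U. (if \<pi> u = 0 then count \<alpha> u else 0) + (if u \<in> B then 1 else 0)) :: complex)"
    proof -
      have "(if \<pi> u = 0 then of_nat (count \<alpha> u) else of_bool (u \<in> B)) =
        (of_nat ((if \<pi> u = 0 then count \<alpha> u else 0) + (if u \<in> B then 1 else 0)) :: complex)" for u
        using True by (auto simp: M mon_def)
      then show ?thesis by (simp only: of_nat_sum)
    qed
    also have "(\<Sum>u\<in>U. (if \<pi> u = 0 then count \<alpha> u else 0) + (if u \<in> B then 1 else 0)) = size \<alpha> + card B"
    proof -
      have "(\<Sum>u\<in>U. if \<pi> u = 0 then count \<alpha> u else 0) = (\<Sum>u\<in>set_mset \<alpha>. count \<alpha> u)"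
        using assms True by (intro sum.mono_neutral_cong_right) (auto simp: M mon_def count_eq_zero_iff)
      moreover have "(\<Sum>u\<in>U. if u \<in> B then 1 else 0) = card B"
      proof -
        have "U \<inter> B = B" using True by (auto simp: M mon_def)
        then show ?thesis using assms by (simp add: sum.If_cases)
      qed
      ultimately show ?thesis by (simp add: sum.distrib size_multiset_overloaded_eq)
    qed
    also have "\<dots> = k" using True by (simp add: M mon_def)
    finally show ?thesis by (simp add: pointwise)
  next
    case False
    have "(\<Sum>u\<in>U. X u (D u f)) \<in> Sk U k" using XD_Sk assms by blast
    then have "(\<Sum>u\<in>U. X u (D u f)) M = 0" "f M = 0" using False assms unfolding supp_on_def by blast+
    then show ?thesis by (simp add: pointwise)
  qed
qed

subsection \<open>The Fock inner product\<close>

text \<open>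
  The squared norm of a monomial in the Fock space.
\<close>

definition weight :: "smonom \<Rightarrow> real" where
  "weight M = (\<Prod>u\<in>set_mset (fst M). fact (count (fst M) u))"

lemma weight_pos: "weight M > 0"
  by (auto simp: weight_def intro!: prod_pos)

lemma weight_add: "weight (add_mset u \<alpha>, B) = of_nat (Suc (count \<alpha> u)) * weight (\<alpha>, B)"
proof (cases "u \<in># \<alpha>")
  case True
  have "(\<Prod>v\<in>set_mset \<alpha> - {u}. fact (count (add_mset u \<alpha>) v)) = (\<Prod>v\<in>set_mset \<alpha> - {u}. fact (count \<alpha> v) :: real)"
    by (rule prod.cong) auto
  then show ?thesis using True
    unfolding weight_def fst_conv set_mset_add_mset_insert insert_absorb[OF True]
    by (subst (1 2) prod.remove[of _ u]) (simp_all add: mult.assoc)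
next
  case False
  have "(\<Prod>v\<in>set_mset \<alpha>. fact (count (add_mset u \<alpha>) v)) = (\<Prod>v\<in>set_mset \<alpha>. fact (count \<alpha> v) :: real)"
    by (rule prod.cong) (use False in auto)
  then show ?thesis using False by (simp add: weight_def not_in_iff)
qed

lemma cnj_jw_sign: "cnj (jw_sign u B) = jw_sign u B"
  by (simp add: jw_sign_def)

text \<open>
  Multiplication by \<open>b\<^sub>u\<close> is injective on the monomials that do not vanish under it, and \<open>\<partial>/\<partial>b\<^sub>u\<close> is its
  adjoint: the factor \<open>Suc (count \<alpha> u)\<close> in the derivative of an even power is the quotient of the two
  weights, and for odd \<open>u\<close> both operators carry the same real sign.
\<close>

lemma inner_X_left:
  assumes U: "finite U" "u \<in> U"
  shows "inner weight (mon U (Suc k)) (X u f) g = inner weight (mon U k) f (D u g)"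
proof (cases "\<pi> u = 0")
  case True
  let ?ins = "\<lambda>(\<alpha>, B :: nat set). (add_mset u \<alpha>, B)"
  let ?F = "\<lambda>M. of_real (weight M) * X u f M * cnj (g M)"
  have sub: "?ins ` mon U k \<subseteq> mon U (Suc k)" using U True by (auto simp: mon_def)
  have out: "?F M = 0" if "M \<in> mon U (Suc k) - ?ins ` mon U k" for M
  proof -
    obtain \<alpha> B where M: "M = (\<alpha>, B)" by (cases M)
    have "u \<notin># \<alpha>"
    proof
      assume "u \<in># \<alpha>"
      then obtain \<beta> where "\<alpha> = add_mset u \<beta>" by (meson mset_add)
      then show False using that by (auto simp: M mon_def image_iff)
    qed
    then show ?thesis using True by (simp add: M X_def var_mult_def)
  qed
  have "inner weight (mon U (Suc k)) (X u f) g = (\<Sum>M\<in>?ins ` mon U k. ?F M)"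
    unfolding inner_def by (rule sum.mono_neutral_right) (use sub out finite_mon[OF U(1)] in auto)
  also have "\<dots> = (\<Sum>M\<in>mon U k. ?F (?ins M))"
    by (rule sum.reindex_cong[where l = ?ins]) (auto simp: inj_on_def)
  also have "\<dots> = inner weight (mon U k) f (D u g)"
    unfolding inner_def
    by (rule sum.cong) (use True in \<open>auto simp: X_def D_def var_mult_def var_deriv_def weight_add algebra_simps\<close>)
  finally show ?thesis .
next
  case False
  then have 1: "\<pi> u = 1" using parity[of u] by auto
  let ?N = "{M \<in> mon U k. u \<notin> snd M}"
  let ?ins = "\<lambda>(\<alpha> :: nat multiset, B). (\<alpha>, insert u B)"
  let ?F = "\<lambda>M. of_real (weight M) * X u f M * cnj (g M)"
  have fin: "finite B" if "(\<alpha>, B) \<in> mon U n" for \<alpha> B n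
    using that U by (auto simp: mon_def intro: finite_subset)
  have sub: "?ins ` ?N \<subseteq> mon U (Suc k)"
  proof
    fix M assume "M \<in> ?ins ` ?N"
    then obtain \<alpha> B where M: "M = (\<alpha>, insert u B)" "(\<alpha>, B) \<in> mon U k" "u \<notin> B" by auto
    then show "M \<in> mon U (Suc k)" using fin[OF M(2)] U 1 by (simp add: mon_def)
  qed
  have out: "?F M = 0" if "M \<in> mon U (Suc k) - ?ins ` ?N" for M
  proof -
    obtain \<alpha> B where M: "M = (\<alpha>, B)" by (cases M)
    have "u \<notin> B"
    proof
      assume u: "u \<in> B"
      have "finite B" using fin that M by auto
      then have "card B = Suc (card (B - {u}))" using u by (metis card_Suc_Diff1)
      then have "(\<alpha>, B - {u}) \<in> ?N" using that by (auto simp: M mon_def)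
      moreover have "M = ?ins (\<alpha>, B - {u})" using u by (auto simp: M)
      ultimately show False using that by blast
    qed
    then show ?thesis using False by (simp add: M X_def var_mult_def)
  qed
  have "inner weight (mon U (Suc k)) (X u f) g = (\<Sum>M\<in>?ins ` ?N. ?F M)"
    unfolding inner_def by (rule sum.mono_neutral_right) (use sub out finite_mon[OF U(1)] in auto)
  also have "\<dots> = (\<Sum>M\<in>?N. ?F (?ins M))"
    by (rule sum.reindex_cong[where l = ?ins]) (auto simp: inj_on_def)
  also have "\<dots> = (\<Sum>M\<in>?N. of_real (weight M) * f M * cnj (D u g M))"
    by (rule sum.cong) (use False in \<open>auto simp: X_def D_def var_mult_def var_deriv_def weight_def jw_sign_insert cnj_jw_sign\<close>)
  also have "\<dots> = inner weight (mon U k) f (D u g)"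
    unfolding inner_def
    by (rule sum.mono_neutral_left) (use False finite_mon[OF U(1)] in \<open>auto simp: D_def var_deriv_def\<close>)
  finally show ?thesis .
qed

lemma inner_XD:
  assumes U: "finite U" "u \<in> U" "v \<in> U" and f: "f \<in> Sk U k" "g \<in> Sk U k"
  shows "inner weight (mon U k) (X u (D v f)) g = inner weight (mon U k) f (X v (D u g))"
proof (cases k)
  case 0
  then show ?thesis using D_S0[OF U(1)] f lin_zero[OF lin_X] inner_commute[of weight _ f 0] by simp
next
  case (Suc k')
  have "inner weight (mon U k) (X u (D v f)) g = inner weight (mon U k') (D v f) (D u g)"
    unfolding Suc by (rule inner_X_left[OF U(1,2)])
  also have "\<dots> = cnj (inner weight (mon U k') (D u g) (D v f))" by (rule inner_commute)
  also have "\<dots> = cnj (inner weight (mon U k) (X v (D u g)) f)"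
    unfolding Suc by (simp only: inner_X_left[OF U(1,3)])
  also have "\<dots> = inner weight (mon U k) f (X v (D u g))" by (rule inner_commute[symmetric])
  finally show ?thesis .
qed

subsection \<open>The parity operator\<close>

text \<open>
  The parity operator \<open>f \<mapsto> (-1)\<^bsup>|f|\<^esup> f\<close>.  Killing the coefficients of infinite sets \<open>B\<close>, for which
  \<open>card\<close> carries no information, makes the sign rules below hold for all coefficient functions.
\<close>

definition eps :: "svec \<Rightarrow> svec" where
  "eps f = (\<lambda>(\<alpha>, B). if finite B then (-1) ^ card B * f (\<alpha>, B) else 0)"

lemma lin_eps: "lin eps"
  by (rule linI) (auto simp: eps_def fun_eq_iff pointwise algebra_simps)

lemma eps_Sk: "f \<in> Sk U k \<Longrightarrow> eps f \<in> Sk U k"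
  by (auto simp: eps_def supp_on_def)

lemma Sk_infinite:
  assumes "finite U" "f \<in> Sk U k" "infinite B"
  shows "f (\<alpha>, B) = 0"
proof -
  have "\<not> B \<subseteq> U" using assms(1,3) finite_subset by blast
  then have "(\<alpha>, B) \<notin> mon U k" unfolding mon_def by blast
  then show ?thesis using assms(2) by (simp add: supp_on_def)
qed

lemma eps_eps:
  assumes "finite U" "f \<in> Sk U k"
  shows "eps (eps f) = f"
proof -
  have "f (\<alpha>, B) = 0" if "infinite B" for \<alpha> B
    using Sk_infinite[OF assms(1,2) that] .
  then show ?thesis by (simp add: eps_def fun_eq_iff mult.assoc[symmetric])
qed

lemma X_eps: "X u (eps f) = (-1) ^ \<pi> u *\<^sub>f eps (X u f)"
proof (rule ext)
  fix M :: smonom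
  obtain \<alpha> B where M: "M = (\<alpha>, B)" by (cases M)
  show "X u (eps f) M = ((-1) ^ \<pi> u *\<^sub>f eps (X u f)) M"
  proof (cases "\<pi> u = 0")
    case True
    then show ?thesis by (simp add: M X_def var_mult_def eps_def pointwise)
  next
    case False
    then have 1: "\<pi> u = 1" using parity[of u] by auto
    show ?thesis
    proof (cases "finite B \<and> u \<in> B")
      case True
      then have "(-1 :: complex) ^ card B = - ((-1) ^ card (B - {u}))"
        by (metis card_Suc_Diff1 power_Suc mult_minus1)
      then show ?thesis using True 1 by (simp add: M X_def var_mult_def eps_def pointwise)
    qed (use 1 in \<open>auto simp: M X_def var_mult_def eps_def pointwise\<close>)
  qed
qed

lemma D_eps: "D u (eps f) = (-1) ^ \<pi> u *\<^sub>f eps (D u f)"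
  using parity[of u]
  by (auto simp: D_def var_deriv_def eps_def fun_eq_iff pointwise)

subsection \<open>Superderivations\<close>

text \<open>
  The superderivation \<open>sder\<close> over an arbitrary finite set of generators.
\<close>

definition dop :: "nat set \<Rightarrow> (nat \<Rightarrow> nat \<Rightarrow> complex) \<Rightarrow> svec \<Rightarrow> svec" where
  "dop U T f = (\<Sum>u\<in>U. \<Sum>v\<in>U. T u v *\<^sub>f X u (D v f))"

abbreviation homog :: "nat set \<Rightarrow> nat \<Rightarrow> (nat \<Rightarrow> nat \<Rightarrow> complex) \<Rightarrow> bool" where
  "homog \<equiv> par_homog \<pi>"

lemma lin_dop: "lin (dop U T)"
  by (rule linI)
    (simp_all add: dop_def lin_add[OF lin_D] lin_add[OF lin_X] lin_smul[OF lin_D] lin_smul[OF lin_X]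
      smul_add sum.distrib fun_eq_iff pointwise sum_apply sum_distrib_left algebra_simps)

lemma dop_Sk: "finite U \<Longrightarrow> f \<in> Sk U k \<Longrightarrow> dop U T f \<in> Sk U k"
  unfolding dop_def by (intro supp_on_sum supp_on_smul XD_Sk)

lemma dop_add: "dop U (\<lambda>u v. T u v + T' u v) f = dop U T f + dop U T' f"
  by (simp add: dop_def fun_eq_iff pointwise sum_apply sum.distrib algebra_simps)

lemma dop_smul: "dop U (\<lambda>u v. c * T u v) f = c *\<^sub>f dop U T f"
  by (simp add: dop_def fun_eq_iff pointwise sum_apply sum_distrib_left algebra_simps)

lemma dop_cong:
  assumes "\<And>u v. u \<in> U \<Longrightarrow> v \<in> U \<Longrightarrow> T u v = T' u v"
  shows "dop U T f = dop U T' f"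
  unfolding dop_def using assms by (intro sum.cong) auto

text \<open>
  The supercommutator of \<open>b\<^sub>u \<partial>\<^sub>v\<close> and \<open>b\<^sub>w \<partial>\<^sub>t\<close>.  Moving all derivations to the right on both sides leaves
  the same quartic term up to a sign, so only the two contractions survive.
\<close>

lemma X_D_X_D:
  "X u (D v (X w (D t f))) = (-1) ^ ((\<pi> u + \<pi> v) * (\<pi> w + \<pi> t)) *\<^sub>f X w (D t (X u (D v f)))
     + ((if w = v then X u (D t f) else 0)
     - (if u = t then (-1) ^ ((\<pi> u + \<pi> v) * (\<pi> w + \<pi> t)) *\<^sub>f X w (D v f) else 0))"
proof -
  have l: "X u (D v (X w (D t f))) = (if w = v then X u (D t f) else 0)
      + ((-1) ^ (\<pi> w * \<pi> v) * (-1) ^ (\<pi> w * \<pi> u) * (-1) ^ (\<pi> t * \<pi> v)) *\<^sub>f X w (X u (D t (D v f)))"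
    by (simp add: D_X X_X[of u w] D_D[of v t] lin_add[OF lin_X] lin_smul[OF lin_X] lin_zero[OF lin_X] mult_ac)
  have r: "X w (D t (X u (D v f))) = (if u = t then X w (D v f) else 0)
      + (-1) ^ (\<pi> u * \<pi> t) *\<^sub>f X w (X u (D t (D v f)))"
    by (simp add: D_X lin_add[OF lin_X] lin_smul[OF lin_X] lin_zero[OF lin_X])
  have s: "(-1 :: complex) ^ ((\<pi> u + \<pi> v) * (\<pi> w + \<pi> t)) * (-1) ^ (\<pi> u * \<pi> t) =
      (-1) ^ (\<pi> w * \<pi> v) * (-1) ^ (\<pi> w * \<pi> u) * (-1) ^ (\<pi> t * \<pi> v)"
    using parity[of u] parity[of v] parity[of w] parity[of t] by (auto simp: minus_one_power_iff)
  show ?thesis unfolding l r s[symmetric] by (simp add: fun_eq_iff pointwise algebra_simps)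
qed

text \<open>
  Superderivations of degree zero form a copy of \<open>gl\<close>: the bracket of two of them is given by the
  supercommutator of the matrices.
\<close>

lemma dop_bracket:
  assumes "finite U" and T: "homog U e T" "homog U e' T'"
  shows "dop U T (dop U T' f) = (-1) ^ (e * e') *\<^sub>f dop U T' (dop U T f)
    + dop U (\<lambda>u w. mmul U T T' u w - (-1) ^ (e * e') * mmul U T' T u w) f"
proof -
  let ?s = "(-1 :: complex) ^ (e * e')"
  let ?q = "\<lambda>u v w t. T u v * T' w t"
  have a: "dop U T (dop U T' f) = (\<Sum>u\<in>U. \<Sum>v\<in>U. \<Sum>w\<in>U. \<Sum>t\<in>U. ?q u v w t *\<^sub>f X u (D v (X w (D t f))))"
    by (simp add: dop_def lin_sum[OF lin_D] lin_sum[OF lin_X] lin_smul[OF lin_D] lin_smul[OF lin_X]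
      fun_eq_iff pointwise sum_apply sum_distrib_left mult.assoc)
  have "dop U T' (dop U T f) = (\<Sum>w\<in>U. \<Sum>t\<in>U. \<Sum>u\<in>U. \<Sum>v\<in>U. ?q u v w t *\<^sub>f X w (D t (X u (D v f))))"
    by (simp add: dop_def lin_sum[OF lin_D] lin_sum[OF lin_X] lin_smul[OF lin_D] lin_smul[OF lin_X]
      fun_eq_iff pointwise sum_apply sum_distrib_left mult.assoc mult.left_commute)
  also have "\<dots> = (\<Sum>w\<in>U. \<Sum>u\<in>U. \<Sum>t\<in>U. \<Sum>v\<in>U. ?q u v w t *\<^sub>f X w (D t (X u (D v f))))"
    by (intro sum.cong refl sum.swap)
  also have "\<dots> = (\<Sum>u\<in>U. \<Sum>w\<in>U. \<Sum>v\<in>U. \<Sum>t\<in>U. ?q u v w t *\<^sub>f X w (D t (X u (D v f))))"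
    by (subst sum.swap) (intro sum.cong refl sum.swap)
  also have "\<dots> = (\<Sum>u\<in>U. \<Sum>v\<in>U. \<Sum>w\<in>U. \<Sum>t\<in>U. ?q u v w t *\<^sub>f X w (D t (X u (D v f))))"
    by (intro sum.cong refl sum.swap)
  finally have b: "dop U T' (dop U T f) = \<dots>" .
  have q: "?q u v w t *\<^sub>f X u (D v (X w (D t f))) =
      ?s *\<^sub>f (?q u v w t *\<^sub>f X w (D t (X u (D v f))))
      + ((if w = v then ?q u v w t *\<^sub>f X u (D t f) else 0)
        - (if u = t then (?s * ?q u v w t) *\<^sub>f X w (D v f) else 0))"
    if "u \<in> U" "v \<in> U" "w \<in> U" "t \<in> U" for u v w t
  proof (cases "?q u v w t = 0")
    case True
    then show ?thesis by (auto simp: fun_eq_iff pointwise)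
  next
    case False
    then have e: "(\<pi> u + \<pi> v) mod 2 = e" "(\<pi> w + \<pi> t) mod 2 = e'"
      using T that by (auto simp: par_homog_def)
    have "(-1 :: complex) ^ ((\<pi> u + \<pi> v) * (\<pi> w + \<pi> t)) = (-1) ^ (e * (\<pi> w + \<pi> t))"
      by (rule minus_one_power_mod_two[OF e(1)])
    also have "\<dots> = ?s" using minus_one_power_mod_two[OF e(2), of e] by (simp only: mult.commute)
    finally have sg: "(-1 :: complex) ^ ((\<pi> u + \<pi> v) * (\<pi> w + \<pi> t)) = ?s" .
    show ?thesis
      unfolding X_D_X_D[of u v w t] sg by (simp add: fun_eq_iff pointwise algebra_simps)
  qed
  have c: "dop U T (dop U T' f) = (\<Sum>u\<in>U. \<Sum>v\<in>U. \<Sum>w\<in>U. \<Sum>t\<in>U.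
      ?s *\<^sub>f (?q u v w t *\<^sub>f X w (D t (X u (D v f))))
      + ((if w = v then ?q u v w t *\<^sub>f X u (D t f) else 0)
        - (if u = t then (?s * ?q u v w t) *\<^sub>f X w (D v f) else 0)))"
    unfolding a by (intro sum.cong refl q)
  have d: "(\<Sum>u\<in>U. \<Sum>v\<in>U. \<Sum>w\<in>U. \<Sum>t\<in>U. if w = v then ?q u v w t *\<^sub>f X u (D t f) else 0)
      = dop U (mmul U T T') f"
  proof -
    have "(\<Sum>v\<in>U. \<Sum>w\<in>U. \<Sum>t\<in>U. if w = v then ?q u v w t *\<^sub>f X u (D t f) else 0)
      = (\<Sum>t\<in>U. mmul U T T' u t *\<^sub>f X u (D t f))" for u
    proof -
      have "(\<Sum>v\<in>U. \<Sum>w\<in>U. \<Sum>t\<in>U. if w = v then ?q u v w t *\<^sub>f X u (D t f) else 0)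
        = (\<Sum>v\<in>U. \<Sum>w\<in>U. if w = v then \<Sum>t\<in>U. ?q u v w t *\<^sub>f X u (D t f) else 0)"
        by (intro sum.cong refl) auto
      also have "\<dots> = (\<Sum>v\<in>U. \<Sum>t\<in>U. ?q u v v t *\<^sub>f X u (D t f))"
        using assms(1) by (simp add: sum.delta)
      also have "\<dots> = (\<Sum>t\<in>U. \<Sum>v\<in>U. ?q u v v t *\<^sub>f X u (D t f))" by (rule sum.swap)
      also have "\<dots> = (\<Sum>t\<in>U. mmul U T T' u t *\<^sub>f X u (D t f))"
        by (simp add: mmul_def fun_eq_iff pointwise sum_apply sum_distrib_right)
      finally show ?thesis .
    qed
    then show ?thesis by (simp add: dop_def)
  qed
  have e: "(\<Sum>u\<in>U. \<Sum>v\<in>U. \<Sum>w\<in>U. \<Sum>t\<in>U. if u = t then (?s * ?q u v w t) *\<^sub>f X w (D v f) else 0)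
      = dop U (\<lambda>u w. ?s * mmul U T' T u w) f"
  proof -
    have "(\<Sum>u\<in>U. \<Sum>v\<in>U. \<Sum>w\<in>U. \<Sum>t\<in>U. if u = t then (?s * ?q u v w t) *\<^sub>f X w (D v f) else 0)
        = (\<Sum>u\<in>U. \<Sum>v\<in>U. \<Sum>w\<in>U. (?s * ?q u v w u) *\<^sub>f X w (D v f))"
      using assms(1) by (simp add: sum.delta')
    also have "\<dots> = (\<Sum>u\<in>U. \<Sum>w\<in>U. \<Sum>v\<in>U. (?s * ?q u v w u) *\<^sub>f X w (D v f))"
      by (intro sum.cong refl sum.swap)
    also have "\<dots> = (\<Sum>w\<in>U. \<Sum>u\<in>U. \<Sum>v\<in>U. (?s * ?q u v w u) *\<^sub>f X w (D v f))" by (rule sum.swap)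
    also have "\<dots> = (\<Sum>w\<in>U. \<Sum>v\<in>U. \<Sum>u\<in>U. (?s * ?q u v w u) *\<^sub>f X w (D v f))"
      by (intro sum.cong refl sum.swap)
    also have "\<dots> = dop U (\<lambda>u w. ?s * mmul U T' T u w) f"
      by (simp add: dop_def mmul_def fun_eq_iff pointwise sum_apply sum_distrib_right sum_distrib_left algebra_simps)
    finally show ?thesis .
  qed
  have "dop U T (dop U T' f) = ?s *\<^sub>f dop U T' (dop U T f)
      + (dop U (mmul U T T') f - dop U (\<lambda>u w. ?s * mmul U T' T u w) f)"
    unfolding c b d[symmetric] e[symmetric]
    by (simp add: fun_eq_iff pointwise sum_apply sum.distrib sum_subtractf sum_distrib_left mult.assoc)
  then show ?thesis
    by (simp add: dop_def fun_eq_iff pointwise sum_apply sum_subtractf algebra_simps)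
qed

lemma dop_X:
  assumes "finite U" "homog U e T" "u \<in> U"
  shows "dop U T (X u f) = (\<Sum>w\<in>U. T w u *\<^sub>f X w f) + (-1) ^ (e * \<pi> u) *\<^sub>f X u (dop U T f)"
proof -
  have *: "T w v *\<^sub>f X w (D v (X u f)) = (if u = v then T w v *\<^sub>f X w f else 0)
      + (-1) ^ (e * \<pi> u) *\<^sub>f (T w v *\<^sub>f X u (X w (D v f)))"
    if "w \<in> U" "v \<in> U" for w v
  proof (cases "T w v = 0")
    case False
    then have d: "(\<pi> w + \<pi> v) mod 2 = e" using assms(2) that by (auto simp: par_homog_def)
    have s: "(-1 :: complex) ^ (e * \<pi> u) = (-1) ^ (\<pi> u * \<pi> v) * (-1) ^ (\<pi> u * \<pi> w)"
      using minus_one_power_mod_two[OF d, of "\<pi> u"]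
      by (simp flip: power_add add: algebra_simps)
    show ?thesis unfolding s
      by (simp add: D_X lin_add[OF lin_X] lin_smul[OF lin_X] lin_zero[OF lin_X] X_X[of w u]
        fun_eq_iff pointwise algebra_simps)
  qed (simp add: fun_eq_iff pointwise)
  have "dop U T (X u f) = (\<Sum>w\<in>U. \<Sum>v\<in>U. (if u = v then T w v *\<^sub>f X w f else 0)
      + (-1) ^ (e * \<pi> u) *\<^sub>f (T w v *\<^sub>f X u (X w (D v f))))"
    unfolding dop_def by (intro sum.cong refl *)
  also have "\<dots> = (\<Sum>w\<in>U. T w u *\<^sub>f X w f) + (-1) ^ (e * \<pi> u) *\<^sub>f X u (dop U T f)"
    using assms(1,3)
    by (simp add: sum.distrib sum.delta' dop_def lin_sum[OF lin_X] lin_smul[OF lin_X])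
      (simp add: fun_eq_iff pointwise sum_apply sum_distrib_left mult.assoc)
  finally show ?thesis .
qed

lemma dop_eps:
  assumes "homog U e T"
  shows "dop U T (eps f) = (-1) ^ e *\<^sub>f eps (dop U T f)"
proof -
  have "T u v *\<^sub>f X u (D v (eps f)) = (-1) ^ e *\<^sub>f eps (T u v *\<^sub>f X u (D v f))" if "u \<in> U" "v \<in> U" for u v
  proof (cases "T u v = 0")
    case False
    then have d: "(\<pi> u + \<pi> v) mod 2 = e" using assms(1) that by (auto simp: par_homog_def)
    have "(-1 :: complex) ^ e = (-1) ^ \<pi> v * (-1) ^ \<pi> u"
      using minus_one_power_mod_two[OF d, of 1] by (simp add: power_add mult.commute)
    then show ?thesis
      by (simp add: D_eps X_eps lin_smul[OF lin_X] lin_smul[OF lin_eps] mult_ac)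
  qed (simp add: lin_zero[OF lin_eps])
  then show ?thesis
    by (simp add: dop_def lin_sum[OF lin_eps] fun_eq_iff pointwise sum_apply sum_distrib_left)
qed

lemma dop_number:
  assumes "finite U" "\<And>u v. u \<in> U \<Longrightarrow> v \<in> U \<Longrightarrow> T u v = (if u = v \<and> u \<in> N then 1 else 0)"
    and N: "N \<subseteq> U"
  shows "dop U T f = (\<Sum>u\<in>N. X u (D u f))"
proof -
  have "dop U T f = (\<Sum>u\<in>U. \<Sum>v\<in>U. if u = v then (if u \<in> N then X u (D u f) else 0) else 0)"
    unfolding dop_def by (intro sum.cong refl) (simp add: assms(2) pointwise)
  also have "\<dots> = (\<Sum>u\<in>U. if u \<in> N then X u (D u f) else 0)"
    using assms(1) by (simp add: sum.delta')
  also have "\<dots> = (\<Sum>u\<in>N. X u (D u f))"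
    using assms(1) N by (simp add: sum.If_cases Int_absorb1)
  finally show ?thesis .
qed

end

section \<open>Algebras generated by homogeneous operators\<close>

text \<open>
  \<open>galg R d\<close> is the part of parity \<open>d\<close> of the unital algebra in which the operators in \<open>R e\<close> are
  generators of parity \<open>e\<close>.  Words grow on the left only, and linear
  combinations stay within one parity, so that rule induction runs over homogeneous operators.
\<close>

inductive galg :: "(nat \<Rightarrow> (svec \<Rightarrow> svec) set) \<Rightarrow> nat \<Rightarrow> (svec \<Rightarrow> svec) \<Rightarrow> bool"
  for R :: "nat \<Rightarrow> (svec \<Rightarrow> svec) set" where
  galg_id: "galg R 0 (\<lambda>f. f)"
| galg_zero: "d < 2 \<Longrightarrow> galg R d (\<lambda>f. 0)"
| galg_gen: "G \<in> R e \<Longrightarrow> galg R d T \<Longrightarrow> galg R ((d + e) mod 2) (\<lambda>f. G (T f))"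
| galg_add: "galg R d T \<Longrightarrow> galg R d T' \<Longrightarrow> galg R d (\<lambda>f. T f + T' f)"
| galg_smul: "galg R d T \<Longrightarrow> galg R d (\<lambda>f. c *\<^sub>f T f)"

lemma galg_lin:
  assumes "galg R d T" "\<And>e G. G \<in> R e \<Longrightarrow> lin G"
  shows "lin T"
  using assms(1)
proof (induction rule: galg.induct)
  case (galg_gen G e d T)
  show ?case
    by (rule linI) (simp_all only: lin_add[OF galg_gen.IH] lin_smul[OF galg_gen.IH]
      lin_add[OF assms(2)[OF galg_gen.hyps(1)]] lin_smul[OF assms(2)[OF galg_gen.hyps(1)]])
next
  case (galg_add d T T')
  show ?case
    by (rule linI) (simp_all only: lin_add[OF galg_add.IH(1)] lin_smul[OF galg_add.IH(1)]
        lin_add[OF galg_add.IH(2)] lin_smul[OF galg_add.IH(2)] smul_add add_ac)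
next
  case (galg_smul d T c)
  show ?case
    by (rule linI) (simp_all add: lin_add[OF galg_smul.IH(1)] lin_smul[OF galg_smul.IH(1)] smul_add mult.commute)
qed (simp_all add: lin_def)

text \<open>
  An operator \<open>E\<close> of parity \<open>e\<close> that supercommutes with the generators supercommutes with everything.
  The lemma is also applied to the parity operator, which behaves as if it had \<open>e = 1\<close>.
\<close>

lemma galg_supercommute:
  assumes "galg R d T" and E: "lin E"
    and comm: "\<And>e' G f. G \<in> R e' \<Longrightarrow> G (E f) = (-1) ^ (e' * e) *\<^sub>f E (G f)"
    and lin: "\<And>e G. G \<in> R e \<Longrightarrow> lin G"
  shows "T (E f) = (-1) ^ (d * e) *\<^sub>f E (T f)"
  using assms(1)
proof (induction arbitrary: f rule: galg.induct)
  case (galg_gen G e' d T)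
  have "G (T (E f)) = ((-1) ^ (d * e) * (-1) ^ (e' * e)) *\<^sub>f E (G (T f))"
    by (simp add: galg_gen.IH lin_smul[OF lin[OF galg_gen.hyps(1)]] comm[OF galg_gen.hyps(1)])
  also have "(-1 :: complex) ^ (d * e) * (-1) ^ (e' * e) = (-1) ^ ((d + e') mod 2 * e)"
    using minus_one_power_mod_two[of "d + e'" "(d + e') mod 2" e] by (simp add: power_add algebra_simps)
  finally show ?case .
qed (simp_all add: lin_zero[OF E] lin_add[OF E] lin_smul[OF E] smul_add mult.commute)

section \<open>Cyclic vectors of the symmetric superalgebra\<close>

definition unit :: "'i \<Rightarrow> 'i \<Rightarrow> 'i \<Rightarrow> 'i \<Rightarrow> complex" where
  "unit i j = (\<lambda>k l. if k = i \<and> l = j then 1 else 0)"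

context fock
begin

definition vac :: svec where
  "vac = (\<lambda>M. if M = ({#}, {}) then 1 else 0)"

lemma vac_Sk: "vac \<in> Sk U 0"
  by (auto simp: vac_def supp_on_def mon_def)

lemma D_vac: "D u vac = 0"
  by (rule D_S0[OF _ vac_Sk]) (rule finite.emptyI)

lemma dop_vac: "dop U T vac = 0"
  by (simp add: dop_def D_vac lin_zero[OF lin_X])

lemma Sk_0:
  assumes "finite U" "f \<in> Sk U 0"
  shows "f = f ({#}, {}) *\<^sub>f vac"
proof (rule ext)
  fix M :: smonom
  have "M \<notin> mon U 0" if "M \<noteq> ({#}, {})"
  proof
    assume m: "M \<in> mon U 0"
    then have "snd M \<subseteq> U" by (auto simp: mon_def)
    then have "finite (snd M)" using assms(1) by (rule finite_subset)
    then show False using m that by (auto simp: mon_def)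
  qed
  then show "f M = (f ({#}, {}) *\<^sub>f vac) M"
    using assms(2) by (cases "M = ({#}, {})") (auto simp: vac_def pointwise supp_on_def simp del: split_paired_All)
qed

lemma Sk_words:
  assumes "finite U" "subsp K" "\<And>ws. set ws \<subseteq> U \<Longrightarrow> length ws = k \<Longrightarrow> foldr X ws vac \<in> K"
  shows "Sk U k \<subseteq> K"
  using assms(2,3)
proof (induction k arbitrary: K)
  case 0
  show ?case
  proof
    fix f assume "f \<in> Sk U 0"
    then have "f = f ({#}, {}) *\<^sub>f vac" by (rule Sk_0[OF assms(1)])
    moreover have "vac \<in> K" using 0(2)[of "[]"] by simp
    ultimately show "f \<in> K" using 0(1) unfolding subsp_def by metis
  qed
next
  case (Suc k)
  show ?case
  proof
    fix f assume f: "f \<in> Sk U (Suc k)"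
    have "X u (D u f) \<in> K" if u: "u \<in> U" for u
    proof -
      have "Sk U k \<subseteq> {g. X u g \<in> K}"
      proof (rule Suc.IH)
        show "subsp {g. X u g \<in> K}"
          using Suc.prems(1) by (auto simp: subsp_def lin_zero[OF lin_X] lin_add[OF lin_X] lin_smul[OF lin_X])
        show "foldr X ws vac \<in> {g. X u g \<in> K}" if "set ws \<subseteq> U" "length ws = k" for ws
          using Suc.prems(2)[of "u # ws"] that u by simp
      qed
      then show ?thesis using D_Sk[OF assms(1) f] by blast
    qed
    then have "(\<Sum>u\<in>U. X u (D u f)) \<in> K" by (rule subsp_sum[OF Suc.prems(1)])
    then have "of_nat (Suc k) *\<^sub>f f \<in> K" by (simp only: euler[OF assms(1) f])
    then have "(1 / of_nat (Suc k)) *\<^sub>f of_nat (Suc k) *\<^sub>f f \<in> K"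
      using Suc.prems(1) unfolding subsp_def by blast
    then show "f \<in> K" by (simp del: of_nat_Suc)
  qed
qed

text \<open>
  The vector \<open>(\<Sum>z\<in>Z. b\<^sub>z)\<^sup>r\<close>.
\<close>

definition power_vec :: "nat set \<Rightarrow> nat \<Rightarrow> svec" where
  "power_vec Z r = ((\<lambda>f. \<Sum>z\<in>Z. X z f) ^^ r) vac"

lemma power_vec_Suc: "power_vec Z (Suc r) = (\<Sum>z\<in>Z. X z (power_vec Z r))"
  by (simp add: power_vec_def)

lemma power_vec_Sk:
  assumes "finite U" "Z \<subseteq> U"
  shows "power_vec Z r \<in> Sk U r"
proof (induction r)
  case 0
  then show ?case using vac_Sk by (simp add: power_vec_def)
next
  case (Suc r)
  then show ?case unfolding power_vec_Suc using assms by (intro supp_on_sum X_Sk) auto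
qed

lemma eps_power_vec:
  assumes "\<And>z. z \<in> Z \<Longrightarrow> \<pi> z = 0"
  shows "eps (power_vec Z r) = power_vec Z r"
proof (induction r)
  case 0
  then show ?case by (auto simp: power_vec_def eps_def vac_def fun_eq_iff)
next
  case (Suc r)
  have "eps (X z f) = X z (eps f)" if "z \<in> Z" for z f
    using X_eps[of z f] assms[OF that] by simp
  then show ?case unfolding power_vec_Suc lin_sum[OF lin_eps] by (simp add: Suc)
qed

text \<open>
  The derivative of a power.  The hypothesis on \<open>T\<close> says that it sends \<open>\<Sum>z\<in>Z. b\<^sub>z\<close> to \<open>c b\<^sub>u\<close>; the factors of
  the power are even, so \<open>b\<^sub>u\<close> can be moved to the front without a sign.
\<close>

lemma dop_power_vec:
  assumes U: "finite U" "Z \<subseteq> U" and ev: "\<And>z. z \<in> Z \<Longrightarrow> \<pi> z = 0" and T: "homog U e T"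
    and u: "u \<in> U" "\<And>w. w \<in> U \<Longrightarrow> (\<Sum>z\<in>Z. T w z) = (if w = u then c else 0)"
  shows "dop U T (power_vec Z r) = (of_nat r * c) *\<^sub>f X u (power_vec Z (r - 1))"
proof (induction r)
  case 0
  then show ?case by (simp add: power_vec_def dop_vac)
next
  case (Suc r)
  let ?f = "power_vec Z r"
  have "dop U T (power_vec Z (Suc r)) = (\<Sum>z\<in>Z. (\<Sum>w\<in>U. T w z *\<^sub>f X w ?f) + X z (dop U T ?f))"
    unfolding power_vec_Suc lin_sum[OF lin_dop]
    by (intro sum.cong refl) (use U ev in \<open>auto simp: dop_X[OF U(1) T]\<close>)
  also have "\<dots> = (\<Sum>w\<in>U. (\<Sum>z\<in>Z. T w z) *\<^sub>f X w ?f) + (\<Sum>z\<in>Z. X z (dop U T ?f))"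
  proof -
    have "(\<Sum>z\<in>Z. \<Sum>w\<in>U. T w z *\<^sub>f X w ?f) = (\<Sum>w\<in>U. \<Sum>z\<in>Z. T w z *\<^sub>f X w ?f)" by (rule sum.swap)
    also have "\<dots> = (\<Sum>w\<in>U. (\<Sum>z\<in>Z. T w z) *\<^sub>f X w ?f)"
      by (simp add: fun_eq_iff pointwise sum_apply sum_distrib_right)
    finally show ?thesis by (simp add: sum.distrib)
  qed
  also have "(\<Sum>w\<in>U. (\<Sum>z\<in>Z. T w z) *\<^sub>f X w ?f) = (\<Sum>w\<in>U. if w = u then c *\<^sub>f X u ?f else 0)"
    by (intro sum.cong refl) (simp add: u(2))
  also have "\<dots> = c *\<^sub>f X u ?f" using U u by simp
  also have "(\<Sum>z\<in>Z. X z (dop U T ?f)) = (of_nat r * c) *\<^sub>f X u ?f"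
  proof (cases r)
    case 0
    then show ?thesis unfolding Suc.IH by (simp add: lin_zero[OF lin_X])
  next
    case (Suc r')
    have "(\<Sum>z\<in>Z. X z (dop U T ?f)) = (\<Sum>z\<in>Z. (of_nat r * c) *\<^sub>f X u (X z (power_vec Z r')))"
      unfolding Suc.IH by (intro sum.cong refl) (simp add: ev X_X[of _ u] lin_smul[OF lin_X] Suc)
    also have "\<dots> = (of_nat r * c) *\<^sub>f X u (\<Sum>z\<in>Z. X z (power_vec Z r'))"
      unfolding lin_sum[OF lin_X] by (simp add: fun_eq_iff pointwise sum_apply sum_distrib_left)
    finally show ?thesis by (simp add: Suc power_vec_Suc)
  qed
  finally show ?case by (simp add: fun_eq_iff pointwise algebra_simps)
qed

text \<open>
  The Leibniz rule for a word of generators applied to \<open>g\<close>: apart from the term in which \<open>g\<close> is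
  differentiated, one letter of the word is replaced by others.  Those terms are words of the same
  length, and all that matters is that \<open>K\<close> contains them.
\<close>

lemma dop_word:
  assumes U: "finite U" "U1 \<subseteq> U" and T: "homog U e T"
    and st: "\<And>v w. v \<in> U1 \<Longrightarrow> w \<in> U \<Longrightarrow> T w v \<noteq> 0 \<Longrightarrow> w \<in> U1"
    and K: "subsp K" "\<And>ws'. set ws' \<subseteq> U1 \<Longrightarrow> length ws' = length ws \<Longrightarrow> foldr X ws' g \<in> K"
    and ws: "set ws \<subseteq> U1"
  shows "\<exists>\<sigma>. \<sigma> \<noteq> 0 \<and> dop U T (foldr X ws g) - \<sigma> *\<^sub>f foldr X ws (dop U T g) \<in> K"
  using K ws
proof (induction ws arbitrary: K)
  case Nil
  then show ?case by (intro exI[of _ 1]) (simp add: subsp_def)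
next
  case (Cons v ws)
  let ?h = "foldr X ws g" let ?s = "(-1) ^ (e * \<pi> v) :: complex"
  have v: "v \<in> U1" "v \<in> U" "set ws \<subseteq> U1" using Cons.prems U by auto
  have "\<exists>\<sigma>. \<sigma> \<noteq> 0 \<and> dop U T ?h - \<sigma> *\<^sub>f foldr X ws (dop U T g) \<in> {f. X v f \<in> K}"
  proof (rule Cons.IH)
    show "subsp {f. X v f \<in> K}"
      using Cons.prems(1) by (auto simp: subsp_def lin_zero[OF lin_X] lin_add[OF lin_X] lin_smul[OF lin_X])
    show "foldr X ws' g \<in> {f. X v f \<in> K}" if "set ws' \<subseteq> U1" "length ws' = length ws" for ws'
      using Cons.prems(2)[of "v # ws'"] that v by simp
  qed (use v in auto)
  then obtain \<sigma> where \<sigma>: "\<sigma> \<noteq> 0" "X v (dop U T ?h - \<sigma> *\<^sub>f foldr X ws (dop U T g)) \<in> K" by blast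
  have "T w v *\<^sub>f X w ?h \<in> K" if "w \<in> U" for w
  proof (cases "T w v = 0")
    case True
    then show ?thesis using Cons.prems(1) by (simp add: subsp_def)
  next
    case False
    then have "w \<in> U1" using st v that by blast
    then have "X w ?h \<in> K" using Cons.prems(2)[of "w # ws"] v by simp
    then show ?thesis using Cons.prems(1) by (simp add: subsp_def)
  qed
  then have 1: "(\<Sum>w\<in>U. T w v *\<^sub>f X w ?h) \<in> K" by (rule subsp_sum[OF Cons.prems(1)])
  have 2: "?s *\<^sub>f X v (dop U T ?h - \<sigma> *\<^sub>f foldr X ws (dop U T g)) \<in> K"
    using \<sigma> Cons.prems(1) by (simp add: subsp_def)
  have "dop U T (foldr X (v # ws) g) - (?s * \<sigma>) *\<^sub>f foldr X (v # ws) (dop U T g)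
     = (\<Sum>w\<in>U. T w v *\<^sub>f X w ?h) + ?s *\<^sub>f X v (dop U T ?h - \<sigma> *\<^sub>f foldr X ws (dop U T g))"
    by (simp add: dop_X[OF U(1) T v(2)] lin_diff[OF lin_X] lin_smul[OF lin_X] smul_diff)
  then have "dop U T (foldr X (v # ws) g) - (?s * \<sigma>) *\<^sub>f foldr X (v # ws) (dop U T g) \<in> K"
    using 1 2 Cons.prems(1) unfolding subsp_def by (simp only:)
  moreover have "?s * \<sigma> \<noteq> 0" using \<sigma> by simp
  ultimately show ?case by blast
qed

text \<open>
  Suppose that for every generator \<open>b\<^sub>u\<close> with \<open>u \<in> U1\<close> some admissible derivation sends \<open>s = \<Sum>z\<in>Z. b\<^sub>z\<close>
  to a nonzero multiple of \<open>b\<^sub>u\<close>.  Applied to a word of length \<open>n\<close> times \<open>s\<^bsup>r + 1\<^esup>\<close>, it yields words of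
  length \<open>n\<close> times \<open>s\<^bsup>r + 1\<^esup>\<close>, in \<open>K\<close> by induction, and a nonzero multiple of the word extended by \<open>b\<^sub>u\<close>
  times \<open>s\<^sup>r\<close>, the multiple containing the factor \<open>r + 1\<close>.  So
  starting from \<open>s\<^sup>k\<close>, all words of length \<open>k\<close> are reached.
\<close>

lemma power_vec_cyclic:
  assumes U: "finite U" "U1 \<subseteq> U" "Z \<subseteq> U1" and ev: "\<And>z. z \<in> Z \<Longrightarrow> \<pi> z = 0"
    and K: "subsp K" "power_vec Z k \<in> K"
    and T: "\<And>u. u \<in> U1 \<Longrightarrow> homog U (e u) (T u)"
    and TK: "\<And>u f. u \<in> U1 \<Longrightarrow> f \<in> K \<Longrightarrow> dop U (T u) f \<in> K"
    and st: "\<And>u v w. u \<in> U1 \<Longrightarrow> v \<in> U1 \<Longrightarrow> w \<in> U \<Longrightarrow> T u w v \<noteq> 0 \<Longrightarrow> w \<in> U1"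
    and c: "\<And>u w. u \<in> U1 \<Longrightarrow> w \<in> U \<Longrightarrow> (\<Sum>z\<in>Z. T u w z) = (if w = u then c u else 0)"
      "\<And>u. u \<in> U1 \<Longrightarrow> c u \<noteq> 0"
  shows "Sk U1 k \<subseteq> K"
proof -
  have words: "foldr X ws (power_vec Z s) \<in> K" if "set ws \<subseteq> U1" "length ws = n" "n + s = k" for n ws s
    using that
  proof (induction n arbitrary: ws s)
    case 0
    then show ?case using K by simp
  next
    case (Suc n)
    \<comment> \<open>The new letter is the last one: the derivation takes it out of the power that follows the word.\<close>
    obtain ws' u where ws: "ws = ws' @ [u]" using Suc.prems(2) by (metis length_Suc_conv_rev)
    have u: "u \<in> U1" "u \<in> U" and ws': "set ws' \<subseteq> U1" "length ws' = n" using Suc.prems ws U by auto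
    let ?g = "power_vec Z (Suc s)"
    have inK: "foldr X vs ?g \<in> K" if "set vs \<subseteq> U1" "length vs = length ws'" for vs
      using that Suc.IH[of vs "Suc s"] Suc.prems(3) ws' by simp
    have "\<exists>\<sigma>. \<sigma> \<noteq> 0 \<and> dop U (T u) (foldr X ws' ?g) - \<sigma> *\<^sub>f foldr X ws' (dop U (T u) ?g) \<in> K"
      by (rule dop_word[OF U(1,2) T[OF u(1)] _ K(1) inK ws'(1)]) (rule st[OF u(1)])
    then obtain \<sigma> where \<sigma>: "\<sigma> \<noteq> 0"
        "dop U (T u) (foldr X ws' ?g) - \<sigma> *\<^sub>f foldr X ws' (dop U (T u) ?g) \<in> K"
      by (elim exE conjE)
    have "dop U (T u) (foldr X ws' ?g) \<in> K" using TK u(1) inK ws' by blast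
    from subsp_diff[OF K(1) this \<sigma>(2)] have "\<sigma> *\<^sub>f foldr X ws' (dop U (T u) ?g) \<in> K"
      by simp
    moreover have "Z \<subseteq> U" using U by blast
    then have "dop U (T u) ?g = (of_nat (Suc s) * c u) *\<^sub>f X u (power_vec Z s)"
      using dop_power_vec[OF U(1) _ ev T[OF u(1)] u(2) c(1)[OF u(1)], of "Suc s"] by simp
    ultimately have "(\<sigma> * (of_nat (Suc s) * c u)) *\<^sub>f foldr X ws (power_vec Z s) \<in> K"
      by (simp only: lin_smul[OF lin_foldr[OF lin_X]] smul_smul ws foldr_append foldr.simps comp_apply id_apply)
    then have "(1 / (\<sigma> * (of_nat (Suc s) * c u))) *\<^sub>f (\<sigma> * (of_nat (Suc s) * c u)) *\<^sub>f foldr X ws (power_vec Z s) \<in> K"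
      using K(1) unfolding subsp_def by blast
    moreover have "\<sigma> * (of_nat (Suc s) * c u) \<noteq> 0" using \<sigma>(1) c(2)[OF u(1)] by (simp del: of_nat_Suc)
    ultimately show ?case by (simp del: of_nat_Suc)
  qed
  show ?thesis
  proof (rule Sk_words[OF _ K(1)])
    show "finite U1" using U finite_subset by blast
    show "foldr X ws vac \<in> K" if "set ws \<subseteq> U1" "length ws = k" for ws
      using words[OF that, of 0] by (simp add: power_vec_def)
  qed
qed

lemma inner_sum_left: "inner \<mu> S (\<Sum>i\<in>J. f i) g = (\<Sum>i\<in>J. inner \<mu> S (f i) g)"
  by (induction J rule: infinite_finite_induct) (simp_all add: inner_add_left)

lemma inner_sum_right: "inner \<mu> S g (\<Sum>i\<in>J. f i) = (\<Sum>i\<in>J. inner \<mu> S g (f i))"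
proof (induction J rule: infinite_finite_induct)
  case (insert x F)
  then show ?case by (simp add: inner_add_right)
qed (simp_all add: inner_commute[of \<mu> S g 0])

lemma inner_dop:
  assumes "finite U" "f \<in> Sk U k" "g \<in> Sk U k"
  shows "inner weight (mon U k) (dop U T f) g = inner weight (mon U k) f (dop U (\<lambda>u v. cnj (T v u)) g)"
proof -
  have "inner weight (mon U k) (dop U T f) g
     = (\<Sum>u\<in>U. \<Sum>v\<in>U. T u v * inner weight (mon U k) f (X v (D u g)))"
    using assms by (simp add: dop_def inner_sum_left inner_smul_left inner_XD)
  also have "\<dots> = (\<Sum>v\<in>U. \<Sum>u\<in>U. T u v * inner weight (mon U k) f (X v (D u g)))" by (rule sum.swap)
  also have "\<dots> = inner weight (mon U k) f (dop U (\<lambda>u v. cnj (T v u)) g)"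
    by (simp add: dop_def inner_sum_right inner_smul_right)
  finally show ?thesis .
qed

lemma dop_restrict:
  assumes "finite U" "U0 \<subseteq> U" "f \<in> Sk U0 k"
    and T: "\<And>u v. u \<in> U \<Longrightarrow> v \<in> U0 \<Longrightarrow> T u v \<noteq> 0 \<Longrightarrow> u \<in> U0"
  shows "dop U T f = dop U0 T f"
proof -
  have "(\<Sum>v\<in>U. T u v *\<^sub>f X u (D v f)) = (\<Sum>v\<in>U0. T u v *\<^sub>f X u (D v f))" for u
    using assms D_outside[OF assms(3)] by (intro sum.mono_neutral_right) (auto simp: lin_zero[OF lin_X])
  moreover have "(\<Sum>v\<in>U0. T u v *\<^sub>f X u (D v f)) = 0" if "u \<in> U - U0" for u
    using that T by (intro sum.neutral) fastforce
  ultimately show ?thesis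
    unfolding dop_def using assms(1,2) by (simp add: sum.mono_neutral_right[OF assms(1,2)])
qed

text \<open>
  If the matrix is block diagonal with respect to \<open>U0\<close> and its complement, the derivation commutes
  with the orthogonal projection to the monomials in \<open>U0\<close>: it preserves this subspace, and so does
  its adjoint, which therefore preserves the orthogonal complement.
\<close>

lemma dop_restr:
  assumes U: "finite U" "U0 \<subseteq> U" and f: "f \<in> Sk U k"
    and T: "\<And>u v. u \<in> U \<Longrightarrow> v \<in> U \<Longrightarrow> T u v \<noteq> 0 \<Longrightarrow> u \<in> U0 \<longleftrightarrow> v \<in> U0"
  shows "dop U T (restr (mon U0 k) f) = restr (mon U0 k) (dop U T f)"
proof -
  let ?e = "restr (mon U0 k)" let ?T' = "\<lambda>u v. cnj (T v u)"
  let ?in = "inner weight (mon U k)"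
  have U0: "finite U0" using U finite_subset by blast
  have sub: "Sk U0 k \<subseteq> Sk U k" using supp_on_mono mon_mono[OF U(2)] by blast
  have fixed: "dop U S h \<in> Sk U0 k" if "h \<in> Sk U0 k" "S = T \<or> S = ?T'" for h S
  proof -
    have "dop U S h = dop U0 S h"
      by (rule dop_restrict[OF U that(1)]) (use T U(2) that(2) in auto)
    then show ?thesis using dop_Sk[OF U0 that(1)] by simp
  qed
  have inner_e: "?in a h = ?in (?e a) h" if "h \<in> Sk U0 k" for a h
    unfolding inner_def using that by (intro sum.cong refl) (auto simp: restr_def supp_on_def)
  let ?g = "f - ?e f"
  have eg: "?e ?g = 0"
    by (simp add: lin_diff[OF lin_restr] restr_id[OF restr_in])
  have ef: "?e f \<in> Sk U k" using sub restr_in by blast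
  have g: "?g \<in> Sk U k" using f ef by blast
  let ?h = "?e (dop U T ?g)"
  have "?in ?h ?h = ?in (dop U T ?g) ?h" using inner_e[OF restr_in] by metis
  also have "\<dots> = ?in ?g (dop U ?T' ?h)"
    using g sub restr_in by (intro inner_dop[OF U(1)]) auto
  also have "\<dots> = ?in (?e ?g) (dop U ?T' ?h)" by (rule inner_e) (rule fixed, simp_all)
  also have "\<dots> = 0" unfolding eg by simp
  finally have "?h = 0"
    using inner_self_eq_0[OF finite_mon[OF U(1)]] weight_pos sub restr_in by blast
  then have "?e (dop U T f) = ?e (dop U T (?e f))"
    by (simp add: lin_diff[OF lin_restr] lin_diff[OF lin_dop])
  also have "\<dots> = dop U T (?e f)" by (rule restr_id) (rule fixed, simp_all)
  finally show ?thesis by simp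
qed

end

section \<open>Two supercommuting general linear superalgebras\<close>

text \<open>
  Generators have a row \<open>r u\<close> and a column \<open>c u\<close>, with parity functions \<open>p\<close> and \<open>q\<close>.  A matrix \<open>X\<close> indexed
  by rows acts on \<open>V \<otimes> W\<close> by leaving the column alone.  With \<open>\<gamma> = 0\<close> this is \<open>X \<otimes> 1\<close>; with \<open>\<gamma> = 1\<close> there
  is the sign of moving \<open>X\<close> past the column.  Exchanging the roles of rows and columns gives the
  action of the other algebra, so that one set of lemmas covers both.
\<close>

definition lift :: "nat \<Rightarrow> ('i \<Rightarrow> nat) \<Rightarrow> ('a \<Rightarrow> nat) \<Rightarrow> (nat \<Rightarrow> 'i) \<Rightarrow> (nat \<Rightarrow> 'a)
    \<Rightarrow> ('i \<Rightarrow> 'i \<Rightarrow> complex) \<Rightarrow> nat \<Rightarrow> nat \<Rightarrow> complex" where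
  "lift \<gamma> p q r c X u v =
     (if c u = c v then (-1) ^ (\<gamma> * ((p (r u) + p (r v)) * q (c v))) * X (r u) (r v) else 0)"

lemma par_homog_unit: "par_homog p I ((p i + p j) mod 2) (unit i j)"
  by (auto simp: par_homog_def unit_def)

lemma mmul_unit:
  "finite I \<Longrightarrow> mmul I (unit i j) (unit k l) = (\<lambda>u w. if j = k \<and> k \<in> I then unit i l u w else 0)"
proof (intro ext)
  fix u w assume "finite I"
  have "mmul I (unit i j) (unit k l) u w = (\<Sum>v\<in>I. if v = k then (if j = k then unit i l u w else 0) else 0)"
    unfolding mmul_def by (intro sum.cong refl) (auto simp: unit_def)
  then show "mmul I (unit i j) (unit k l) u w = (if j = k \<and> k \<in> I then unit i l u w else 0)"
    using \<open>finite I\<close> by simp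
qed

lemma if_combination:
  "(if P then x else 0) - s * (if Q then y else 0) = (if P then 1 else 0) * x + (- s * (if Q then 1 else 0)) * y"
  for x y s :: complex
  by simp

locale lifting = fock \<pi> for \<pi> +
  fixes U :: "nat set" and I :: "'i set" and A :: "'a set" and p :: "'i \<Rightarrow> nat" and q :: "'a \<Rightarrow> nat"
    and r :: "nat \<Rightarrow> 'i" and c :: "nat \<Rightarrow> 'a" and lab :: "'i \<Rightarrow> 'a \<Rightarrow> nat" and \<gamma> :: nat
  assumes finite: "finite U" "finite I" "finite A"
    and rc: "\<And>u. u \<in> U \<Longrightarrow> r u \<in> I \<and> c u \<in> A \<and> lab (r u) (c u) = u"
    and lab: "\<And>i a. i \<in> I \<Longrightarrow> a \<in> A \<Longrightarrow> lab i a \<in> U \<and> r (lab i a) = i \<and> c (lab i a) = a"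
    and par: "\<And>u. u \<in> U \<Longrightarrow> \<pi> u = (p (r u) + q (c u)) mod 2"
begin

abbreviation lft :: "('i \<Rightarrow> 'i \<Rightarrow> complex) \<Rightarrow> nat \<Rightarrow> nat \<Rightarrow> complex" where
  "lft \<equiv> lift \<gamma> p q r c"

abbreviation L :: "('i \<Rightarrow> 'i \<Rightarrow> complex) \<Rightarrow> svec \<Rightarrow> svec" where
  "L Y \<equiv> dop U (lft Y)"

lemma lift_homog: "par_homog p I e Y \<Longrightarrow> homog U e (lft Y)"
  unfolding par_homog_def
proof (intro ballI impI)
  fix u v assume h: "\<forall>i\<in>I. \<forall>j\<in>I. Y i j \<noteq> 0 \<longrightarrow> (p i + p j) mod 2 = e"
    and uv: "u \<in> U" "v \<in> U" "lft Y u v \<noteq> 0"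
  then have "c u = c v" "(p (r u) + p (r v)) mod 2 = e"
    using rc[of u] rc[of v] by (auto simp: lift_def split: if_splits)
  then show "(\<pi> u + \<pi> v) mod 2 = e" using par[OF uv(1)] par[OF uv(2)] by (simp add: mod_simps) presburger
qed

text \<open>
  The generators of one column correspond to the rows; this turns products of lifted matrices
  into products of matrices.
\<close>

lemma sum_column:
  assumes "u \<in> U"
  shows "(\<Sum>v\<in>U. if c v = c u then g v else 0) = (\<Sum>i\<in>I. g (lab i (c u)))"
proof -
  have "(\<Sum>v\<in>U. if c v = c u then g v else 0) = (\<Sum>v\<in>{v\<in>U. c v = c u}. g v)"
    using finite by (intro sum.mono_neutral_cong_right) auto
  also have "\<dots> = (\<Sum>i\<in>I. g (lab i (c u)))"
  proof (rule sum.reindex_bij_witness[where i = "\<lambda>i. lab i (c u)" and j = r])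
    fix v assume "v \<in> {v \<in> U. c v = c u}"
    then show "lab (r v) (c u) = v" "r v \<in> I" "g (lab (r v) (c u)) = g v" using rc[of v] by auto
  next
    fix i assume "i \<in> I"
    then show "r (lab i (c u)) = i" "lab i (c u) \<in> {v \<in> U. c v = c u}" using lab rc[OF assms] by auto
  qed
  finally show ?thesis .
qed

lemma mmul_lift:
  assumes u: "u \<in> U" "w \<in> U"
  shows "mmul U (lft Y) (lft Y') u w = lft (mmul I Y Y') u w"
proof -
  have sg: "(-1 :: complex) ^ (\<gamma> * ((a + b) * k)) * (-1) ^ (\<gamma> * ((b + d) * k)) = (-1) ^ (\<gamma> * ((a + d) * k))"
    for a b d k by (simp flip: power_add add: minus_one_power_iff)
  have "mmul U (lft Y) (lft Y') u w = (\<Sum>v\<in>U. if c v = c u then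
      (if c u = c w then (-1) ^ (\<gamma> * ((p (r u) + p (r w)) * q (c w))) * (Y (r u) (r v) * Y' (r v) (r w)) else 0) else 0)"
    unfolding mmul_def lift_def
  proof (intro sum.cong refl)
    fix v
    have rearrange: "x1 * y * (x2 * y') = (x1 * x2) * (y * y')" for x1 x2 y y' :: complex by simp
    have "(-1) ^ (\<gamma> * ((p (r u) + p (r v)) * q (c w))) * Y (r u) (r v) *
        ((-1) ^ (\<gamma> * ((p (r v) + p (r w)) * q (c w))) * Y' (r v) (r w)) =
        (-1) ^ (\<gamma> * ((p (r u) + p (r w)) * q (c w))) * (Y (r u) (r v) * Y' (r v) (r w))"
      by (subst rearrange) (simp only: sg)
    then show "(if c u = c v then (-1) ^ (\<gamma> * ((p (r u) + p (r v)) * q (c v))) * Y (r u) (r v) else 0) *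
        (if c v = c w then (-1) ^ (\<gamma> * ((p (r v) + p (r w)) * q (c w))) * Y' (r v) (r w) else 0) =
      (if c v = c u then
        (if c u = c w then (-1) ^ (\<gamma> * ((p (r u) + p (r w)) * q (c w))) * (Y (r u) (r v) * Y' (r v) (r w)) else 0) else 0)"
      by auto
  qed
  also have "\<dots> = (\<Sum>i\<in>I. if c u = c w then (-1) ^ (\<gamma> * ((p (r u) + p (r w)) * q (c w))) * (Y (r u) i * Y' i (r w)) else 0)"
    unfolding sum_column[OF u(1)] using lab rc[OF u(1)] by (intro sum.cong refl) auto
  also have "\<dots> = lft (mmul I Y Y') u w"
    by (simp add: lift_def mmul_def sum_distrib_left)
  finally show ?thesis .
qed

lemma L_bracket:
  assumes "par_homog p I e Y" "par_homog p I e' Y'"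
  shows "L Y (L Y' f) = (-1) ^ (e * e') *\<^sub>f L Y' (L Y f)
    + L (\<lambda>i j. mmul I Y Y' i j - (-1) ^ (e * e') * mmul I Y' Y i j) f"
proof -
  have "L Y (L Y' f) = (-1) ^ (e * e') *\<^sub>f L Y' (L Y f)
    + dop U (\<lambda>u w. mmul U (lft Y) (lft Y') u w - (-1) ^ (e * e') * mmul U (lft Y') (lft Y) u w) f"
    using assms by (intro dop_bracket lift_homog finite)
  also have "dop U (\<lambda>u w. mmul U (lft Y) (lft Y') u w - (-1) ^ (e * e') * mmul U (lft Y') (lft Y) u w) f
    = L (\<lambda>i j. mmul I Y Y' i j - (-1) ^ (e * e') * mmul I Y' Y i j) f"
    by (rule dop_cong) (simp add: mmul_lift, simp add: lift_def algebra_simps)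
  finally show ?thesis .
qed

lemma L_add: "L (\<lambda>i j. Y i j + Y' i j) f = L Y f + L Y' f"
  unfolding dop_add[symmetric] by (rule dop_cong) (simp add: lift_def algebra_simps)

lemma L_smul: "L (\<lambda>i j. k * Y i j) f = k *\<^sub>f L Y f"
  unfolding dop_smul[symmetric] by (rule dop_cong) (simp add: lift_def algebra_simps)

lemma L_cong: "(\<And>i j. i \<in> I \<Longrightarrow> j \<in> I \<Longrightarrow> Y i j = Y' i j) \<Longrightarrow> L Y f = L Y' f"
  using rc by (intro dop_cong) (auto simp: lift_def)

text \<open>
  The form of the commutation relations in which words are reordered: exchanging two letters
  costs a scalar and produces two single letters.
\<close>

lemma L_unit_bracket:
  "\<exists>k1 k2 k3. \<forall>f. L (unit i j) (L (unit i' j') f) =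
     k1 *\<^sub>f L (unit i' j') (L (unit i j) f) + (k2 *\<^sub>f L (unit i j') f + k3 *\<^sub>f L (unit i' j) f)"
proof -
  let ?s = "(-1 :: complex) ^ ((p i + p j) mod 2 * ((p i' + p j') mod 2))"
  let ?k2 = "if j = i' \<and> i' \<in> I then 1 else 0 :: complex"
  let ?k3 = "- ?s * (if j' = i \<and> i \<in> I then 1 else 0 :: complex)"
  have *: "(\<lambda>k l. mmul I (unit i j) (unit i' j') k l - ?s * mmul I (unit i' j') (unit i j) k l)
     = (\<lambda>k l. ?k2 * unit i j' k l + ?k3 * unit i' j k l)"
    by (simp only: mmul_unit[OF finite(2)] if_combination)
  have "L (unit i j) (L (unit i' j') f) = ?s *\<^sub>f L (unit i' j') (L (unit i j) f)
     + (?k2 *\<^sub>f L (unit i j') f + ?k3 *\<^sub>f L (unit i' j) f)" for f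
    using L_bracket[OF par_homog_unit par_homog_unit, of i j i' j' f] unfolding * L_add L_smul .
  then show "\<exists>k1 k2 k3. \<forall>f. L (unit i j) (L (unit i' j') f) =
     k1 *\<^sub>f L (unit i' j') (L (unit i j) f) + (k2 *\<^sub>f L (unit i j') f + k3 *\<^sub>f L (unit i' j) f)" by blast
qed

lemma L_adjoint:
  assumes "f \<in> Sk U k" "g \<in> Sk U k"
  shows "inner weight (mon U k) (L (unit i j) f) g = inner weight (mon U k) f (L (unit j i) g)"
proof -
  have "dop U (\<lambda>u v. cnj (lft (unit i j) v u)) g = L (unit j i) g"
    by (rule dop_cong) (auto simp: lift_def unit_def add.commute)
  then show ?thesis using inner_dop[OF finite(1) assms, of "lft (unit i j)"] by simp
qed

end

text \<open>
  Exactly one of the two actions carries the sign of passing the other tensor factor.  Both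
  choices occur, as the two factors of \<open>V \<otimes> W\<close> play different roles in the sign rule.
\<close>

locale pairing = lifting \<pi> U I A p q r c lab \<gamma>
  for \<pi> U and I :: "'i set" and A :: "'a set" and p q r c lab \<gamma> +
  fixes \<delta> :: nat
  assumes signs: "\<gamma> + \<delta> = 1"
begin

sublocale R: lifting \<pi> U A I q p c r "\<lambda>a i. lab i a" \<delta>
  by unfold_locales (use finite rc lab par in \<open>auto simp: add.commute\<close>)

text \<open>
  Both composites send \<open>b\<^sub>w\<close> to generators in the row given by \<open>Y\<close> and the column given by \<open>Y'\<close>; they
  differ by the sign that the acting matrix with the sign rule picks up when the other matrix
  changes the parity of the factor that it passes.
\<close>

lemma L_R_supercommute:
  assumes Y: "par_homog p I e Y" and Y': "par_homog q A e' Y'"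
  shows "L Y (R.L Y' f) = (-1) ^ (e * e') *\<^sub>f R.L Y' (L Y f)"
proof -
  let ?T = "lft Y" and ?T' = "R.lft Y'"
  have *: "mmul U ?T ?T' u w = (-1) ^ (e * e') * mmul U ?T' ?T u w" if u: "u \<in> U" "w \<in> U" for u w
  proof -
    let ?Y = "Y (r u) (r w)" and ?Y' = "Y' (c u) (c w)"
    have inU: "lab (r w) (c u) \<in> U" "lab (r u) (c w) \<in> U"
      "r (lab (r w) (c u)) = r w" "c (lab (r w) (c u)) = c u" "r (lab (r u) (c w)) = r u" "c (lab (r u) (c w)) = c w"
      using rc u lab by blast+
    have uniq: "v = lab (r v) (c v)" if "v \<in> U" for v using rc[OF that] by simp
    have lr: "mmul U ?T ?T' u w = (-1) ^ (\<gamma> * ((p (r u) + p (r w)) * q (c u)) + \<delta> * ((q (c u) + q (c w)) * p (r w))) * (?Y * ?Y')"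
    proof -
      have "mmul U ?T ?T' u w = (\<Sum>v\<in>U. if v = lab (r w) (c u) then ?T u v * ?T' v w else 0)"
        unfolding mmul_def
        by (intro sum.cong refl) (use uniq in \<open>force simp: lift_def\<close>)
      also have "\<dots> = ?T u (lab (r w) (c u)) * ?T' (lab (r w) (c u)) w"
        using finite inU by simp
      also have "\<dots> = (-1) ^ (\<gamma> * ((p (r u) + p (r w)) * q (c u)) + \<delta> * ((q (c u) + q (c w)) * p (r w))) * (?Y * ?Y')"
        unfolding lift_def inU by (simp add: power_add)
      finally show ?thesis .
    qed
    have rl: "mmul U ?T' ?T u w = (-1) ^ (\<delta> * ((q (c u) + q (c w)) * p (r u)) + \<gamma> * ((p (r u) + p (r w)) * q (c w))) * (?Y * ?Y')"
    proof -
      have "mmul U ?T' ?T u w = (\<Sum>v\<in>U. if v = lab (r u) (c w) then ?T' u v * ?T v w else 0)"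
        unfolding mmul_def
        by (intro sum.cong refl) (use uniq in \<open>force simp: lift_def\<close>)
      also have "\<dots> = ?T' u (lab (r u) (c w)) * ?T (lab (r u) (c w)) w"
        using finite inU by simp
      also have "\<dots> = (-1) ^ (\<delta> * ((q (c u) + q (c w)) * p (r u)) + \<gamma> * ((p (r u) + p (r w)) * q (c w))) * (?Y * ?Y')"
        unfolding lift_def inU by (simp add: power_add)
      finally show ?thesis .
    qed
    show ?thesis
    proof (cases "?Y * ?Y' = 0")
      case True
      then show ?thesis unfolding lr rl by auto
    next
      case False
      then have e: "(p (r u) + p (r w)) mod 2 = e" "(q (c u) + q (c w)) mod 2 = e'"
        using Y Y' rc u unfolding par_homog_def by auto
      have "(-1 :: complex) ^ (e * e') = (-1) ^ ((p (r u) + p (r w)) * e')"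
        by (rule minus_one_power_mod_two[OF e(1), symmetric])
      also have "\<dots> = (-1) ^ ((p (r u) + p (r w)) * (q (c u) + q (c w)))"
        using minus_one_power_mod_two[OF e(2), of "p (r u) + p (r w)"] by (simp only: mult.commute)
      finally have ee: "(-1 :: complex) ^ (e * e') = \<dots>" .
      have "(\<gamma> = 0 \<and> \<delta> = 1) \<or> (\<gamma> = 1 \<and> \<delta> = 0)" using signs by auto
      then have "(-1 :: complex) ^ (\<gamma> * ((p (r u) + p (r w)) * q (c u)) + \<delta> * ((q (c u) + q (c w)) * p (r w)))
        = (-1) ^ ((p (r u) + p (r w)) * (q (c u) + q (c w)) +
            (\<delta> * ((q (c u) + q (c w)) * p (r u)) + \<gamma> * ((p (r u) + p (r w)) * q (c w))))"
        by (elim disjE conjE) (auto simp: minus_one_power_iff)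
      then show ?thesis unfolding lr rl ee power_add mult.assoc by simp
    qed
  qed
  have "L Y (R.L Y' f) = (-1) ^ (e * e') *\<^sub>f R.L Y' (L Y f)
    + dop U (\<lambda>u w. mmul U ?T ?T' u w - (-1) ^ (e * e') * mmul U ?T' ?T u w) f"
    using assms by (intro dop_bracket lift_homog R.lift_homog finite)
  also have "dop U (\<lambda>u w. mmul U ?T ?T' u w - (-1) ^ (e * e') * mmul U ?T' ?T u w) f = dop U (\<lambda>u w. 0) f"
    by (rule dop_cong) (simp add: *)
  also have "\<dots> = 0" by (simp add: dop_def)
  finally show ?thesis by simp
qed

end

section \<open>The commutant of one of the two algebras\<close>

context lifting
begin

definition Lgens :: "nat \<Rightarrow> (svec \<Rightarrow> svec) set" where
  "Lgens e = {L Y | Y. par_homog p I e Y}"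

lemma Lgens_lin: "G \<in> Lgens e \<Longrightarrow> lin G"
  by (auto simp: Lgens_def lin_dop)

lemma L_unit_in_Lgens: "L (unit i j) \<in> Lgens ((p i + p j) mod 2)"
  unfolding Lgens_def by (intro CollectI exI[of _ "unit i j"] conjI refl par_homog_unit)

lemma galg_eps:
  assumes "galg Lgens d T"
  shows "T (eps f) = (-1) ^ d *\<^sub>f eps (T f)"
proof -
  have "T (eps f) = (-1) ^ (d * 1) *\<^sub>f eps (T f)"
    using assms
  proof (rule galg_supercommute)
    show "G (eps f) = (-1) ^ (e' * 1) *\<^sub>f eps (G f)" if "G \<in> Lgens e'" for G e' f
      using that dop_eps[OF lift_homog] unfolding Lgens_def by auto
  qed (auto simp: lin_eps Lgens_lin)
  then show ?thesis by simp
qed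

lemma galg_Sk:
  assumes "galg Lgens d T" "f \<in> Sk U k"
  shows "T f \<in> Sk U k"
  using assms(1)
proof (induction rule: galg.induct)
  case (galg_gen G e d T)
  then show ?case using dop_Sk[OF finite(1)] unfolding Lgens_def by auto
qed (use assms(2) in auto)

end

context pairing
begin

lemma galg_R_commute:
  assumes "galg Lgens d T" "par_homog q A e Y"
  shows "T (R.L Y f) = (-1) ^ (d * e) *\<^sub>f R.L Y (T f)"
  using assms(1)
proof (rule galg_supercommute)
  show "G (R.L Y f) = (-1) ^ (e' * e) *\<^sub>f R.L Y (G f)" if "G \<in> Lgens e'" for G e' f
    using that L_R_supercommute assms(2) unfolding Lgens_def by blast
qed (auto simp: lin_dop Lgens_lin)

text \<open>
  Operators commuting with the algebra of the columns in the ordinary sense: an odd element of the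
  algebra of the rows supercommutes with it, and composition with the parity operator (a Klein
  transformation) cancels the sign.
\<close>

definition klein :: "(svec \<Rightarrow> svec) set" where
  "klein = {(\<lambda>f. T0 f + T1 (eps f)) | T0 T1. galg Lgens 0 T0 \<and> galg Lgens 1 T1}"

lemma klein_lin: "T \<in> klein \<Longrightarrow> lin T"
proof -
  assume "T \<in> klein"
  then obtain T0 T1 where T: "T = (\<lambda>f. T0 f + T1 (eps f))" and g: "galg Lgens 0 T0" "galg Lgens 1 T1"
    unfolding klein_def by blast
  note l = galg_lin[OF g(1) Lgens_lin] galg_lin[OF g(2) Lgens_lin]
  show "lin T"
    unfolding T by (rule linI)
      (simp_all only: lin_add[OF l(1)] lin_add[OF l(2)] lin_smul[OF l(1)] lin_smul[OF l(2)]
        lin_add[OF lin_eps] lin_smul[OF lin_eps] smul_add add_ac)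
qed

lemma klein_R_commute:
  assumes "T \<in> klein"
  shows "T (R.L (unit a b) f) = R.L (unit a b) (T f)"
proof -
  obtain T0 T1 where T: "T = (\<lambda>f. T0 f + T1 (eps f))" and g: "galg Lgens 0 T0" "galg Lgens 1 T1"
    using assms unfolding klein_def by blast
  let ?e = "(q a + q b) mod 2"
  have 0: "T0 (R.L (unit a b) f) = R.L (unit a b) (T0 f)"
    using galg_R_commute[OF g(1) par_homog_unit] by simp
  have "eps (R.L (unit a b) f) = (-1) ^ ?e *\<^sub>f R.L (unit a b) (eps f)"
    using dop_eps[OF R.lift_homog[OF par_homog_unit], of a b f] by simp
  then have "T1 (eps (R.L (unit a b) f)) = R.L (unit a b) (T1 (eps f))"
    using galg_R_commute[OF g(2) par_homog_unit, of a b "eps f"]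
    by (simp add: lin_smul[OF galg_lin[OF g(2) Lgens_lin]])
  with 0 show ?thesis unfolding T by (simp add: lin_add[OF lin_dop])
qed

lemma klein_Sk: "T \<in> klein \<Longrightarrow> f \<in> Sk U k \<Longrightarrow> T f \<in> Sk U k"
  unfolding klein_def using galg_Sk eps_Sk by blast

lemma galg_restr:
  assumes "galg Lgens d T" "A0 \<subseteq> A" "f \<in> Sk U k"
  shows "T (restr (mon {u \<in> U. c u \<in> A0} k) f) = restr (mon {u \<in> U. c u \<in> A0} k) (T f)"
  using assms(1)
proof (induction rule: galg.induct)
  case (galg_gen G e d T)
  obtain Y where G: "G = L Y" using galg_gen.hyps(1) unfolding Lgens_def by blast
  show ?case unfolding galg_gen.IH G
    by (rule dop_restr[OF finite(1) _ galg_Sk[OF galg_gen.hyps(2) assms(3)]])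
      (auto simp: lift_def split: if_splits)
qed (simp_all add: lin_zero[OF lin_restr] lin_add[OF lin_restr] lin_smul[OF lin_restr])

lemma klein_restr:
  assumes "T \<in> klein" "A0 \<subseteq> A" "f \<in> Sk U k"
  shows "T (restr (mon {u \<in> U. c u \<in> A0} k) f) = restr (mon {u \<in> U. c u \<in> A0} k) (T f)"
proof -
  let ?e = "restr (mon {u \<in> U. c u \<in> A0} k)"
  obtain T0 T1 where T: "T = (\<lambda>f. T0 f + T1 (eps f))" and g: "galg Lgens 0 T0" "galg Lgens 1 T1"
    using assms unfolding klein_def by blast
  have "eps (?e f) = ?e (eps f)" by (auto simp: eps_def restr_def fun_eq_iff)
  then show ?thesis
    unfolding T lin_add[OF lin_restr]
    using galg_restr[OF g(1) assms(2,3)] galg_restr[OF g(2) assms(2) eps_Sk[OF assms(3)]] by simp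
qed

text \<open>
  The diagonal matrix unit of a column counts the generators of this column in a monomial.
\<close>

lemma number_operator: "R.L (unit a a) f = (\<Sum>u\<in>{u \<in> U. c u = a}. X u (D u f))"
proof (rule dop_number[OF finite(1)])
  fix u v assume "u \<in> U" "v \<in> U"
  then have "r u = r v \<and> c u = c v \<longleftrightarrow> u = v" using rc by metis
  then show "R.lft (unit a a) u v = (if u = v \<and> u \<in> {u \<in> U. c u = a} then 1 else 0)"
    using \<open>u \<in> U\<close> by (auto simp: lift_def unit_def minus_one_power_iff)
qed auto

lemma in_Sk_if_number_zero:
  assumes y: "y \<in> Sk U k" and z: "\<And>a. a \<in> A - A1 \<Longrightarrow> R.L (unit a a) y = 0"
  shows "y \<in> Sk {u \<in> U. c u \<in> A1} k"
proof -
  have "M \<in> mon {u \<in> U. c u \<in> A1} k" if yM: "y M \<noteq> 0" for M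
  proof -
    obtain \<alpha> B where M: "M = (\<alpha>, B)" by (cases M)
    let ?n = "\<lambda>u. if \<pi> u = 0 then count \<alpha> u else of_bool (u \<in> B)"
    have m: "M \<in> mon U k" using y that unfolding supp_on_def by blast
    have n0: "?n u = 0" if u: "u \<in> U" "c u \<notin> A1" for u
    proof -
      have "c u \<in> A - A1" using u rc by blast
      then have "(\<Sum>v\<in>{v \<in> U. c v = c u}. X v (D v y)) M = 0"
        using z number_operator by (metis zero_fun_apply)
      then have "(\<Sum>v\<in>{v \<in> U. c v = c u}. of_nat (?n v) * y M) = 0"
      proof -
        have "X v (D v y) M = of_nat (?n v) * y M" for v by (simp add: M X_D_same)
        then show ?thesis using \<open>_ M = 0\<close> by (simp only: sum_apply)
      qed
      then have "of_nat (\<Sum>v\<in>{v \<in> U. c v = c u}. ?n v) = (0 :: complex)"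
        using yM by (simp only: of_nat_sum sum_distrib_right[symmetric]) simp
      then have "(\<Sum>v\<in>{v \<in> U. c v = c u}. ?n v) = 0" by (simp only: of_nat_eq_0_iff)
      then show ?thesis using u(1) finite(1) by (subst (asm) sum_eq_0_iff) auto
    qed
    have "c u \<in> A1" if u: "u \<in># \<alpha>" for u
    proof -
      have "u \<in> U" "\<pi> u = 0" using m u unfolding M mon_def by blast+
      then show ?thesis using n0[of u] u by (auto simp: count_eq_zero_iff)
    qed
    moreover have "c u \<in> A1" if u: "u \<in> B" for u
    proof -
      have "u \<in> U" "\<pi> u = 1" using m u unfolding M mon_def by blast+
      then show ?thesis using n0[of u] u by auto
    qed
    ultimately show ?thesis using m by (auto simp: M mon_def)
  qed
  then show ?thesis by (auto simp: supp_on_def)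
qed

text \<open>
  \<open>A0\<close> is the set of columns of \<open>W\<close>, and \<open>\<iota>\<close> singles out among all columns a copy of the rows.  The
  hypotheses of \<open>compressed_commutant\<close> are verified for \<open>\<omega> = (\<Sum>i\<in>I. x\<^bsub>i, \<iota> i\<^esub>)\<^sup>k\<close>, for the matrix
  units of all columns as the operators \<open>E s\<close>, and for the Klein transforms as \<open>\<T>\<close>.
\<close>

theorem column_commutant:
  fixes \<iota> :: "'i \<Rightarrow> 'a"
  assumes A0: "A0 \<subseteq> A" and \<iota>: "inj_on \<iota> I" "\<iota> ` I \<subseteq> A" "\<And>i. i \<in> I \<Longrightarrow> q (\<iota> i) = p i"
  defines "U0 \<equiv> {u \<in> U. c u \<in> A0}"
  assumes F: "lin F" "\<And>h. h \<in> Sk U0 k \<Longrightarrow> F h \<in> Sk U0 k"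
    and comm: "\<And>a b h. a \<in> A0 \<Longrightarrow> b \<in> A0 \<Longrightarrow> h \<in> Sk U0 k \<Longrightarrow>
      F (R.L (unit a b) h) = R.L (unit a b) (F h)"
  shows "\<exists>T0 T1. galg Lgens 0 T0 \<and> galg Lgens 1 T1 \<and> (\<forall>h\<in>Sk U0 k. F h = T0 h + T1 (eps h))"
proof -
  let ?e = "restr (mon U0 k)"
  define E where "E = (\<lambda>(a, b). R.L (unit a b))"
  define U1 where "U1 = {u \<in> U. c u \<in> \<iota> ` I}"
  define Z where "Z = (\<lambda>i. lab i (\<iota> i)) ` I"
  define \<omega> where "\<omega> = power_vec Z k"
  have U0: "U0 \<subseteq> U" "finite U0" using finite by (auto simp: U0_def)
  have U1: "U1 \<subseteq> U" by (auto simp: U1_def)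
  have Z: "Z \<subseteq> U1" using lab \<iota> by (auto simp: Z_def U1_def)
  have ev: "\<pi> z = 0" if z: "z \<in> Z" for z
  proof -
    obtain i where i: "i \<in> I" "z = lab i (\<iota> i)" using z by (auto simp: Z_def)
    then have "\<iota> i \<in> A" using \<iota> by auto
    then have "\<pi> z = (p i + q (\<iota> i)) mod 2" using par[of z] lab[OF i(1), of "\<iota> i"] i by simp
    then show ?thesis using \<iota>(3)[OF i(1)] by simp
  qed
  have \<omega>U1: "\<omega> \<in> Sk U1 k" unfolding \<omega>_def
    using finite finite_subset[OF U1] by (intro power_vec_Sk Z) auto
  have sub1: "Sk U1 k \<subseteq> Sk U k"
    using supp_on_mono mon_mono[OF U1] by blast
  have eps\<omega>: "eps \<omega> = \<omega>" unfolding \<omega>_def using ev by (rule eps_power_vec)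
  have Elin: "lin (E s)" for s by (cases s) (simp add: E_def lin_dop)
  have ESk: "E s f \<in> Sk U k" if "f \<in> Sk U k" for s f
    using that by (cases s) (simp add: E_def dop_Sk[OF finite(1)])
  have sumZ: "(\<Sum>z\<in>Z. g z) = (\<Sum>i\<in>I. g (lab i (\<iota> i)))" for g :: "nat \<Rightarrow> complex"
  proof -
    have "inj_on (\<lambda>i. lab i (\<iota> i)) I"
      by (rule inj_on_inverseI[where g = r]) (use lab \<iota> in auto)
    then show ?thesis unfolding Z_def by (simp add: sum.reindex)
  qed

  \<comment> \<open>\<open>F\<close> commutes with the compression of every word, by induction on the length: a factor \<open>E (a, b)\<close>
    applied first, with \<open>b\<close> outside \<open>A0\<close> kills the small space, one with \<open>a\<close> outside \<open>A0\<close> can be moved to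
    the left end, where it is killed by the projection, at the cost of shorter words, and one with
    both in \<open>A0\<close> commutes with \<open>F\<close> by assumption and preserves the small space.\<close>
  define Good where "Good = (\<lambda>G. \<forall>h\<in>Sk U0 k. F (?e (G h)) = ?e (G (F h)))"
  have E_out: "?e (E (a, b) f) = 0" if "a \<notin> A0" for a b f
  proof -
    have "?e (X u g) = 0" if u: "u \<in> U" "c u = a" for u g
    proof -
      have "X u g M = 0" if m: "M \<in> mon U0 k" for M
      proof -
        obtain \<alpha> B where M: "M = (\<alpha>, B)" by (cases M)
        have "u \<notin># \<alpha>" "u \<notin> B" using m u \<open>a \<notin> A0\<close> by (auto simp: M mon_def U0_def)
        then show ?thesis by (simp add: M X_def var_mult_def)
      qed
      then show ?thesis by (auto simp: restr_def fun_eq_iff pointwise)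
    qed
    then have "?e (R.lft (unit a b) u v *\<^sub>f X u (D v f)) = 0" if "u \<in> U" for u v
      using that by (cases "c u = a") (auto simp: lin_smul[OF lin_restr] lift_def unit_def lin_zero[OF lin_restr])
    then show ?thesis by (simp add: E_def dop_def lin_sum[OF lin_restr])
  qed
  have E_in: "E (a, b) h = 0" if "b \<notin> A0" "h \<in> Sk U0 k" for a b h
  proof -
    have "R.lft (unit a b) u v *\<^sub>f X u (D v h) = 0" if "v \<in> U" for u v
    proof (cases "c v = b")
      case True
      then have "v \<notin> U0" using \<open>b \<notin> A0\<close> by (simp add: U0_def)
      then show ?thesis using D_outside[OF \<open>h \<in> Sk U0 k\<close>] by (simp add: lin_zero[OF lin_X])
    qed (simp add: lift_def unit_def)
    then show ?thesis by (simp add: E_def dop_def)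
  qed
  have E_small: "E (a, b) h \<in> Sk U0 k" if "a \<in> A0" "h \<in> Sk U0 k" for a b h
  proof -
    have "dop U (R.lft (unit a b)) h = dop U0 (R.lft (unit a b)) h"
      by (rule dop_restrict[OF finite(1) U0(1) that(2)])
        (use that(1) in \<open>auto simp: lift_def unit_def U0_def split: if_splits\<close>)
    then show ?thesis using dop_Sk[OF U0(2) that(2)] by (simp add: E_def)
  qed
  have wlin: "lin (foldr E w)" for w by (rule lin_foldr[OF Elin])
  have Good_outer: "Good (foldr E (u @ (a, b) # v))"
    if "\<And>w. length w \<le> length u + length v \<Longrightarrow> Good (foldr E w)" "a \<notin> A0" for u a b v
    using that(1)
  proof (induction u arbitrary: v rule: rev_induct)
    case Nil
    show ?case unfolding Good_def
      using E_out[OF that(2)] by (simp add: lin_zero[OF F(1)])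
  next
    case (snoc s u)
    obtain a' b' where s: "s = (a', b')" by (cases s)
    obtain k1 k2 k3 where k: "\<And>f. E s (E (a, b) f) = k1 *\<^sub>f E (a, b) (E s f) + (k2 *\<^sub>f E (a', b) f + k3 *\<^sub>f E (a, b') f)"
      using R.L_unit_bracket[of a' b' a b] unfolding E_def s by auto
    have "foldr E ((u @ [s]) @ (a, b) # v) h = k1 *\<^sub>f foldr E (u @ (a, b) # s # v) h
        + (k2 *\<^sub>f foldr E (u @ (a', b) # v) h + k3 *\<^sub>f foldr E (u @ (a, b') # v) h)" for h
      by (simp add: k lin_add[OF wlin] lin_smul[OF wlin])
    moreover have "Good (foldr E (u @ (a, b) # s # v))"
      by (rule snoc.IH) (rule snoc.prems, simp)
    moreover have "Good (foldr E (u @ (a', b) # v))" "Good (foldr E (u @ (a, b') # v))"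
      by (rule snoc.prems, simp)+
    ultimately show ?case unfolding Good_def
      by (simp add: lin_add[OF F(1)] lin_smul[OF F(1)] lin_add[OF lin_restr] lin_smul[OF lin_restr] del: foldr_append)
  qed
  have Good_words: "Good (foldr E w)" for w
  proof (induction "length w" arbitrary: w rule: less_induct)
    case less
    show ?case
    proof (cases w rule: rev_cases)
      case Nil
      then show ?thesis by (simp add: Good_def restr_id F(2))
    next
      case (snoc w' s)
      obtain a b where s: "s = (a, b)" by (cases s)
      show ?thesis
      proof (cases "a \<in> A0")
        case False
        have "Good (foldr E (w' @ (a, b) # []))"
          by (rule Good_outer) (use less snoc False in auto)
        then show ?thesis by (simp add: snoc s)
      next
        case a: True
        show ?thesis unfolding Good_def
        proof
          fix h assume h: "h \<in> Sk U0 k"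
          show "F (?e (foldr E w h)) = ?e (foldr E w (F h))"
          proof (cases "b \<in> A0")
            case True
            have "F (E s h) = E s (F h)" using comm[OF a True h] by (simp add: E_def s)
            moreover have "Good (foldr E w')" using less snoc by simp
            moreover have "E s h \<in> Sk U0 k" using E_small[OF a h] s by simp
            ultimately show ?thesis by (simp add: snoc Good_def)
          next
            case False
            then have "E s h = 0" "E s (F h) = 0" using E_in h F(2) s by auto
            then show ?thesis
              by (simp add: snoc lin_zero[OF wlin] lin_zero[OF lin_restr] lin_zero[OF F(1)])
          qed
        qed
      qed
    qed
  qed

  have "\<exists>T\<in>klein. \<forall>h\<in>Sk U0 k. F h = T h"
  proof (rule compressed_commutant[where S = "mon U k" and \<mu> = weight and E = E and adj = "\<lambda>(a, b). (b, a)"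
        and \<omega> = \<omega>])
    show "finite (mon U k)" by (rule finite_mon[OF finite(1)])
    show "\<forall>M\<in>mon U k. weight M > 0" using weight_pos by blast
    show "mon U0 k \<subseteq> mon U k" by (rule mon_mono[OF U0(1)])
    show "inner weight (mon U k) (E s f) g = inner weight (mon U k) f (E ((\<lambda>(a, b). (b, a)) s) g)"
      if "f \<in> Sk U k" "g \<in> Sk U k" for s f g
      using R.L_adjoint[OF that] by (cases s) (simp add: E_def)
    show "F (?e (foldr E b h)) = ?e (foldr E b (F h))" if "h \<in> Sk U0 k" for b h
      using Good_words that by (simp add: Good_def)
    show "\<omega> \<in> Sk U k" using sub1 \<omega>U1 by blast
    show "Sk U k \<subseteq> K" if K: "subsp K" "\<omega> \<in> K" "\<And>s f. f \<in> K \<Longrightarrow> E s f \<in> K" for K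
    proof (rule power_vec_cyclic[OF finite(1) subset_refl _ ev K(1)])
      show "Z \<subseteq> U" using Z U1 by blast
      show "power_vec Z k \<in> K" using K(2) by (simp add: \<omega>_def)
      \<comment> \<open>The matrix unit taking the column \<open>\<iota> (r u)\<close> to \<open>c u\<close> turns \<open>x\<^bsub>r u, \<iota> (r u)\<^esub>\<close> into \<open>\<plusminus> b\<^sub>u\<close> and kills
        the other summands.\<close>
      show "homog U ((q (c u) + q (\<iota> (r u))) mod 2) (R.lft (unit (c u) (\<iota> (r u))))" if "u \<in> U" for u
        by (rule R.lift_homog[OF par_homog_unit])
      show "R.L (unit (c u) (\<iota> (r u))) f \<in> K" if "f \<in> K" for u f
        using K(3)[OF that, of "(c u, \<iota> (r u))"] by (simp add: E_def)
      show "(\<Sum>z\<in>Z. R.lft (unit (c u) (\<iota> (r u))) w z) =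
          (if w = u then (-1) ^ (\<delta> * ((q (c u) + q (\<iota> (r u))) * p (r u))) else 0)"
        if "u \<in> U" "w \<in> U" for u w
      proof -
        have "(\<Sum>z\<in>Z. R.lft (unit (c u) (\<iota> (r u))) w z) =
          (\<Sum>i\<in>I. if i = r u then if w = u then (-1) ^ (\<delta> * ((q (c u) + q (\<iota> (r u))) * p (r u))) else 0 else 0)"
          unfolding sumZ
        proof (intro sum.cong refl)
          fix i assume i: "i \<in> I"
          then have "\<iota> i \<in> A" using \<iota> by blast
          then have l: "r (lab i (\<iota> i)) = i" "c (lab i (\<iota> i)) = \<iota> i" using lab i by auto
          have "\<iota> i = \<iota> (r u) \<longleftrightarrow> i = r u" using \<iota>(1) i rc[OF that(1)] by (auto dest: inj_onD)
          moreover have "w = u \<longleftrightarrow> r w = r u \<and> c w = c u" using rc that by metis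
          ultimately show "R.lft (unit (c u) (\<iota> (r u))) w (lab i (\<iota> i)) =
             (if i = r u then if w = u then (-1) ^ (\<delta> * ((q (c u) + q (\<iota> (r u))) * p (r u))) else 0 else 0)"
            unfolding lift_def unit_def l by auto
        qed
        then show ?thesis using rc[OF that(1)] finite by simp
      qed
    qed auto
    show "\<exists>T\<in>klein. y = T \<omega>" if y: "y \<in> Sk U k" "\<And>s. E s \<omega> = 0 \<Longrightarrow> E s y = 0" for y
    proof -
      \<comment> \<open>Every column occurring in \<open>\<omega>\<close> is in the image of \<open>\<iota>\<close>, so the other number operators kill \<open>\<omega>\<close>.\<close>
      have "R.L (unit a a) y = 0" if "a \<in> A - \<iota> ` I" for a
      proof -
        have "D u \<omega> = 0" if "c u = a" for u
          by (rule D_outside[OF \<omega>U1]) (use \<open>a \<in> A - \<iota> ` I\<close> that in \<open>simp add: U1_def\<close>)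
        then have "E (a, a) \<omega> = 0" by (simp add: E_def number_operator lin_zero[OF lin_X])
        then show ?thesis using y(2)[of "(a, a)"] by (simp add: E_def)
      qed
      then have yU1: "y \<in> Sk U1 k" unfolding U1_def by (rule in_Sk_if_number_zero[OF y(1)])
      define K where "K = {T0 \<omega> + T1 \<omega> | T0 T1. galg Lgens 0 T0 \<and> galg Lgens 1 T1}"
      have KI: "T0 \<omega> + T1 \<omega> \<in> K" if "galg Lgens 0 T0" "galg Lgens 1 T1" for T0 T1
        unfolding K_def using that by blast
      have "Sk U1 k \<subseteq> K"
      proof (rule power_vec_cyclic[OF finite(1) U1 Z ev])
        show "subsp K" unfolding subsp_def
        proof (intro conjI ballI allI)
          show "0 \<in> K" using KI[OF galg_zero galg_zero] by simp
        next
          fix f g assume "f \<in> K" "g \<in> K"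
          then obtain T0 T1 S0 S1 where *: "f = T0 \<omega> + T1 \<omega>" "g = S0 \<omega> + S1 \<omega>"
            "galg Lgens 0 T0" "galg Lgens 1 T1" "galg Lgens 0 S0" "galg Lgens 1 S1" unfolding K_def by blast
          then have "f + g = (T0 \<omega> + S0 \<omega>) + (T1 \<omega> + S1 \<omega>)" by (simp add: add_ac)
          then show "f + g \<in> K"
            using KI[OF galg_add[OF *(3,5)] galg_add[OF *(4,6)]] by simp
        next
          fix k f assume "f \<in> K"
          then obtain T0 T1 where *: "f = T0 \<omega> + T1 \<omega>" "galg Lgens 0 T0" "galg Lgens 1 T1"
            unfolding K_def by blast
          then have "k *\<^sub>f f = k *\<^sub>f T0 \<omega> + k *\<^sub>f T1 \<omega>" by (simp add: smul_add)
          then show "k *\<^sub>f f \<in> K"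
            using KI[OF galg_smul[OF *(2)] galg_smul[OF *(3)]] by simp
        qed
        show "power_vec Z k \<in> K"
          using KI[OF galg_id galg_zero] by (simp add: \<omega>_def)
        let ?j = "\<lambda>u. inv_into I \<iota> (c u)"
        \<comment> \<open>For \<open>u\<close> in the row \<open>r u\<close> and the column \<open>\<iota> j\<close>, the matrix unit taking the row \<open>j\<close> to \<open>r u\<close> turns
          \<open>x\<^bsub>j, \<iota> j\<^esub>\<close> into \<open>\<plusminus> b\<^sub>u\<close>.\<close>
        have j: "?j u \<in> I" "\<iota> (?j u) = c u" if "u \<in> U1" for u
          using that by (auto simp: U1_def inv_into_into f_inv_into_f)
        show "homog U ((p (r u) + p (?j u)) mod 2) (lft (unit (r u) (?j u)))" for u
          by (rule lift_homog[OF par_homog_unit])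
        show "L (unit (r u) (?j u)) f \<in> K" if fK: "f \<in> K" for u f
        proof -
          let ?E = "L (unit (r u) (?j u))" and ?d = "(p (r u) + p (?j u)) mod 2"
          obtain T0 T1 where *: "f = T0 \<omega> + T1 \<omega>" "galg Lgens 0 T0" "galg Lgens 1 T1"
            using fK unfolding K_def by blast
          have "?E \<in> Lgens ?d" by (rule L_unit_in_Lgens)
          note g' = galg_gen[OF this *(2)] galg_gen[OF this *(3)]
          have f: "?E f = ?E (T0 \<omega>) + ?E (T1 \<omega>)" unfolding * by (rule lin_add[OF lin_dop])
          have "?d = 0 \<or> ?d = 1" by auto
          then show ?thesis
          proof
            assume d: "?d = 0"
            have "galg Lgens 0 (\<lambda>f. ?E (T0 f))" "galg Lgens 1 (\<lambda>f. ?E (T1 f))"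
              using g' unfolding d by simp_all
            from KI[OF this] show ?thesis unfolding f .
          next
            assume d: "?d = 1"
            have "galg Lgens 0 (\<lambda>f. ?E (T1 f))" "galg Lgens 1 (\<lambda>f. ?E (T0 f))"
              using g' unfolding d by simp_all
            from KI[OF this] show ?thesis unfolding f by (simp only: add.commute)
          qed
        qed
        show "w \<in> U1" if "u \<in> U1" "v \<in> U1" "w \<in> U" "lft (unit (r u) (?j u)) w v \<noteq> 0" for u v w
          using that by (auto simp: lift_def U1_def split: if_splits)
        show "(\<Sum>z\<in>Z. lft (unit (r u) (?j u)) w z) =
            (if w = u then (-1) ^ (\<gamma> * ((p (r u) + p (?j u)) * q (c u))) else 0)"
          if "u \<in> U1" "w \<in> U" for u w
        proof -
          have "(\<Sum>z\<in>Z. lft (unit (r u) (?j u)) w z) =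
            (\<Sum>i\<in>I. if i = ?j u then if w = u then (-1) ^ (\<gamma> * ((p (r u) + p (?j u)) * q (c u))) else 0 else 0)"
            unfolding sumZ
          proof (intro sum.cong refl)
            fix i assume i: "i \<in> I"
            then have "\<iota> i \<in> A" using \<iota> by blast
            then have l: "r (lab i (\<iota> i)) = i" "c (lab i (\<iota> i)) = \<iota> i" using lab i by auto
            have "w = u \<longleftrightarrow> r w = r u \<and> c w = c u" using rc that U1 by (metis subsetD)
            then show "lft (unit (r u) (?j u)) w (lab i (\<iota> i)) =
               (if i = ?j u then if w = u then (-1) ^ (\<gamma> * ((p (r u) + p (?j u)) * q (c u))) else 0 else 0)"
              unfolding lift_def unit_def l using j(2)[OF that(1)] by auto
          qed
          then show ?thesis using j[OF that(1)] finite by simp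
        qed
      qed auto
      with yU1 have "y \<in> K" by blast
      \<comment> \<open>Inserting the parity operator in front of \<open>\<omega>\<close> does nothing, as \<open>\<omega>\<close> is even.\<close>
      then obtain T0 T1 where y': "y = T0 \<omega> + T1 (eps \<omega>)" and T: "galg Lgens 0 T0" "galg Lgens 1 T1"
        unfolding K_def eps\<omega> by blast
      have "(\<lambda>f. T0 f + T1 (eps f)) \<in> klein" unfolding klein_def using T by blast
      with y' show ?thesis by (intro bexI[of _ "\<lambda>f. T0 f + T1 (eps f)"])
    qed
    show "T (E s f) = E s (T f)" if "T \<in> klein" for T s f
      using klein_R_commute[OF that] by (cases s) (simp add: E_def)
    show "T (?e f) = ?e (T f)" if "T \<in> klein" "f \<in> Sk U k" for T f
      using klein_restr[OF that(1) A0 that(2)] unfolding U0_def .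
  qed (use F Elin ESk klein_lin klein_Sk in auto)
  then show ?thesis unfolding klein_def by blast
qed

text \<open>
  The copy of the rows among the columns is created by adding new generators, whose labels lie
  beyond those in use.  On vectors that contain only old generators, the derivations of the
  enlarged system agree with those of the original one.
\<close>

theorem commutant_of_R:
  assumes F: "lin F" "\<And>h. h \<in> Sk U k \<Longrightarrow> F h \<in> Sk U k"
    and comm: "\<And>a b h. a \<in> A \<Longrightarrow> b \<in> A \<Longrightarrow> h \<in> Sk U k \<Longrightarrow>
      F (R.L (unit a b) h) = R.L (unit a b) (F h)"
  shows "\<exists>T0 T1. galg Lgens 0 T0 \<and> galg Lgens 1 T1 \<and> (\<forall>h\<in>Sk U k. F h = T0 h + T1 (eps h))"
proof -
  \<comment> \<open>Labels below \<open>N\<close> are the old ones; \<open>N + prod_encode (e i, e j)\<close> is the new generator in the row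
    \<open>i\<close> and the column \<open>Inr j\<close>.\<close>
  obtain N where N: "\<And>u. u \<in> U \<Longrightarrow> u < N"
    using finite(1) by (metis finite_nat_set_iff_bounded)
  obtain n :: nat and en where "en ` {i. i < n} = I" "inj_on en {i. i < n}"
    using finite_imp_nat_seg_image_inj_on[OF finite(2)] by metis
  define e where "e = the_inv_into {i. i < n} en"
  have e: "en (e i) = i" if "i \<in> I" for i
    using that \<open>en ` {i. i < n} = I\<close> \<open>inj_on en {i. i < n}\<close> unfolding e_def by (metis f_the_inv_into_f)
  define new where "new = (\<lambda>i j. N + prod_encode (e i, e j))"
  define fs where "fs = (\<lambda>u. en (fst (prod_decode (u - N))))"
  define sn where "sn = (\<lambda>u. en (snd (prod_decode (u - N))))"
  have new: "fs (new i j) = i" "sn (new i j) = j" "\<not> new i j < N" if "i \<in> I" "j \<in> I" for i j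
    using that e by (auto simp: fs_def sn_def new_def)
  define \<pi>' where "\<pi>' = (\<lambda>u. if u < N then \<pi> u else (p (fs u) + p (sn u)) mod 2)"
  define r' where "r' = (\<lambda>u. if u < N then r u else fs u)"
  define c' :: "nat \<Rightarrow> 'a + 'i" where "c' = (\<lambda>u. if u < N then Inl (c u) else Inr (sn u))"
  define lab' where "lab' = (\<lambda>i. case_sum (lab i) (new i))"
  define U' where "U' = U \<union> (\<lambda>(i, j). new i j) ` (I \<times> I)"
  define A' where "A' = Inl ` A \<union> (Inr ` I :: ('a + 'i) set)"
  interpret B: pairing \<pi>' U' I A' p "case_sum q p" r' c' lab' \<gamma> \<delta>
  proof
    show "\<pi>' u \<in> {0, 1}" for u using parity[of u] by (auto simp: \<pi>'_def)
    show "finite U'" "finite I" "finite A'" using finite by (auto simp: U'_def A'_def)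
    show "r' u \<in> I \<and> c' u \<in> A' \<and> lab' (r' u) (c' u) = u" if "u \<in> U'" for u
      using that unfolding U'_def
    proof
      assume "u \<in> U"
      then show ?thesis using N rc[of u] by (auto simp: r'_def c'_def lab'_def A'_def)
    next
      assume "u \<in> (\<lambda>(i, j). new i j) ` (I \<times> I)"
      then obtain i j where "i \<in> I" "j \<in> I" "u = new i j" by auto
      then show ?thesis using new by (simp add: r'_def c'_def lab'_def A'_def)
    qed
    show "lab' i a \<in> U' \<and> r' (lab' i a) = i \<and> c' (lab' i a) = a" if "i \<in> I" "a \<in> A'" for i a
    proof (cases a)
      case (Inl b)
      then show ?thesis using that N lab[of i b] by (auto simp: r'_def c'_def lab'_def A'_def U'_def)
    next
      case (Inr j)
      then show ?thesis using that new[of i j] by (auto simp: r'_def c'_def lab'_def A'_def U'_def)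
    qed
    show "\<pi>' u = (p (r' u) + case_sum q p (c' u)) mod 2" if "u \<in> U'" for u
    proof (cases "u < N")
      case True
      then have "u \<in> U" using that new by (auto simp: U'_def)
      then show ?thesis using True par[of u] by (simp add: \<pi>'_def r'_def c'_def)
    qed (simp add: \<pi>'_def r'_def c'_def)
    show "\<gamma> + \<delta> = 1" by (rule signs)
  qed
  have UU': "U \<subseteq> U'" by (auto simp: U'_def)
  have U0: "{u \<in> U'. c' u \<in> Inl ` A} = U"
    using N rc new by (auto simp: U'_def c'_def)
  have \<pi>': "\<pi>' u = \<pi> u" if "u \<in> U" for u using N[OF that] by (simp add: \<pi>'_def)
  have mon: "B.mon U k = mon U k" unfolding B.mon_def mon_def using \<pi>' by (simp cong: conj_cong)
  have X: "B.X u = X u" and D: "B.D u = D u" if "u \<in> U" for u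
    using \<pi>'[OF that] by (simp_all add: B.X_def X_def B.D_def D_def fun_eq_iff var_mult_def var_deriv_def)
  have dop: "B.dop U' T h = dop U T' h"
    if h: "h \<in> Sk U k" and "\<And>u v. u \<in> U' \<Longrightarrow> v \<in> U \<Longrightarrow> T u v \<noteq> 0 \<Longrightarrow> u \<in> U"
      and T: "\<And>u v. u \<in> U \<Longrightarrow> v \<in> U \<Longrightarrow> T u v = T' u v" for T T' h
  proof -
    have "B.dop U' T h = B.dop U T h"
      using h that(2) mon by (intro B.dop_restrict[OF B.finite(1) UU', where k = k]) auto
    also have "\<dots> = dop U T' h"
      unfolding B.dop_def dop_def using X D T by (intro sum.cong) auto
    finally show ?thesis .
  qed
  have BL: "B.L Y h = L Y h" if "h \<in> Sk U k" for Y h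
  proof (rule dop[OF that])
    fix u v assume uv: "u \<in> U'" "v \<in> U" "B.lft Y u v \<noteq> 0"
    then have "c' u = Inl (c v)" using N[of v] by (auto simp: lift_def c'_def split: if_splits)
    then show "u \<in> U" using U0 uv rc[of v] by blast
  qed (use N in \<open>auto simp: lift_def r'_def c'_def\<close>)
  have BR: "B.R.L (unit (Inl a) (Inl b)) h = R.L (unit a b) h" if "a \<in> A" "h \<in> Sk U k" for a b h
  proof (rule dop[OF that(2)])
    fix u v assume uv: "u \<in> U'" "v \<in> U" "B.R.lft (unit (Inl a) (Inl b)) u v \<noteq> 0"
    then have "c' u = Inl a" by (auto simp: lift_def unit_def split: if_splits)
    then show "u \<in> U" using U0 uv that(1) by blast
  qed (use N in \<open>auto simp: lift_def r'_def c'_def unit_def\<close>)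
  have "\<exists>T0 T1. galg B.Lgens 0 T0 \<and> galg B.Lgens 1 T1 \<and>
      (\<forall>h\<in>B.Sk {u \<in> U'. c' u \<in> Inl ` A} k. F h = T0 h + T1 (eps h))"
  proof (rule B.column_commutant[where \<iota> = Inr])
    fix a b :: "'a + 'i" and h assume "a \<in> Inl ` A" "b \<in> Inl ` A" "h \<in> B.Sk {u \<in> U'. c' u \<in> Inl ` A} k"
    then show "F (B.R.L (unit a b) h) = B.R.L (unit a b) (F h)"
      using comm BR F(2) unfolding U0 mon by auto
  qed (use F in \<open>auto simp: A'_def U0 mon\<close>)
  then obtain T0 T1 where T: "galg B.Lgens 0 T0" "galg B.Lgens 1 T1"
      "\<And>h. h \<in> Sk U k \<Longrightarrow> F h = T0 h + T1 (eps h)"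
    unfolding U0 mon by blast
  have transfer: "\<exists>T'. galg Lgens d T' \<and> (\<forall>h\<in>Sk U k. T h = T' h)" if "galg B.Lgens d T" for d T
    using that
  proof (induction rule: galg.induct)
    case galg_id
    show ?case using galg.galg_id by blast
  next
    case (galg_zero d)
    show ?case using galg.galg_zero[OF galg_zero] by blast
  next
    case (galg_gen G e d T)
    obtain Y where Y: "G = B.L Y" "par_homog p I e Y" using galg_gen.hyps unfolding B.Lgens_def by blast
    obtain T' where T': "galg Lgens d T'" "\<And>h. h \<in> Sk U k \<Longrightarrow> T h = T' h" using galg_gen.IH by blast
    have "L Y \<in> Lgens e" using Y(2) unfolding Lgens_def by blast
    from galg.galg_gen[OF this T'(1)] show ?case
      using BL galg_Sk[OF T'(1)] by (intro exI conjI) (auto simp: Y T')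
  next
    case (galg_add d T T1)
    obtain T' T1' where T': "galg Lgens d T'" "\<And>h. h \<in> Sk U k \<Longrightarrow> T h = T' h"
       "galg Lgens d T1'" "\<And>h. h \<in> Sk U k \<Longrightarrow> T1 h = T1' h" using galg_add.IH by blast
    from galg.galg_add[OF T'(1,3)] show ?case by (intro exI conjI) (auto simp: T')
  next
    case (galg_smul d T k')
    obtain T' where T': "galg Lgens d T'" "\<And>h. h \<in> Sk U k \<Longrightarrow> T h = T' h" using galg_smul.IH by blast
    from galg.galg_smul[OF T'(1)] show ?case by (intro exI conjI) (auto simp: T')
  qed
  obtain T0' T1' where "galg Lgens 0 T0'" "\<And>h. h \<in> Sk U k \<Longrightarrow> T0 h = T0' h"
     "galg Lgens 1 T1'" "\<And>h. h \<in> Sk U k \<Longrightarrow> T1 h = T1' h"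
    using transfer[OF T(1)] transfer[OF T(2)] by blast
  then show ?thesis using T(3) eps_Sk by (intro exI[of _ T0'] exI[of _ T1']) simp
qed

end

section \<open>Images of enveloping algebras\<close>

text \<open>
  \<open>eval_free\<close> without the restriction to a subspace: the commutation relations hold for all coefficient
  functions, so the evaluation can be studied without domain conditions.
\<close>

definition ev :: "(complex mat \<Rightarrow> svec \<Rightarrow> svec) \<Rightarrow> falg \<Rightarrow> svec \<Rightarrow> svec" where
  "ev \<rho> t f = (\<Sum>w\<in>Poly_Mapping.keys t. Poly_Mapping.lookup t w *\<^sub>f foldr \<rho> (letters w) f)"

lemma eval_free_ev: "eval_free S \<rho> t = (\<lambda>f\<in>S. ev \<rho> t f)"
  by (simp add: eval_free_def ev_def fun_eq_iff sum_apply smul_apply restrict_def)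

lemma ev_add: "ev \<rho> (s + t) f = ev \<rho> s f + ev \<rho> t f"
proof -
  have "(\<Sum>k\<in>Poly_Mapping.keys (s + t). Poly_Mapping.lookup (s + t) k *\<^sub>f foldr \<rho> (letters k) f) =
     (\<Sum>k\<in>Poly_Mapping.keys s. Poly_Mapping.lookup s k *\<^sub>f foldr \<rho> (letters k) f) +
     (\<Sum>k\<in>Poly_Mapping.keys t. Poly_Mapping.lookup t k *\<^sub>f foldr \<rho> (letters k) f)"
    by (rule setsum_keys_plus_distrib) (simp_all add: fun_eq_iff pointwise algebra_simps)
  then show ?thesis by (simp add: ev_def)
qed

lemma ev_zero: "ev \<rho> 0 f = 0"
  by (simp add: ev_def)

lemma ev_minus: "ev \<rho> (- t) f = - ev \<rho> t f"
  using ev_add[of \<rho> t "- t" f] by (simp add: ev_zero eq_neg_iff_add_eq_0 add.commute)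

lemma ev_diff: "ev \<rho> (s - t) f = ev \<rho> s f - ev \<rho> t f"
  using ev_add[of \<rho> s "- t" f] by (simp add: ev_minus)

lemma ev_single: "ev \<rho> (Poly_Mapping.single w k) f = k *\<^sub>f foldr \<rho> (letters w) f"
  by (simp add: ev_def)

lemma falg_induct [case_names zero add]:
  fixes t :: falg
  assumes "P 0" "\<And>w k t. P t \<Longrightarrow> P (Poly_Mapping.single w k + t)"
  shows "P t"
proof (induction "card (Poly_Mapping.keys t)" arbitrary: t)
  case 0
  then show ?case using assms(1) by simp
next
  case (Suc n)
  then obtain w where w: "w \<in> Poly_Mapping.keys t" by fastforce
  define t' where "t' = t - Poly_Mapping.single w (Poly_Mapping.lookup t w)"
  have k: "Poly_Mapping.keys t' = Poly_Mapping.keys t - {w}"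
    by (auto simp: t'_def in_keys_iff lookup_minus lookup_single when_def split: if_splits)
  have "P t'" using Suc w k by (intro Suc.hyps(1)) auto
  moreover have "t = Poly_Mapping.single w (Poly_Mapping.lookup t w) + t'" by (simp add: t'_def)
  ultimately show ?case using assms(2) by metis
qed

lemma ev_mult:
  assumes "\<And>X. lin (\<rho> X)"
  shows "ev \<rho> (s * t) f = ev \<rho> s (ev \<rho> t f)"
proof (induction s rule: falg_induct)
  case zero
  then show ?case by (simp add: ev_zero)
next
  case (add w k s)
  have "ev \<rho> (Poly_Mapping.single w k * t) f = k *\<^sub>f foldr \<rho> (letters w) (ev \<rho> t f)"
  proof (induction t rule: falg_induct)
    case zero
    then show ?case by (simp add: ev_zero lin_zero[OF lin_foldr[OF assms]])
  next
    case (add v l t)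
    have "ev \<rho> (Poly_Mapping.single w k * Poly_Mapping.single v l) f =
        k *\<^sub>f foldr \<rho> (letters w) (ev \<rho> (Poly_Mapping.single v l) f)"
      by (simp add: mult_single ev_single plus_free_monoid_def lin_smul[OF lin_foldr[OF assms]])
    then show ?case
      by (simp add: distrib_left ev_add add.IH lin_add[OF lin_foldr[OF assms]] smul_add)
  qed
  then show ?case by (simp add: distrib_right ev_add add.IH ev_single)
qed

lemma ev_gen: "ev \<rho> (gen Y) f = \<rho> Y f"
  by (simp add: gen_def ev_single)

lemma ev_scalar: "ev \<rho> (scalar k) f = k *\<^sub>f f"
  by (simp add: scalar_def ev_single zero_free_monoid_def)

lemma free_alg_add: "s \<in> free_alg V \<Longrightarrow> t \<in> free_alg V \<Longrightarrow> s + t \<in> free_alg V"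
  using keys_add[of s t] by (force simp: free_alg_def)

lemma free_alg_mult: "s \<in> free_alg V \<Longrightarrow> t \<in> free_alg V \<Longrightarrow> s * t \<in> free_alg V"
  using keys_mult[of s t] by (force simp: free_alg_def plus_free_monoid_def)

lemma free_alg_gen: "Y \<in> gl V \<Longrightarrow> gen Y \<in> free_alg V"
  by (simp add: free_alg_def gen_def)

lemma free_alg_scalar: "scalar k \<in> free_alg V"
  by (simp add: free_alg_def scalar_def zero_free_monoid_def)

definition ent :: "complex mat \<Rightarrow> nat \<Rightarrow> nat \<Rightarrow> complex" where
  "ent Y = (\<lambda>i j. Y $$ (i, j))"

lemma sder_dop:
  assumes "fock (par S)"
  shows "sder S T f = fock.dop (par S) {..<sdim S} (ent T) f"
  by (simp add: sder_def fock.dop_def[OF assms] fock.X_def[OF assms] fock.D_def[OF assms] ent_def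
      fun_eq_iff sum_apply smul_apply var_mult_def var_deriv_def)

text \<open>
  The common form of \<open>act_fst\<close> and \<open>act_snd\<close>.
\<close>

locale gl_action = lifting "par S" "{..<sdim S}" "{..<sdim V}" "{..<sdim W}" "par V" "par W" r c lab \<gamma>
  for S V W :: superspace and r c lab \<gamma> +
  fixes act :: "complex mat \<Rightarrow> complex mat"
  assumes act: "\<And>Y u v. u < sdim S \<Longrightarrow> v < sdim S \<Longrightarrow> act Y $$ (u, v) = lift \<gamma> (par V) (par W) r c (ent Y) u v"
begin

abbreviation \<rho> :: "complex mat \<Rightarrow> svec \<Rightarrow> svec" where
  "\<rho> Y \<equiv> sder S (act Y)"

lemma rho_L: "\<rho> Y = L (ent Y)"
proof
  fix f
  show "\<rho> Y f = L (ent Y) f"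
    unfolding sder_dop[OF fock_axioms] by (rule dop_cong) (simp add: act ent_def[of "act Y"])
qed

lemma lin_rho: "lin (\<rho> Y)"
  unfolding rho_L by (rule lin_dop)

lemma gl_homog_par_homog: "Y \<in> gl_homog V e \<longleftrightarrow> Y \<in> gl V \<and> par_homog (par V) {..<sdim V} e (ent Y)"
  by (auto simp: gl_homog_def par_homog_def ent_def)

lemma ent_mult:
  assumes "Y \<in> gl V" "Y' \<in> gl V" "i < sdim V" "j < sdim V"
  shows "ent (Y * Y') i j = mmul {..<sdim V} (ent Y) (ent Y') i j"
  using assms by (simp add: ent_def mmul_def gl_def scalar_prod_def lessThan_atLeast0)

text \<open>
  The action is a representation of the Lie superalgebra, so the evaluation factors through the
  enveloping algebra.
\<close>

lemma ev_env_ideal: "t \<in> env_ideal V \<Longrightarrow> ev \<rho> t f = 0"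
proof (induction arbitrary: f rule: env_ideal.induct)
  case (add Y Y')
  have "L (ent (Y + Y')) f = L (\<lambda>i j. ent Y i j + ent Y' i j) f"
    by (rule L_cong) (use add in \<open>auto simp: ent_def gl_def\<close>)
  then show ?case by (simp add: ev_diff ev_add ev_gen rho_L L_add)
next
  case (smult Y k)
  have "L (ent (k \<cdot>\<^sub>m Y)) f = L (\<lambda>i j. k * ent Y i j) f"
    by (rule L_cong) (use smult in \<open>auto simp: ent_def gl_def\<close>)
  then show ?case
    by (simp only: ev_diff ev_mult[OF lin_rho] ev_gen ev_scalar) (simp add: rho_L L_smul)
next
  case (bracket d e Y Y')
  have gl: "Y \<in> gl V" "Y' \<in> gl V" using bracket by (auto simp: gl_homog_def)
  have "L (ent (gl_bracket d e Y Y')) f = L (\<lambda>i j. mmul {..<sdim V} (ent Y) (ent Y') i j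
      - (-1) ^ (d * e) * mmul {..<sdim V} (ent Y') (ent Y) i j) f"
  proof (rule L_cong)
    fix i j assume "i \<in> {..<sdim V}" "j \<in> {..<sdim V}"
    then have ij: "i < sdim V" "j < sdim V" by auto
    have "ent (gl_bracket d e Y Y') i j = ent (Y * Y') i j - (-1) ^ (d * e) * ent (Y' * Y) i j"
      using ij gl by (simp add: gl_bracket_def ent_def gl_def)
    then show "ent (gl_bracket d e Y Y') i j = mmul {..<sdim V} (ent Y) (ent Y') i j
      - (-1) ^ (d * e) * mmul {..<sdim V} (ent Y') (ent Y) i j"
      using ent_mult[OF gl ij] ent_mult[OF gl(2,1) ij] by simp
  qed
  moreover have "L (ent Y) (L (ent Y') f) = (-1) ^ (d * e) *\<^sub>f L (ent Y') (L (ent Y) f)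
    + L (\<lambda>i j. mmul {..<sdim V} (ent Y) (ent Y') i j - (-1) ^ (d * e) * mmul {..<sdim V} (ent Y') (ent Y) i j) f"
    using bracket by (intro L_bracket) (auto simp: gl_homog_par_homog)
  ultimately show ?case
    by (simp only: ev_diff ev_mult[OF lin_rho] ev_gen ev_scalar) (simp add: rho_L)
next
  case zero
  then show ?case by (simp add: ev_zero)
next
  case (sum s t)
  then show ?case by (simp add: ev_add)
next
  case (mult a b t)
  have "ev \<rho> a 0 = 0"
    by (simp add: ev_def lin_zero[OF lin_foldr[OF lin_rho]])
  then show ?case using mult by (simp add: ev_mult[OF lin_rho])
qed

text \<open>
  The algebra generated by the action, homogeneous or not, as the sum of its two graded parts.
\<close>

definition in_alg :: "(svec \<Rightarrow> svec) \<Rightarrow> bool" where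
  "in_alg T \<longleftrightarrow> (\<exists>T0 T1. galg Lgens 0 T0 \<and> galg Lgens 1 T1 \<and> (\<forall>f. T f = T0 f + T1 f))"

lemma in_alg_add: "in_alg T \<Longrightarrow> in_alg T' \<Longrightarrow> in_alg (\<lambda>f. T f + T' f)"
proof -
  assume "in_alg T" "in_alg T'"
  then obtain T0 T1 S0 S1 where *: "galg Lgens 0 T0" "galg Lgens 1 T1" "galg Lgens 0 S0" "galg Lgens 1 S1"
    "\<And>f. T f = T0 f + T1 f" "\<And>f. T' f = S0 f + S1 f" unfolding in_alg_def by blast
  show ?thesis unfolding in_alg_def
    by (rule exI[of _ "\<lambda>f. T0 f + S0 f"], rule exI[of _ "\<lambda>f. T1 f + S1 f"])
      (use galg_add[OF *(1,3)] galg_add[OF *(2,4)] in \<open>simp add: * add_ac\<close>)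
qed

lemma in_alg_smul: "in_alg T \<Longrightarrow> in_alg (\<lambda>f. k *\<^sub>f T f)"
proof -
  assume "in_alg T"
  then obtain T0 T1 where *: "galg Lgens 0 T0" "galg Lgens 1 T1" "\<And>f. T f = T0 f + T1 f"
    unfolding in_alg_def by blast
  show ?thesis unfolding in_alg_def
    by (rule exI[of _ "\<lambda>f. k *\<^sub>f T0 f"], rule exI[of _ "\<lambda>f. k *\<^sub>f T1 f"])
      (use galg_smul[OF *(1)] galg_smul[OF *(2)] in \<open>simp add: * smul_add\<close>)
qed

lemma galg_in_alg: "galg Lgens d T \<Longrightarrow> d < 2 \<Longrightarrow> in_alg T"
proof -
  assume T: "galg Lgens d T" "d < 2"
  then have "d = 0 \<or> d = 1" by auto
  then show ?thesis
  proof
    assume "d = 0"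
    then show ?thesis unfolding in_alg_def using T galg_zero[of 1 Lgens]
      by (intro exI[of _ T] exI[of _ "\<lambda>f. 0"]) simp
  next
    assume "d = 1"
    then show ?thesis unfolding in_alg_def using T galg_zero[of 0 Lgens]
      by (intro exI[of _ "\<lambda>f. 0"] exI[of _ T]) simp
  qed
qed

text \<open>
  A generator \<open>L Y\<close> need not be homogeneous; it is the sum of the contributions of the even and of
  the odd matrix entries.
\<close>

lemma in_alg_L:
  assumes "in_alg T"
  shows "in_alg (\<lambda>f. L Y (T f))"
proof -
  obtain T0 T1 where T: "galg Lgens 0 T0" "galg Lgens 1 T1" "\<And>f. T f = T0 f + T1 f"
    using assms unfolding in_alg_def by blast
  define Z where "Z = (\<lambda>e i j. if (par V i + par V j) mod 2 = e then Y i j else 0)"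
  have Z: "L (Z e) \<in> Lgens e" for e :: nat
    unfolding Lgens_def by (rule CollectI, rule exI[of _ "Z e"]) (simp add: par_homog_def Z_def)
  have "L Y f = L (Z 0) f + L (Z 1) f" for f
    unfolding L_add[symmetric] by (rule L_cong) (auto simp: Z_def)
  then have eq: "(\<lambda>f. L Y (T f)) =
      (\<lambda>f. (L (Z 0) (T0 f) + L (Z 0) (T1 f)) + (L (Z 1) (T0 f) + L (Z 1) (T1 f)))"
    by (simp only: T lin_add[OF lin_dop] add_ac)
  show ?thesis unfolding eq
    by (intro in_alg_add galg_in_alg[OF galg_gen[OF Z T(1)]] galg_in_alg[OF galg_gen[OF Z T(2)]]) auto
qed

lemma in_alg_ev: "in_alg (ev \<rho> t)"
proof (induction t rule: falg_induct)
  case zero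
  have "ev \<rho> 0 = (\<lambda>f. 0)" by (simp add: fun_eq_iff ev_zero)
  then show ?case using galg_in_alg[OF galg_zero[of 0]] by simp
next
  case (add w k t)
  have "in_alg (\<lambda>f. foldr \<rho> ws f)" for ws
  proof (induction ws)
    case Nil
    then show ?case using galg_in_alg[OF galg_id] by simp
  next
    case (Cons Y ws)
    then show ?case using in_alg_L[of "\<lambda>f. foldr \<rho> ws f" "ent Y"] by (simp add: rho_L)
  qed
  from in_alg_add[OF in_alg_smul[OF this] add.IH]
  have "in_alg (\<lambda>f. k *\<^sub>f foldr \<rho> (letters w) f + ev \<rho> t f)" .
  moreover have "ev \<rho> (Poly_Mapping.single w k + t) = (\<lambda>f. k *\<^sub>f foldr \<rho> (letters w) f + ev \<rho> t f)"
    by (simp add: fun_eq_iff[where f = "ev _ _"] ev_add ev_single)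
  ultimately show ?case by simp
qed

lemma galg_ev: "galg Lgens d T \<Longrightarrow> \<exists>t\<in>free_alg V. \<forall>f. ev \<rho> t f = T f"
proof (induction rule: galg.induct)
  case galg_id
  show ?case by (rule bexI[OF _ free_alg_scalar[of 1]]) (simp add: ev_scalar)
next
  case (galg_zero d)
  show ?case by (rule bexI[OF _ free_alg_scalar[of 0]]) (simp add: ev_scalar)
next
  case (galg_gen G e d T)
  obtain t where t: "t \<in> free_alg V" "\<And>f. ev \<rho> t f = T f" using galg_gen.IH by blast
  obtain Y where Y: "G = L Y" using galg_gen.hyps unfolding Lgens_def by blast
  define M where "M = mat (sdim V) (sdim V) (\<lambda>(i, j). Y i j)"
  have "M \<in> gl V" by (simp add: M_def gl_def)
  then have "gen M * t \<in> free_alg V" using t by (intro free_alg_mult free_alg_gen)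
  moreover have "L (ent M) f = L Y f" for f by (rule L_cong) (simp add: ent_def M_def)
  then have "ev \<rho> (gen M * t) f = G (T f)" for f
    by (simp only: ev_mult[OF lin_rho] ev_gen Y t) (simp only: rho_L)
  ultimately show ?case by blast
next
  case (galg_add d T T')
  obtain t t' where t: "t \<in> free_alg V" "\<And>f. ev \<rho> t f = T f" "t' \<in> free_alg V" "\<And>f. ev \<rho> t' f = T' f"
    using galg_add.IH by blast
  show ?case by (rule bexI[OF _ free_alg_add[OF t(1,3)]]) (simp add: ev_add t)
next
  case (galg_smul d T k)
  obtain t where t: "t \<in> free_alg V" "\<And>f. ev \<rho> t f = T f" using galg_smul.IH by blast
  show ?case by (rule bexI[OF _ free_alg_mult[OF free_alg_scalar[of k] t(1)]])
    (simp add: ev_mult[OF lin_rho] ev_scalar t)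
qed

lemma Sym_Sk: "Sym S k = Sk {..<sdim S} k"
proof -
  have "smonoms S k = mon {..<sdim S} k" by (simp add: smonoms_def mon_def)
  then show ?thesis by (simp add: Sym_def supp_on_def)
qed

text \<open>
  Since the ideal evaluates to zero, all members of a coset evaluate to the same operator, and
  \<open>the_elem\<close> picks this operator.
\<close>

lemma image_eq:
  "eval_env (Sym S k) \<rho> ` U_gl V = {restrict T (Sym S k) | T. in_alg T}" (is "?l = ?r")
proof -
  let ?rel = "{(s, t). s \<in> free_alg V \<and> t \<in> free_alg V \<and> s - t \<in> env_ideal V}"
  have coset: "eval_env (Sym S k) \<rho> (?rel `` {s}) = restrict (ev \<rho> s) (Sym S k)" if s: "s \<in> free_alg V" for s
  proof -
    have "s \<in> ?rel `` {s}" using s env_ideal.zero by auto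
    moreover have "eval_free (Sym S k) \<rho> t = eval_free (Sym S k) \<rho> s" if "t \<in> ?rel `` {s}" for t
    proof -
      have "s - t \<in> env_ideal V" using that by simp
      then have "ev \<rho> s f - ev \<rho> t f = 0" for f using ev_env_ideal[of "s - t" f] by (simp only: ev_diff)
      then show ?thesis by (simp add: eval_free_ev)
    qed
    ultimately have "eval_free (Sym S k) \<rho> ` (?rel `` {s}) = {eval_free (Sym S k) \<rho> s}" by blast
    then show ?thesis by (simp add: eval_env_def eval_free_ev)
  qed
  have "?l = (\<lambda>s. restrict (ev \<rho> s) (Sym S k)) ` free_alg V"
  proof -
    have "U_gl V = (\<lambda>s. ?rel `` {s}) ` free_alg V"
      unfolding U_gl_def quotient_def by (rule UNION_singleton_eq_range)
    then show ?thesis by (simp only: image_image) (intro image_cong refl coset)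
  qed
  also have "\<dots> = ?r"
  proof
    show "(\<lambda>s. restrict (ev \<rho> s) (Sym S k)) ` free_alg V \<subseteq> ?r" using in_alg_ev by blast
    show "?r \<subseteq> (\<lambda>s. restrict (ev \<rho> s) (Sym S k)) ` free_alg V"
    proof
      fix G assume "G \<in> ?r"
      then obtain T T0 T1 where T: "G = restrict T (Sym S k)" "galg Lgens 0 T0" "galg Lgens 1 T1"
        "\<And>f. T f = T0 f + T1 f" unfolding in_alg_def by blast
      obtain t0 t1 where t: "t0 \<in> free_alg V" "\<And>f. ev \<rho> t0 f = T0 f" "t1 \<in> free_alg V" "\<And>f. ev \<rho> t1 f = T1 f"
        using galg_ev T(2,3) by metis
      have "G = restrict (ev \<rho> (t0 + t1)) (Sym S k)"
        unfolding T(1) by (simp add: ev_add t T(4) restrict_def fun_eq_iff)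
      then show "G \<in> (\<lambda>s. restrict (ev \<rho> s) (Sym S k)) ` free_alg V" using free_alg_add[OF t(1,3)] by blast
    qed
  qed
  finally show ?thesis .
qed

end

section \<open>Supercentralizers\<close>

context fock
begin

lemma par_proj_eps:
  assumes "finite U" "f \<in> Sk U k" "e \<in> {0, 1}"
  shows "par_proj e f = f \<longleftrightarrow> eps f = (-1) ^ e *\<^sub>f f"
proof -
  have "f (\<alpha>, B) = 0" if "infinite B" for \<alpha> B
    using Sk_infinite[OF assms(1,2) that] .
  then have "par_proj e f M = f M \<longleftrightarrow> eps f M = ((-1) ^ e *\<^sub>f f) M" for M
    using assms(3) by (cases M; cases "finite (snd M)")
      (auto simp: par_proj_def eps_def pointwise minus_one_power_iff even_iff_mod_2_eq_zero odd_iff_mod_2_eq_one)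
  then show ?thesis unfolding fun_eq_iff by blast
qed

lemma eps_split:
  assumes "finite U" "f \<in> Sk U k"
  shows "par_proj 0 f + par_proj 1 f = f" "par_proj 0 f - par_proj 1 f = eps f"
    "par_proj 0 f \<in> Sk U k" "par_proj 1 f \<in> Sk U k"
proof -
  have "f (\<alpha>, B) = 0" if "infinite B" for \<alpha> B
    using Sk_infinite[OF assms(1,2) that] .
  then show "par_proj 0 f - par_proj 1 f = eps f"
    by (auto simp: fun_eq_iff pointwise par_proj_def eps_def minus_one_power_iff even_iff_mod_2_eq_zero)
  show "par_proj 0 f + par_proj 1 f = f" by (auto simp: fun_eq_iff pointwise par_proj_def)
  show "par_proj 0 f \<in> Sk U k" "par_proj 1 f \<in> Sk U k"
    using assms(2) by (auto simp: supp_on_def par_proj_def)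
qed

end

context gl_action
begin

abbreviation H :: "nat \<Rightarrow> svec set" where
  "H k \<equiv> Sym S k"

lemma End_Sym_iff:
  "F \<in> End_Sym S k \<longleftrightarrow> F \<in> H k \<rightarrow>\<^sub>E H k \<and> (\<forall>f\<in>H k. \<forall>g\<in>H k. F (f + g) = F f + F g) \<and>
     (\<forall>a. \<forall>f\<in>H k. F (a *\<^sub>f f) = a *\<^sub>f F f)"
  by (simp add: End_Sym_def plus_fun_def smul_def)

lemma H_add: "f \<in> H k \<Longrightarrow> g \<in> H k \<Longrightarrow> f + g \<in> H k"
  and H_smul: "f \<in> H k \<Longrightarrow> a *\<^sub>f f \<in> H k"
  and H_eps: "f \<in> H k \<Longrightarrow> eps f \<in> H k"
  and H_eps_eps: "f \<in> H k \<Longrightarrow> eps (eps f) = f"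
  unfolding Sym_Sk by (auto intro: eps_Sk eps_eps)

lemma End_diff: "F \<in> End_Sym S k \<Longrightarrow> f \<in> H k \<Longrightarrow> g \<in> H k \<Longrightarrow> F (f - g) = F f - F g"
  unfolding End_Sym_iff diff_eq_add_smul using H_smul by metis

lemma restrict_End_Sym:
  assumes "lin T" "\<And>f. f \<in> H k \<Longrightarrow> T f \<in> H k"
  shows "restrict T (H k) \<in> End_Sym S k"
  unfolding End_Sym_iff using assms
  by (auto simp: H_add H_smul lin_add[OF assms(1)] lin_smul[OF assms(1)])

text \<open>
  The parity of an endomorphism can be read off from how it commutes with the parity operator.
  This replaces projections to graded parts by sign computations.
\<close>

lemma End_homog_iff:
  assumes "d \<in> {0, 1}"
  shows "F \<in> End_homog S k d \<longleftrightarrow> F \<in> End_Sym S k \<and> (\<forall>f\<in>H k. F (eps f) = (-1) ^ d *\<^sub>f eps (F f))"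
proof (intro iffI conjI ballI)
  assume F: "F \<in> End_homog S k d"
  then show FE: "F \<in> End_Sym S k" by (simp add: End_homog_def)
  have FH: "F f \<in> H k" if "f \<in> H k" for f using FE that by (auto simp: End_Sym_iff)
  fix f assume f: "f \<in> H k"
  have c: "eps (F (par_proj e f)) = (-1) ^ (d + e) *\<^sub>f F (par_proj e f)" "par_proj e f \<in> H k" if e: "e \<in> {0, 1}" for e
  proof -
    have pe: "par_proj e f \<in> H k" using eps_split(3,4)[OF finite(1)] f e unfolding Sym_Sk by auto
    moreover have "par_proj e (par_proj e f) = par_proj e f" by (auto simp: par_proj_def)
    ultimately have "par_proj ((d + e) mod 2) (F (par_proj e f)) = F (par_proj e f)"
      using F e by (auto simp: End_homog_def)
    moreover have "(d + e) mod 2 \<in> {0, 1}" by auto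
    ultimately have "eps (F (par_proj e f)) = (-1) ^ ((d + e) mod 2) *\<^sub>f F (par_proj e f)"
      using par_proj_eps[OF finite(1), of "F (par_proj e f)" k "(d + e) mod 2"] FH[OF pe]
      unfolding Sym_Sk by metis
    then show "eps (F (par_proj e f)) = (-1) ^ (d + e) *\<^sub>f F (par_proj e f)"
      using minus_one_power_mod_two[of "d + e" "(d + e) mod 2" 1] by simp
    show "par_proj e f \<in> H k" by (rule pe)
  qed
  have s: "par_proj 0 f + par_proj 1 f = f" "par_proj 0 f - par_proj 1 f = eps f"
    using eps_split(1,2)[OF finite(1)] f unfolding Sym_Sk by auto
  have "F f = F (par_proj 0 f) + F (par_proj 1 f)"
    using FE c(2) s(1) unfolding End_Sym_iff by (metis insertCI)
  then have "eps (F f) = eps (F (par_proj 0 f)) + eps (F (par_proj 1 f))"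
    by (simp only: lin_add[OF lin_eps])
  then have "eps (F f) = (-1) ^ d *\<^sub>f F (par_proj 0 f) - (-1) ^ d *\<^sub>f F (par_proj 1 f)"
    using c(1)[of 0] c(1)[of 1] by (simp add: fun_eq_iff pointwise)
  moreover have "F (eps f) = F (par_proj 0 f) - F (par_proj 1 f)"
    unfolding s(2)[symmetric] using c(2) by (intro End_diff[OF FE]) auto
  ultimately show "F (eps f) = (-1) ^ d *\<^sub>f eps (F f)"
    by (simp add: fun_eq_iff pointwise right_diff_distrib mult.assoc[symmetric])
next
  assume F: "F \<in> End_Sym S k \<and> (\<forall>f\<in>H k. F (eps f) = (-1) ^ d *\<^sub>f eps (F f))"
  have "par_proj ((d + e) mod 2) (F f) = F f" if e: "e \<in> {0, 1}" and f: "f \<in> H k" "par_proj e f = f" for e f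
  proof -
    have Ff: "F f \<in> H k" using F f by (auto simp: End_Sym_iff)
    have "eps f = (-1) ^ e *\<^sub>f f" using par_proj_eps[OF finite(1) _ e] f unfolding Sym_Sk by auto
    then have "(-1) ^ e *\<^sub>f F f = (-1) ^ d *\<^sub>f eps (F f)"
      using F f(1) unfolding End_Sym_iff by metis
    then have "((-1) ^ d * (-1) ^ e) *\<^sub>f F f = ((-1) ^ d * (-1) ^ d) *\<^sub>f eps (F f)"
      by (simp only: smul_smul[symmetric])
    then have "eps (F f) = (-1) ^ ((d + e) mod 2) *\<^sub>f F f"
      using minus_one_power_mod_two[of "d + e" "(d + e) mod 2" 1] by (simp add: power_add)
    moreover have "(d + e) mod 2 \<in> {0, 1}" by auto
    ultimately show ?thesis
      using par_proj_eps[OF finite(1), of "F f" k "(d + e) mod 2"] Ff unfolding Sym_Sk by metis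
  qed
  then show "F \<in> End_homog S k d" using F unfolding End_homog_def by blast
qed

lemma galg_H: "galg Lgens d T \<Longrightarrow> f \<in> H k \<Longrightarrow> T f \<in> H k"
  unfolding Sym_Sk by (rule galg_Sk)

lemma galg_End_homog:
  assumes "galg Lgens d T" "d \<in> {0, 1}"
  shows "restrict T (H k) \<in> End_homog S k d"
  unfolding End_homog_iff[OF assms(2)]
  using restrict_End_Sym[OF galg_lin[OF assms(1) Lgens_lin] galg_H[OF assms(1)]] galg_eps[OF assms(1)]
  by (simp add: H_eps)

text \<open>
  If \<open>T\<close> is homogeneous on \<open>S\<^sup>k\<close>, its component of the other parity both commutes and anticommutes with
  the parity operator there, so it vanishes.
\<close>

lemma homogeneous_component:
  assumes T: "galg Lgens 0 T0" "galg Lgens 1 T1" "\<And>f. T f = T0 f + T1 f"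
    and hom: "restrict T (H k) \<in> End_homog S k e" "e \<in> {0, 1}" and f: "f \<in> H k"
  shows "T f = (if e = 0 then T0 f else T1 f)"
proof -
  have "T (eps f) = (-1) ^ e *\<^sub>f eps (T f)"
  proof -
    have "\<forall>g\<in>H k. restrict T (H k) (eps g) = (-1) ^ e *\<^sub>f eps (restrict T (H k) g)"
      using hom(1) unfolding End_homog_iff[OF hom(2)] by blast
    from bspec[OF this f] show ?thesis using f H_eps[OF f] by simp
  qed
  then have *: "eps (T0 f) - eps (T1 f) = (-1) ^ e *\<^sub>f (eps (T0 f) + eps (T1 f))"
    using galg_eps[OF T(1), of f] galg_eps[OF T(2), of f]
    by (simp add: T(3) lin_add[OF lin_eps] fun_eq_iff pointwise)
  consider "e = 0" | "e = 1" using hom by auto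
  then show ?thesis
  proof cases
    case 1
    then have "eps (T1 f) = 0" using * by (simp add: fun_eq_iff pointwise eq_iff_diff_eq_0[of "_ - _"])
    then have "T1 f = 0" using H_eps_eps[OF galg_H[OF T(2) f]] lin_zero[OF lin_eps] by metis
    then show ?thesis using 1 T(3) by simp
  next
    case 2
    then have "eps (T0 f) = 0" using * by (simp add: fun_eq_iff pointwise)
    then have "T0 f = 0" using H_eps_eps[OF galg_H[OF T(1) f]] lin_zero[OF lin_eps] by metis
    then show ?thesis using 2 T(3) by simp
  qed
qed

end

locale howe = pairing "par S" "{..<sdim S}" "{..<sdim V}" "{..<sdim W}" "par V" "par W" r c lab \<gamma> \<delta>
  for S V W :: superspace and r c lab \<gamma> \<delta> +
  fixes act act' :: "complex mat \<Rightarrow> complex mat"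
  assumes act: "\<And>Y u v. u < sdim S \<Longrightarrow> v < sdim S \<Longrightarrow> act Y $$ (u, v) = lift \<gamma> (par V) (par W) r c (ent Y) u v"
    and act': "\<And>Y u v. u < sdim S \<Longrightarrow> v < sdim S \<Longrightarrow> act' Y $$ (u, v) = lift \<delta> (par W) (par V) c r (ent Y) u v"
begin

sublocale VV: gl_action S V W r c lab \<gamma> act
  by unfold_locales (rule act)

sublocale WW: gl_action S W V c r "\<lambda>a i. lab i a" \<delta> act'
  by unfold_locales (rule act')

lemma galg_galg_supercommute:
  assumes T: "galg Lgens d T" and T': "galg R.Lgens e T'"
  shows "T (T' f) = (-1) ^ (d * e) *\<^sub>f T' (T f)"
  using T
proof (rule galg_supercommute)
  show "lin T'" by (rule galg_lin[OF T' R.Lgens_lin])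
  show "G (T' f) = (-1) ^ (e' * e) *\<^sub>f T' (G f)" if G: "G \<in> Lgens e'" for G e' f
  proof -
    obtain Y where Y: "G = L Y" "par_homog (par V) {..<sdim V} e' Y" using G unfolding Lgens_def by blast
    have "T' (G f) = (-1) ^ (e * e') *\<^sub>f G (T' f)"
      using T'
    proof (rule galg_supercommute)
      show "G' (G f) = (-1) ^ (e'' * e') *\<^sub>f G (G' f)" if G': "G' \<in> R.Lgens e''" for G' e'' f
      proof -
        obtain Y' where Y': "G' = R.L Y'" "par_homog (par W) {..<sdim W} e'' Y'" using G' unfolding R.Lgens_def by blast
        show ?thesis unfolding Y(1) Y'(1)
          using L_R_supercommute[OF Y(2) Y'(2), of f] by (simp add: mult.commute)
      qed
    qed (simp_all add: Y lin_dop R.Lgens_lin)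
    then show ?thesis by (simp add: mult.commute)
  qed
qed (rule Lgens_lin)

lemma image_subset:
  assumes "F \<in> eval_env (Sym S k) VV.\<rho> ` U_gl V"
  shows "F \<in> supercentralizer S k (eval_env (Sym S k) WW.\<rho> ` U_gl W)"
proof -
  obtain T T0 T1 where F: "F = restrict T (Sym S k)" and T: "galg Lgens 0 T0" "galg Lgens 1 T1" "\<And>f. T f = T0 f + T1 f"
    using assms unfolding VV.image_eq VV.in_alg_def by blast
  have lT: "lin T0" "lin T1" using galg_lin[OF T(1) Lgens_lin] galg_lin[OF T(2) Lgens_lin] by auto
  have lin: "lin T" by (rule linI) (simp_all only: T(3) lin_add[OF lT(1)] lin_add[OF lT(2)] lin_smul[OF lT(1)] lin_smul[OF lT(2)] smul_add add_ac)
  define F0 where "F0 = restrict T0 (Sym S k)"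
  define F1 where "F1 = restrict T1 (Sym S k)"
  have FE: "F \<in> End_Sym S k" unfolding F
    using lin VV.galg_H[OF T(1)] VV.galg_H[OF T(2)] VV.H_add by (intro VV.restrict_End_Sym) (auto simp: T(3))
  have h: "F0 \<in> End_homog S k 0" "F1 \<in> End_homog S k 1"
    unfolding F0_def F1_def by (rule VV.galg_End_homog[OF T(1)], simp) (rule VV.galg_End_homog[OF T(2)], simp)
  have s: "F f = (\<lambda>M. F0 f M + F1 f M)" if "f \<in> Sym S k" for f
    using that by (simp add: F F0_def F1_def T(3) plus_fun_def)
  have c: "supercommute_on S k 0 e F0 G \<and> supercommute_on S k 1 e F1 G"
    if e: "e \<in> {0, 1}" and G: "G \<in> eval_env (Sym S k) WW.\<rho> ` U_gl W" "G \<in> End_homog S k e" for e G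
  proof -
    obtain Q Q0 Q1 where Q: "G = restrict Q (Sym S k)" "galg R.Lgens 0 Q0" "galg R.Lgens 1 Q1" "\<And>f. Q f = Q0 f + Q1 f"
      using G(1) unfolding WW.image_eq WW.in_alg_def by blast
    define Qe where "Qe = (if e = 0 then Q0 else Q1)"
    have Qe: "galg R.Lgens e Qe" using e Q by (auto simp: Qe_def)
    have Gf: "G f = Qe f" if "f \<in> Sym S k" for f
      using WW.homogeneous_component[OF Q(2-4) _ e that] G(2) that unfolding Q(1) by (simp add: Qe_def)
    have "supercommute_on S k d e (restrict T' (Sym S k)) G" if "galg Lgens d T'" for d T'
      unfolding supercommute_on_def
      using Gf VV.galg_H[OF that] WW.galg_H[OF Qe] galg_galg_supercommute[OF that Qe]
      by (auto simp: smul_def)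
    then show ?thesis unfolding F0_def F1_def using T(1,2) by blast
  qed
  show ?thesis unfolding supercentralizer_def
    using FE h s c by (intro CollectI conjI bexI[of _ F0] bexI[of _ F1]) auto
qed

text \<open>
  Composing an odd \<open>F\<close> with the parity operator yields an operator \<open>\<Phi>\<close> commuting with \<open>gl W\<close> in the
  ordinary sense; \<open>\<Phi>\<close> is defined on all coefficient functions through the projection to \<open>S\<^sup>k\<close>.  By
  \<open>commutant_of_R\<close> it has the form \<open>T0 + T1 eps\<close>, and comparing parities removes the component of the
  wrong parity.
\<close>

lemma homogeneous_commutant:
  assumes F: "F \<in> End_homog S k d" and d: "d \<in> {0, 1}"
    and comm: "\<And>e G. e \<in> {0, 1} \<Longrightarrow> G \<in> eval_env (Sym S k) WW.\<rho> ` U_gl W \<inter> End_homog S k e \<Longrightarrow>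
      supercommute_on S k d e F G"
  shows "\<exists>T. galg Lgens d T \<and> (\<forall>f\<in>Sym S k. F f = T f)"
proof -
  let ?H = "Sym S k"
  have FE: "F \<in> End_Sym S k" and Feps: "\<And>f. f \<in> ?H \<Longrightarrow> F (eps f) = (-1) ^ d *\<^sub>f eps (F f)"
    using F VV.End_homog_iff[OF d] by auto
  have FH: "F f \<in> ?H" if "f \<in> ?H" for f using FE that by (auto simp: VV.End_Sym_iff)
  define \<epsilon> where "\<epsilon> = (if d = 0 then (\<lambda>f. f) else eps)"
  have \<epsilon>: "lin \<epsilon>" "\<And>f. f \<in> ?H \<Longrightarrow> \<epsilon> f \<in> ?H" "\<And>f. f \<in> ?H \<Longrightarrow> \<epsilon> (\<epsilon> f) = f"
    using lin_eps VV.H_eps VV.H_eps_eps by (auto simp: \<epsilon>_def lin_def)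
  define \<Phi> where "\<Phi> = (\<lambda>f. F (\<epsilon> (restr (mon {..<sdim S} k) f)))"
  have Sk: "Sk {..<sdim S} k = ?H" by (rule VV.Sym_Sk[symmetric])
  have \<Phi>: "\<Phi> f = F (\<epsilon> f)" if "f \<in> ?H" for f
    unfolding \<Phi>_def using restr_id[of f "mon {..<sdim S} k"] that Sk by simp
  have rH: "\<epsilon> (restr (mon {..<sdim S} k) f) \<in> ?H" for f
    using \<epsilon>(2) restr_in Sk by blast
  have "lin \<Phi>"
    by (rule linI; use FE rH in \<open>simp add: \<Phi>_def VV.End_Sym_iff lin_add[OF lin_restr] lin_smul[OF lin_restr]
      lin_add[OF \<epsilon>(1)] lin_smul[OF \<epsilon>(1)]\<close>)
  moreover have "\<Phi> h \<in> Sk {..<sdim S} k" if "h \<in> Sk {..<sdim S} k" for h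
    using that FH \<epsilon>(2) \<Phi> unfolding Sk by simp
  moreover have "\<Phi> (R.L (unit a b) h) = R.L (unit a b) (\<Phi> h)" if h: "h \<in> Sk {..<sdim S} k" for a b h
  proof -
    let ?E = "R.L (unit a b)" and ?e = "(par W a + par W b) mod 2"
    have e: "?e \<in> {0, 1}" by auto
    have h': "h \<in> ?H" using h unfolding Sk .
    have g: "galg R.Lgens ?e ?E"
      using galg_gen[of ?E R.Lgens ?e 0 "\<lambda>f. f", OF R.L_unit_in_Lgens galg_id] by simp
    have EH: "?E f \<in> ?H" if "f \<in> ?H" for f by (rule WW.galg_H[OF g that])
    have "restrict ?E ?H \<in> eval_env ?H WW.\<rho> ` U_gl W"
      unfolding WW.image_eq using WW.galg_in_alg[OF g] by auto
    moreover have "restrict ?E ?H \<in> End_homog S k ?e" by (rule WW.galg_End_homog[OF g e])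
    ultimately have "supercommute_on S k d ?e F (restrict ?E ?H)" using comm[OF e] by blast
    then have sc: "F (?E f) = (-1) ^ (d * ?e) *\<^sub>f ?E (F f)" if "f \<in> ?H" for f
      using that FH by (auto simp: supercommute_on_def smul_def)
    have "\<epsilon> (?E h) = (-1) ^ (d * ?e) *\<^sub>f ?E (\<epsilon> h)"
      using R.galg_eps[OF g, of h] d by (auto simp: \<epsilon>_def)
    then have "\<Phi> (?E h) = F ((-1) ^ (d * ?e) *\<^sub>f ?E (\<epsilon> h))"
      using \<Phi>[OF EH[OF h']] by simp
    also have "\<dots> = (-1) ^ (d * ?e) *\<^sub>f F (?E (\<epsilon> h))"
      using FE EH \<epsilon>(2) h' by (simp add: VV.End_Sym_iff)
    also have "\<dots> = ?E (\<Phi> h)" using sc[OF \<epsilon>(2)[OF h']] \<Phi>[OF h'] by simp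
    finally show ?thesis .
  qed
  ultimately obtain T0 T1 where T: "galg Lgens 0 T0" "galg Lgens 1 T1"
      "\<And>h. h \<in> ?H \<Longrightarrow> \<Phi> h = T0 h + T1 (eps h)"
    using commutant_of_R[of \<Phi> k] unfolding Sk by blast
  have lT: "lin T0" "lin T1" using galg_lin[OF T(1) Lgens_lin] galg_lin[OF T(2) Lgens_lin] by auto
  have FT: "F f = T0 (\<epsilon> f) + T1 (eps (\<epsilon> f))" if "f \<in> ?H" for f
    using T(3)[OF \<epsilon>(2)[OF that]] \<Phi>[OF \<epsilon>(2)[OF that]] \<epsilon>(3)[OF that] by simp
  note te = galg_eps[OF T(1)] galg_eps[OF T(2)]
  have zero: "g = 0" if "g \<in> ?H" "eps g = 0" for g
    using VV.H_eps_eps[OF that(1)] that(2) lin_zero[OF lin_eps] by simp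
  have "d = 0 \<or> d = 1" using d by auto
  then show ?thesis
  proof
    assume d0: "d = 0"
    have "F f = T0 f" if f: "f \<in> ?H" for f
    proof -
      have 1: "F f = T0 f - eps (T1 f)" using FT[OF f] te by (simp add: \<epsilon>_def d0 fun_eq_iff pointwise)
      have "F (eps f) = T0 (eps f) + T1 f"
        using FT[OF VV.H_eps[OF f]] VV.H_eps_eps[OF f] by (simp add: \<epsilon>_def d0)
      moreover have "F (eps f) = eps (T0 f) - T1 f"
        using Feps[OF f] VV.H_eps_eps[OF VV.galg_H[OF T(2) f]]
        unfolding 1 by (simp add: d0 lin_diff[OF lin_eps])
      ultimately have "T1 f = 0" using te(1)[of f] by (simp add: fun_eq_iff pointwise)
      then show ?thesis using 1 lin_zero[OF lin_eps] by simp
    qed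
    then show ?thesis using T(1) d0 by blast
  next
    assume d1: "d = 1"
    have "F f = T1 f" if f: "f \<in> ?H" for f
    proof -
      have 1: "F f = eps (T0 f) + T1 f" using FT[OF f] te(1)[of f] VV.H_eps_eps[OF f] by (simp add: \<epsilon>_def d1)
      have "F (eps f) = T0 f - eps (T1 f)"
        using FT[OF VV.H_eps[OF f]] VV.H_eps_eps[OF f] te(2)[of f] by (simp add: \<epsilon>_def d1 fun_eq_iff pointwise)
      moreover have "F (eps f) = - T0 f - eps (T1 f)"
        using Feps[OF f] VV.H_eps_eps[OF VV.galg_H[OF T(1) f]]
        unfolding 1 d1 lin_add[OF lin_eps] by (simp add: fun_eq_iff pointwise)
      ultimately have "T0 f = 0" by (simp add: fun_eq_iff pointwise)
      then show ?thesis using 1 lin_zero[OF lin_eps] by simp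
    qed
    then show ?thesis using T(2) d1 by blast
  qed
qed

theorem supercentralizer_eq:
  "eval_env (Sym S k) VV.\<rho> ` U_gl V = supercentralizer S k (eval_env (Sym S k) WW.\<rho> ` U_gl W)"
proof
  show "eval_env (Sym S k) VV.\<rho> ` U_gl V \<subseteq> supercentralizer S k (eval_env (Sym S k) WW.\<rho> ` U_gl W)"
    using image_subset by blast
  show "supercentralizer S k (eval_env (Sym S k) WW.\<rho> ` U_gl W) \<subseteq> eval_env (Sym S k) VV.\<rho> ` U_gl V"
  proof
    fix F assume "F \<in> supercentralizer S k (eval_env (Sym S k) WW.\<rho> ` U_gl W)"
    then obtain F0 F1 where F: "F \<in> End_Sym S k" "F0 \<in> End_homog S k 0" "F1 \<in> End_homog S k 1"
      "\<forall>f\<in>Sym S k. F f = (\<lambda>M. F0 f M + F1 f M)"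
      and c: "\<forall>e\<in>{0, 1}. \<forall>G\<in>eval_env (Sym S k) WW.\<rho> ` U_gl W \<inter> End_homog S k e.
          supercommute_on S k 0 e F0 G \<and> supercommute_on S k 1 e F1 G"
      unfolding supercentralizer_def by blast
    obtain T0 where T0: "galg Lgens 0 T0" "\<forall>f\<in>Sym S k. F0 f = T0 f"
      using homogeneous_commutant[OF F(2)] c by blast
    obtain T1 where T1: "galg Lgens 1 T1" "\<forall>f\<in>Sym S k. F1 f = T1 f"
      using homogeneous_commutant[OF F(3)] c by blast
    have "F = restrict (\<lambda>f. T0 f + T1 f) (Sym S k)"
    proof
      fix f show "F f = restrict (\<lambda>f. T0 f + T1 f) (Sym S k) f"
      proof (cases "f \<in> Sym S k")
        case True
        then show ?thesis using F(4) T0(2) T1(2) by (simp add: plus_fun_def)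
      next
        case False
        then have "F f = undefined" using F(1) unfolding VV.End_Sym_iff by (meson PiE_arb)
        then show ?thesis using False by simp
      qed
    qed
    moreover have "VV.in_alg (\<lambda>f. T0 f + T1 f)" unfolding VV.in_alg_def using T0 T1 by blast
    ultimately show "F \<in> eval_env (Sym S k) VV.\<rho> ` U_gl V" unfolding VV.image_eq by blast
  qed
qed

end

lemma howe_stensor:
  "howe (stensor V W) V W (\<lambda>u. u div sdim W) (\<lambda>u. u mod sdim W) (\<lambda>i a. i * sdim W + a) 0 1
    (act_fst V W) (act_snd V W)"
proof
  show "par (stensor V W) u \<in> {0, 1}" for u by (auto simp: stensor_def)
  show "u div sdim W \<in> {..<sdim V} \<and> u mod sdim W \<in> {..<sdim W} \<and> u div sdim W * sdim W + u mod sdim W = u"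
    if "u \<in> {..<sdim (stensor V W)}" for u
    using that by (cases "sdim W = 0") (simp_all add: stensor_def less_mult_imp_div_less)
  show "i * sdim W + a \<in> {..<sdim (stensor V W)} \<and> (i * sdim W + a) div sdim W = i \<and> (i * sdim W + a) mod sdim W = a"
    if "i \<in> {..<sdim V}" "a \<in> {..<sdim W}" for i a
  proof -
    have "i * sdim W + a < Suc i * sdim W" using that by simp
    also have "\<dots> \<le> sdim V * sdim W" using that by (intro mult_right_mono) auto
    finally show ?thesis using that by (simp add: stensor_def)
  qed
qed (auto simp: stensor_def act_fst_def act_snd_def lift_def ent_def)

theorem corollary3p1:
  fixes p q m n k :: nat
  defines "V \<equiv> CC p q" and "W \<equiv> CC m n"
  shows "image_fst V W k = supercentralizer (stensor V W) k (image_snd V W k)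
    \<and> image_snd V W k = supercentralizer (stensor V W) k (image_fst V W k)"
proof
  interpret P: howe "stensor V W" V W "\<lambda>u. u div sdim W" "\<lambda>u. u mod sdim W" "\<lambda>i a. i * sdim W + a" 0 1
    "act_fst V W" "act_snd V W"
    by (rule howe_stensor)
  \<comment> \<open>The same pairing with rows and columns exchanged; the sign rule now belongs to the rows.\<close>
  interpret Q: howe "stensor V W" W V "\<lambda>u. u mod sdim W" "\<lambda>u. u div sdim W" "\<lambda>a i. i * sdim W + a" 1 0
    "act_snd V W" "act_fst V W"
    by unfold_locales (use P.act P.act' in simp_all)
  show "image_fst V W k = supercentralizer (stensor V W) k (image_snd V W k)"
    unfolding image_fst_def image_snd_def by (rule P.supercentralizer_eq)
  show "image_snd V W k = supercentralizer (stensor V W) k (image_fst V W k)"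
    unfolding image_fst_def image_snd_def by (rule Q.supercentralizer_eq)
qed

end
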